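(* Let $\{Z_i,i\ge1\}$ be independent symmetric random variables with a common mean $\mu$ (i.e. each $Z_i$ is symmetric around $\mu$). Let $\overline Z:=n^{-1}\sum_{i=1}^nZ_i$ and let $\widetilde T_n^t(Z_1-\mu,\ldots,Z_n-\mu)$, $0\le t\le1$, be the Student process defined in the context. Then $$\widetilde T_n^t(Z_1-\mu,\ldots,Z_n-\mu)\xrightarrow{\mathcal D}W(t)\ \text{ on }(D[0,1],\rho)\quad\text{as } n\to\infty$$ if and only if $$\frac{\max_{1\le i\le n}(Z_i-\overline Z)^2}{\sum_{i=1}^n(Z_i-\overline Z)^2}\xrightarrow{P}0\quad\text{as } n\to\infty.$$
   Context: The $Z_i$ are not assumed to be identically distributed or to have finite variances. Empty sums $\sum_{i=1}^0$ are $0$. For $0\le t\le1$, $\widetilde K_n(t)$ is the largest integer $m\in\{0,1,\ldots,n\}$ with $\sum_{i=1}^m(Z_i-\overline Z)^2\le t\sum_{i=1}^n(Z_i-\overline Z)^2$, and $$\widetilde T_n^t(Z_1-\mu,\ldots,Z_n-\mu):=\frac{\sum_{i=1}^{\widetilde K_n(t)}(Z_i-\mu)/\sqrt n}{\left(\sum_{i=1}^n(Z_i-\overline Z)^2/(n-1)\right)^{1/2}},\quad 0\le t\le1$$ (centering by $\mu$ changes neither $\widetilde K_n$ nor the denominator). Convergence in probability to $0$ of the ratio is understood to include that its denominator is nonzero with probability tending to one. $\{W(t),0\le t\le1\}$ is a standard Wiener process, $D[0,1]$ is the space of right-continuous functions with left limits (càdlàg) on $[0,1]$, $\rho$ is the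 sup-norm metric on $D[0,1]$, and $\mathcal D$ is the sigma-field of subsets of $D[0,1]$ generated by its finite-dimensional subsets. For processes $X_n$ in $D[0,1]$, "$X_n(t)\xrightarrow{\mathcal D}W(t)$ on $(D[0,1],\rho)$" means that $h(X_n(\cdot))\xrightarrow{\mathcal D}h(W(\cdot))$ for all functionals $h:D[0,1]\to\mathbb R$ that are $\mathcal D$-measurable and $\rho$-continuous, or $\rho$-continuous except at points forming a set of Wiener measure zero on $(D[0,1],\mathcal D)$. *)

theory Defs
  imports "HOL-Probability.Probability"
begin

section \<open>The space of cadlag functions on the unit interval\<close>

text \<open>Elements of D[0,1] are represented by functions that are undefined outside the unit
  interval, so that equality of representatives is equality on the interval.\<close>

definition cadlag01 :: "(real \<Rightarrow> real) set" where
  "cadlag01 = {f \<in> extensional {0..1}.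
     (\<forall>t\<in>{0..<1}. (f \<longlongrightarrow> f t) (at_right t)) \<and>
     (\<forall>t\<in>{0<..1}. \<exists>l. (f \<longlongrightarrow> l) (at_left t))}"

text \<open>Cadlag functions on the unit interval are bounded, so the supremum is a genuine one
  for arguments in the space.\<close>

definition sup_dist :: "(real \<Rightarrow> real) \<Rightarrow> (real \<Rightarrow> real) \<Rightarrow> real" where
  "sup_dist f g = (SUP t\<in>{0..1}. \<bar>f t - g t\<bar>)"

definition cadlag_sigma :: "(real \<Rightarrow> real) measure" where
  "cadlag_sigma = sigma cadlag01
     {{f \<in> cadlag01. restrict f J \<in> B} | J B.
        finite J \<and> J \<subseteq> {0..1} \<and> B \<in> sets (PiM J (\<lambda>_. borel))}"

definition sup_continuous_at :: "((real \<Rightarrow> real) \<Rightarrow> real) \<Rightarrow> (real \<Rightarrow> real) \<Rightarrow> bool" where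
  "sup_continuous_at h f \<longleftrightarrow>
     (\<forall>e>0. \<exists>d>0. \<forall>g\<in>cadlag01. sup_dist g f < d \<longrightarrow> \<bar>h g - h f\<bar> < e)"

text \<open>The distribution of \<open>Y\<close> decides which sets of discontinuities are negligible.
  Functionals continuous on the whole space are covered: their discontinuity set is empty.\<close>

definition converges_in_distr_cadlag ::
    "'a measure \<Rightarrow> (nat \<Rightarrow> 'a \<Rightarrow> real \<Rightarrow> real) \<Rightarrow> 'b measure \<Rightarrow> ('b \<Rightarrow> real \<Rightarrow> real) \<Rightarrow> bool" where
  "converges_in_distr_cadlag M X N Y \<longleftrightarrow>
     (\<forall>h \<in> borel_measurable cadlag_sigma.
        {f \<in> cadlag01. \<not> sup_continuous_at h f} \<in> null_sets (distr N cadlag_sigma Y) \<longrightarrow>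
        weak_conv_m (\<lambda>n. distr M borel (\<lambda>\<omega>. h (X n \<omega>))) (distr N borel (\<lambda>\<omega>. h (Y \<omega>))))"

section \<open>Standard Wiener process on the unit interval\<close>

locale std_wiener_process = prob_space N for N :: "'b measure" +
  fixes W :: "real \<Rightarrow> 'b \<Rightarrow> real"
  assumes random_variable_W: "\<And>t. t \<in> {0..1} \<Longrightarrow> random_variable borel (W t)"
    and W_0: "\<And>\<omega>. \<omega> \<in> space N \<Longrightarrow> W 0 \<omega> = 0"
    and continuous_paths: "\<And>\<omega>. \<omega> \<in> space N \<Longrightarrow> continuous_on {0..1} (\<lambda>t. W t \<omega>)"
    and normal_increments: "\<And>s t. 0 \<le> s \<Longrightarrow> s < t \<Longrightarrow> t \<le> 1 \<Longrightarrow>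
          distributed N lborel (\<lambda>\<omega>. W t \<omega> - W s \<omega>) (normal_density 0 (sqrt (t - s)))"
    and indep_increments: "\<And>(k::nat) (\<tau>::nat \<Rightarrow> real).
          (\<And>i. i \<le> k \<Longrightarrow> \<tau> i \<in> {0..1}) \<Longrightarrow> (\<And>i. i < k \<Longrightarrow> \<tau> i < \<tau> (Suc i)) \<Longrightarrow>
          indep_vars (\<lambda>_. borel) (\<lambda>i \<omega>. W (\<tau> (Suc i)) \<omega> - W (\<tau> i) \<omega>) {..<k}"

section \<open>Random variables symmetric around a point, convergence in probability\<close>

definition symmetric_around :: "'a measure \<Rightarrow> ('a \<Rightarrow> real) \<Rightarrow> real \<Rightarrow> bool" where
  "symmetric_around M X \<mu> \<longleftrightarrow>
     distr M borel (\<lambda>\<omega>. X \<omega> - \<mu>) = distr M borel (\<lambda>\<omega>. \<mu> - X \<omega>)"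

text \<open>Since division by zero yields zero, it has to be demanded separately that the
  denominator does not vanish, with probability tending to one.\<close>

definition ratio_tendsto_0_in_prob ::
    "'a measure \<Rightarrow> (nat \<Rightarrow> 'a \<Rightarrow> real) \<Rightarrow> (nat \<Rightarrow> 'a \<Rightarrow> real) \<Rightarrow> bool" where
  "ratio_tendsto_0_in_prob M A B \<longleftrightarrow>
     (\<lambda>n. measure M {\<omega> \<in> space M. B n \<omega> \<noteq> 0}) \<longlonglongrightarrow> 1 \<and>
     (\<forall>\<epsilon>>0. (\<lambda>n. measure M {\<omega> \<in> space M. \<bar>A n \<omega> / B n \<omega>\<bar> > \<epsilon>}) \<longlonglongrightarrow> 0)"

section \<open>The Student process\<close>

text \<open>The observations are \<open>z 1, \<dots>, z n\<close>; the value \<open>z 0\<close> is never used.\<close>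

definition sample_mean :: "nat \<Rightarrow> (nat \<Rightarrow> real) \<Rightarrow> real" where
  "sample_mean n z = (\<Sum>i=1..n. z i) / real n"

definition student_index :: "nat \<Rightarrow> (nat \<Rightarrow> real) \<Rightarrow> real \<Rightarrow> nat" where
  "student_index n z t = Max {m \<in> {0..n}.
     (\<Sum>i=1..m. (z i - sample_mean n z)\<^sup>2) \<le> t * (\<Sum>i=1..n. (z i - sample_mean n z)\<^sup>2)}"

definition student_process :: "nat \<Rightarrow> real \<Rightarrow> (nat \<Rightarrow> real) \<Rightarrow> real \<Rightarrow> real" where
  "student_process n \<mu> z = (\<lambda>t\<in>{0..1}.
     ((\<Sum>i=1..student_index n z t. (z i - \<mu>)) / sqrt (real n)) /
     sqrt ((\<Sum>i=1..n. (z i - sample_mean n z)\<^sup>2) / (real n - 1)))"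

end

theory Submission
  imports Defs
begin

text \<open>If the paths converge in distribution, then so do their values on the grid of the points
  \<open>k/m\<close>, and the increments of the Wiener process over the grid cells are almost surely nonzero.
  An observation contributing more than the proportion \<open>2/m\<close> of the sum of squares, however, keeps
  the Student process constant on some grid cell. Hence such observations are asymptotically absent.

  Conversely, by symmetry the law of the observations \<open>X i = Z i - \<mu>\<close> does not change under
  multiplication by independent Rademacher signs, so that it suffices to prove the limit theorem for
  deterministic arrays \<open>a\<close> with random signs, uniformly over all arrays with \<open>\<Sum> (a i)\<^sup>2 = 1\<close> and
  \<open>max \<bar>a i\<bar>\<close> small. There the Student process is uniformly close to a step function of the sums over
  \<open>m\<close> blocks of indices, each carrying about the proportion \<open>1/m\<close> of the sum of squares, by a fourth
  moment maximal inequality. The block sums are independent and asymptotically normal. Since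
  the supremum metric is not separable, the functional \<open>h\<close> is replaced by its Lipschitz minorants
  \<open>INF g. h g + k * sup_dist g f\<close>, which increase to \<open>h\<close> at continuity points and need to be
  measurable only along the finite-dimensional step functions.\<close>

section \<open>Cadlag functions and the supremum distance\<close>

text \<open>Second moments are too weak to control oscillations: over \<open>m\<close> blocks of
  variance about \<open>1 / m\<close>, Chebyshev bounds add up to a constant, whereas fourth moments
  leave a sum of order \<open>1 / m\<close>. Uniformity over arrays is what symmetrization demands:
  once the observations are fixed they form an array about which one knows only that, with
  probability near one, its normalized entries are small. Finitely many sign patterns also remove a
  measurability obstacle: the minorants are infima over an uncountable set, but under a finitely
  supported law every function can be integrated. Minorants approach \<open>h\<close> from below
  only, so the main estimate is one-sided and the other side comes from \<open>- h\<close>. The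
  constants are fixed in the order: minorant index \<open>k\<close>, oscillation
  \<open>\<eta>\<close>, bound \<open>L\<close> for partial sums, number \<open>m\<close> of blocks,
  size \<open>\<delta>\<close> of the entries. Hence \<open>m\<close> stays fixed while the entries
  shrink, and a central limit theorem for finitely many blocks is enough. In the converse direction
  one continuous functional has to detect any constant grid cell: the product of the absolute grid
  increments, zero as soon as one factor is.\<close>

text \<open>One-sided limits bound \<open>f\<close> near every point, and Bolzano's bisection
  principle glues local bounds together. Without this the real-valued \<open>SUP\<close> in
  \<open>sup_dist\<close> would carry no information.\<close>

lemma cadlag01_bounded:
  assumes f: "f \<in> cadlag01"
  obtains B where "\<And>t. t \<in> {0..1} \<Longrightarrow> \<bar>f t\<bar> \<le> B"
proof -
  \<comment> \<open>The intersection with the unit interval lets neighbourhoods of 0 and 1 stick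
    out, as the bisection principle requires.\<close>
  define P where "P a b \<longleftrightarrow> (\<exists>B. \<forall>t\<in>{a..b} \<inter> {0..1}. \<bar>f t\<bar> \<le> B)" for a b :: real
  have ev: "\<forall>\<^sub>F s in F. \<bar>f s\<bar> \<le> \<bar>l\<bar> + 1" if "(f \<longlongrightarrow> l) F" for l F
    using tendsto_rabs[OF that] by (auto dest!: order_tendstoD(2)[of _ _ _ "\<bar>l\<bar> + 1"] elim: eventually_mono)
  have "P 0 1"
  proof (rule Bolzano)
    show "P a c" if "P a b" "P b c" "a \<le> b" "b \<le> c" for a b c
    proof -
      obtain B where B: "\<And>t. t \<in> {a..b} \<inter> {0..1} \<Longrightarrow> \<bar>f t\<bar> \<le> B"
        using \<open>P a b\<close> unfolding P_def by blast
      obtain C where C: "\<And>t. t \<in> {b..c} \<inter> {0..1} \<Longrightarrow> \<bar>f t\<bar> \<le> C"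
        using \<open>P b c\<close> unfolding P_def by blast
      have "\<bar>f t\<bar> \<le> max B C" if "t \<in> {a..c} \<inter> {0..1}" for t
        using B[of t] C[of t] that by (cases "t \<le> b") (auto simp: le_max_iff_disj)
      then show ?thesis unfolding P_def by blast
    qed
    fix x :: real assume x: "0 \<le> x" "x \<le> 1"
    have "\<exists>b>x. \<exists>B. \<forall>y>x. y < b \<longrightarrow> y \<le> 1 \<longrightarrow> \<bar>f y\<bar> \<le> B"
    proof (cases "x = 1")
      case True
      then show ?thesis by (intro exI[of _ 2]) auto
    next
      case False
      then have "(f \<longlongrightarrow> f x) (at_right x)"
        using f x by (auto simp: cadlag01_def)
      from ev[OF this] show ?thesis
        unfolding eventually_at_right_field by blast
    qed
    then obtain b B where b: "b > x" "\<And>y. x < y \<Longrightarrow> y < b \<Longrightarrow> y \<le> 1 \<Longrightarrow> \<bar>f y\<bar> \<le> B"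
      by blast
    have "\<exists>a<x. \<exists>B. \<forall>y>a. y < x \<longrightarrow> 0 \<le> y \<longrightarrow> \<bar>f y\<bar> \<le> B"
    proof (cases "x = 0")
      case True
      then show ?thesis by (intro exI[of _ "-1"]) auto
    next
      case False
      then obtain l where "(f \<longlongrightarrow> l) (at_left x)"
        using f x by (force simp: cadlag01_def)
      from ev[OF this] show ?thesis
        unfolding eventually_at_left_field by blast
    qed
    then obtain a A where a: "a < x" "\<And>y. a < y \<Longrightarrow> y < x \<Longrightarrow> 0 \<le> y \<Longrightarrow> \<bar>f y\<bar> \<le> A"
      by blast
    have "P u v" if "u \<le> x \<and> x \<le> v \<and> v - u < min (b - x) (x - a)" for u v
      unfolding P_def
    proof (intro exI ballI)
      fix t assume "t \<in> {u..v} \<inter> {0..1}"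
      then show "\<bar>f t\<bar> \<le> max (max A B) \<bar>f x\<bar>"
        using a(2)[of t] b(2)[of t] that
        by (cases t x rule: linorder_cases) (auto simp: le_max_iff_disj)
    qed
    then show "\<exists>d>0. \<forall>a b. a \<le> x \<and> x \<le> b \<and> b - a < d \<longrightarrow> P a b"
      using a(1) b(1) by (intro exI[of _ "min (b - x) (x - a)"]) auto
  qed simp
  then obtain B where "\<forall>t\<in>{0..1}. \<bar>f t\<bar> \<le> B"
    unfolding P_def by auto
  then show thesis
    by (intro that[of B]) blast
qed

lemma bdd_above_sup_dist:
  assumes "f \<in> cadlag01" "g \<in> cadlag01"
  shows "bdd_above ((\<lambda>t. \<bar>f t - g t\<bar>) ` {0..1})"
proof -
  obtain A B where "\<And>t. t \<in> {0..1} \<Longrightarrow> \<bar>f t\<bar> \<le> A" "\<And>t. t \<in> {0..1} \<Longrightarrow> \<bar>g t\<bar> \<le> B"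
    using cadlag01_bounded assms by metis
  then have "\<bar>f t - g t\<bar> \<le> A + B" if "t \<in> {0..1}" for t
    using that by (meson abs_triangle_ineq4 add_mono order_trans)
  then show ?thesis by fast
qed

lemma sup_dist_ge:
  assumes "f \<in> cadlag01" "g \<in> cadlag01" "t \<in> {0..1}"
  shows "\<bar>f t - g t\<bar> \<le> sup_dist f g"
  unfolding sup_dist_def using bdd_above_sup_dist[OF assms(1,2)] assms(3) by (rule cSUP_upper2) simp

lemma sup_dist_le: "(\<And>t. t \<in> {0..1} \<Longrightarrow> \<bar>f t - g t\<bar> \<le> c) \<Longrightarrow> sup_dist f g \<le> c"
  unfolding sup_dist_def by (rule cSUP_least) simp_all

lemma sup_dist_nonneg: "f \<in> cadlag01 \<Longrightarrow> g \<in> cadlag01 \<Longrightarrow> 0 \<le> sup_dist f g"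
  using sup_dist_ge[of f g 0] by (force intro: order_trans[OF abs_ge_zero])

lemma sup_dist_commute: "sup_dist f g = sup_dist g f"
  unfolding sup_dist_def by (simp add: abs_minus_commute)

lemma sup_dist_refl [simp]: "sup_dist f f = 0"
  by (simp add: sup_dist_def)

lemma sup_dist_triangle:
  assumes "f \<in> cadlag01" "g \<in> cadlag01" "h \<in> cadlag01"
  shows "sup_dist f h \<le> sup_dist f g + sup_dist g h"
proof (rule sup_dist_le)
  fix t :: real assume "t \<in> {0..1}"
  then show "\<bar>f t - h t\<bar> \<le> sup_dist f g + sup_dist g h"
    using sup_dist_ge[of f g t] sup_dist_ge[of g h t] assms by linarith
qed

text \<open>The neighbourhood filter of the supremum metric inside \<open>cadlag01\<close>. It turns
  \<open>sup_continuous_at\<close> into an ordinary limit, so that the library rules for products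
  and compositions apply.\<close>

definition sup_nhds :: "(real \<Rightarrow> real) \<Rightarrow> (real \<Rightarrow> real) filter" where
  "sup_nhds f = inf (filtercomap (\<lambda>g. sup_dist g f) (nhds 0)) (principal cadlag01)"

lemma eventually_sup_nhds:
  assumes f: "f \<in> cadlag01"
  shows "eventually P (sup_nhds f) \<longleftrightarrow> (\<exists>d>0. \<forall>g\<in>cadlag01. sup_dist g f < d \<longrightarrow> P g)"
proof
  assume "eventually P (sup_nhds f)"
  then obtain Q where Q: "eventually Q (nhds 0)" "\<And>g. Q (sup_dist g f) \<Longrightarrow> g \<in> cadlag01 \<Longrightarrow> P g"
    unfolding sup_nhds_def eventually_inf_principal eventually_filtercomap by auto
  then obtain d where "d > 0" "\<And>x::real. \<bar>x\<bar> < d \<Longrightarrow> Q x"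
    unfolding eventually_nhds_metric by (auto simp: dist_real_def)
  then show "\<exists>d>0. \<forall>g\<in>cadlag01. sup_dist g f < d \<longrightarrow> P g"
    using Q(2) sup_dist_nonneg[OF _ f] by (intro exI[of _ d]) auto
next
  assume "\<exists>d>0. \<forall>g\<in>cadlag01. sup_dist g f < d \<longrightarrow> P g"
  then obtain d where d: "d > 0" "\<And>g. g\<in>cadlag01 \<Longrightarrow> sup_dist g f < d \<Longrightarrow> P g" by blast
  have "eventually (\<lambda>x. x < d) (nhds 0)"
    using d(1) by (simp add: order_tendstoD(2)[OF filterlim_ident])
  then show "eventually P (sup_nhds f)"
    unfolding sup_nhds_def eventually_inf_principal eventually_filtercomap using d(2) by auto
qed

lemma sup_continuous_at_iff:
  assumes "f \<in> cadlag01"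
  shows "sup_continuous_at h f \<longleftrightarrow> (h \<longlongrightarrow> h f) (sup_nhds f)"
  unfolding sup_continuous_at_def tendsto_iff eventually_sup_nhds[OF assms] dist_real_def by simp

lemma tendsto_eval_sup_nhds:
  assumes f: "f \<in> cadlag01" and t: "t \<in> {0..1}"
  shows "((\<lambda>g. g t) \<longlongrightarrow> f t) (sup_nhds f)"
  unfolding tendsto_iff eventually_sup_nhds[OF f] dist_real_def
  using sup_dist_ge[OF _ f t] by (meson le_less_trans)

lemma continuous_on_in_cadlag01:
  assumes "continuous_on {0..1} f"
  shows "restrict f {0..1} \<in> cadlag01"
proof -
  let ?g = "restrict f {0..1}"
  have g: "continuous_on {0..1} ?g"
    using assms by (subst continuous_on_cong[OF refl, of _ _ f]) auto
  have "(?g \<longlongrightarrow> ?g t) (at_right t)" if "t \<in> {0..<1}" for t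
  proof -
    have "(?g \<longlongrightarrow> ?g t) (at t within {0..1})"
      using g that unfolding continuous_on_def by auto
    then have "(?g \<longlongrightarrow> ?g t) (at t within {t..1})"
      by (rule tendsto_within_subset) (use that in auto)
    then show ?thesis using that by (simp add: at_within_Icc_at_right)
  qed
  moreover have "(?g \<longlongrightarrow> ?g t) (at_left t)" if "t \<in> {0<..1}" for t
  proof -
    have "(?g \<longlongrightarrow> ?g t) (at t within {0..1})"
      using g that unfolding continuous_on_def by auto
    then have "(?g \<longlongrightarrow> ?g t) (at t within {0..t})"
      by (rule tendsto_within_subset) (use that in auto)
    then show ?thesis using that by (simp add: at_within_Icc_at_left)
  qed
  ultimately show ?thesis unfolding cadlag01_def by blast
qed

text \<open>Only finitely many thresholds \<open>c i\<close> exist, so the set of those passed is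
  constant just to the right of \<open>t\<close> and equal to the strictly passed ones just to the
  left. With the multiplied form \<open>t * s\<close> the lemma fits the Student process (thresholds
  are partial sums of squares, \<open>s\<close> their total) as well as
  \<open>step_fun\<close>.\<close>

lemma step_function_in_cadlag01:
  fixes c :: "'i \<Rightarrow> real" and \<Phi> :: "'i set \<Rightarrow> real"
  assumes "finite I" and "s \<ge> 0"
  shows "(\<lambda>t\<in>{0..1}. \<Phi> {i \<in> I. c i \<le> t * s}) \<in> cadlag01" (is "?f \<in> _")
proof (cases "s = 0")
  case True
  then show ?thesis by (simp add: continuous_on_in_cadlag01)
next
  case False
  with \<open>s \<ge> 0\<close> have s: "s > 0" by simp
  have right: "(?f \<longlongrightarrow> ?f t) (at_right t)" if t: "t \<in> {0..<1}" for t
  proof -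
    have "\<forall>\<^sub>F u in at_right t. c i \<le> u * s \<longleftrightarrow> c i \<le> t * s" for i
    proof (cases "c i \<le> t * s")
      case True
      have "\<forall>\<^sub>F u in at_right t. t < u" by (auto simp: eventually_at_right_field intro: exI[of _ "t+1"])
      then show ?thesis
      proof eventually_elim
        case (elim u)
        then have "t * s \<le> u * s" using s by simp
        then show ?case using True by simp
      qed
    next
      case False
      then have "t < c i / s" using s by (simp add: field_simps)
      then have "\<forall>\<^sub>F u in at_right t. u < c i / s" by (auto simp: eventually_at_right_field)
      then show ?thesis by eventually_elim (use False s in \<open>simp add: field_simps\<close>)
    qed
    then have "\<forall>\<^sub>F u in at_right t. \<forall>i\<in>I. c i \<le> u * s \<longleftrightarrow> c i \<le> t * s"
      using \<open>finite I\<close> by (simp add: eventually_ball_finite)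
    moreover have "\<forall>\<^sub>F u in at_right t. u \<in> {0..1}"
      using t by (auto simp: eventually_at_right_field intro!: exI[of _ 1])
    ultimately have "\<forall>\<^sub>F u in at_right t. ?f u = ?f t"
    proof eventually_elim
      case (elim u)
      then have "{i\<in>I. c i \<le> u * s} = {i\<in>I. c i \<le> t * s}" by auto
      with elim t show ?case by simp
    qed
    then show ?thesis by (rule tendsto_eventually)
  qed
  have left: "(?f \<longlongrightarrow> \<Phi> {i\<in>I. c i < t * s}) (at_left t)" if t: "t \<in> {0<..1}" for t
  proof -
    have "\<forall>\<^sub>F u in at_left t. c i \<le> u * s \<longleftrightarrow> c i < t * s" for i
    proof (cases "c i < t * s")
      case False
      have "\<forall>\<^sub>F u in at_left t. u < t" by (auto simp: eventually_at_left_field intro: exI[of _ "t-1"])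
      then show ?thesis
      proof eventually_elim
        case (elim u)
        then have "u * s < t * s" using s by simp
        then show ?case using False by simp
      qed
    next
      case True
      then have "c i / s < t" using s by (simp add: field_simps)
      then have "\<forall>\<^sub>F u in at_left t. c i / s < u" by (auto simp: eventually_at_left_field)
      then show ?thesis by eventually_elim (use True s in \<open>simp add: field_simps\<close>)
    qed
    then have "\<forall>\<^sub>F u in at_left t. \<forall>i\<in>I. c i \<le> u * s \<longleftrightarrow> c i < t * s"
      using \<open>finite I\<close> by (simp add: eventually_ball_finite)
    moreover have "\<forall>\<^sub>F u in at_left t. u \<in> {0..1}"
      using t by (auto simp: eventually_at_left_field intro!: exI[of _ 0])
    ultimately have "\<forall>\<^sub>F u in at_left t. ?f u = \<Phi> {i\<in>I. c i < t * s}"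
    proof eventually_elim
      case (elim u)
      then have "{i\<in>I. c i \<le> u * s} = {i\<in>I. c i < t * s}" by auto
      with elim show ?case by simp
    qed
    then show ?thesis by (rule tendsto_eventually)
  qed
  show ?thesis
    unfolding cadlag01_def using right left by blast
qed

section \<open>Measurability for the sigma-field of finite-dimensional sets\<close>

lemma space_cadlag_sigma [simp]: "space cadlag_sigma = cadlag01"
  unfolding cadlag_sigma_def by (subst space_measure_of) auto

lemma measurable_cadlag_sigmaI:
  assumes "\<And>\<omega>. \<omega> \<in> space M \<Longrightarrow> X \<omega> \<in> cadlag01"
    and "\<And>t. t \<in> {0..1} \<Longrightarrow> (\<lambda>\<omega>. X \<omega> t) \<in> borel_measurable M"
  shows "X \<in> measurable M cadlag_sigma"
  unfolding cadlag_sigma_def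
proof (rule measurable_measure_of)
  fix A assume "A \<in> {{f \<in> cadlag01. restrict f J \<in> B} | J B.
        finite J \<and> J \<subseteq> {0..1} \<and> B \<in> sets (PiM J (\<lambda>_. borel))}"
  then obtain J :: "real set" and B where J: "J \<subseteq> {0..1}" and B: "B \<in> sets (PiM J (\<lambda>_. borel))"
    and A: "A = {f \<in> cadlag01. restrict f J \<in> B}" by blast
  have "(\<lambda>\<omega>. restrict (X \<omega>) J) \<in> measurable M (PiM J (\<lambda>_. borel))"
    using assms(2) J by (intro measurable_restrict) auto
  moreover have "X -` A \<inter> space M = (\<lambda>\<omega>. restrict (X \<omega>) J) -` B \<inter> space M"
    using assms(1) by (auto simp: A)
  ultimately show "X -` A \<inter> space M \<in> sets M"
    using B by (simp add: measurable_sets)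
qed (use assms(1) in auto)

lemma measurable_eval_cadlag_sigma:
  assumes "t \<in> {0..1}"
  shows "(\<lambda>f. f t) \<in> borel_measurable cadlag_sigma"
proof (rule measurableI)
  fix B :: "real set" assume B: "B \<in> sets borel"
  let ?C = "(\<lambda>x. x t) -` B \<inter> space (PiM {t} (\<lambda>_. borel::real measure))"
  have "?C \<in> sets (PiM {t} (\<lambda>_. borel))"
    using B by (intro measurable_sets[of _ _ borel]) auto
  then have "{f \<in> cadlag01. restrict f {t} \<in> ?C} \<in> {{f \<in> cadlag01. restrict f J \<in> B} | J B.
        finite J \<and> J \<subseteq> {0..1} \<and> B \<in> sets (PiM J (\<lambda>_. borel))}"
    using assms by (intro CollectI exI[of _ "{t}"] exI[of _ ?C]) auto
  also have "\<dots> \<subseteq> sets cadlag_sigma"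
    unfolding cadlag_sigma_def by (subst sets_measure_of) auto
  finally have "{f \<in> cadlag01. restrict f {t} \<in> ?C} \<in> sets cadlag_sigma" .
  moreover have "restrict f {t} \<in> ?C \<longleftrightarrow> f t \<in> B" for f
    by (simp add: space_PiM)
  ultimately have "{f \<in> cadlag01. f t \<in> B} \<in> sets cadlag_sigma"
    by (simp only:)
  moreover have "(\<lambda>f. f t) -` B \<inter> space cadlag_sigma = {f \<in> cadlag01. f t \<in> B}"
    by auto
  ultimately show "(\<lambda>f. f t) -` B \<inter> space cadlag_sigma \<in> sets cadlag_sigma"
    by (simp only:)
qed simp

section \<open>The Student process\<close>

abbreviation (input) centered_sumsq :: "nat \<Rightarrow> (nat \<Rightarrow> real) \<Rightarrow> nat \<Rightarrow> real" where
  "centered_sumsq n z m \<equiv> \<Sum>i=1..m. (z i - sample_mean n z)\<^sup>2"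

lemma centered_sumsq_mono: "m \<le> m' \<Longrightarrow> centered_sumsq n z m \<le> centered_sumsq n z m'"
  by (intro sum_mono2) auto

lemma student_index_in:
  assumes "t \<ge> 0"
  shows "student_index n z t \<in> {m \<in> {0..n}. centered_sumsq n z m \<le> t * centered_sumsq n z n}"
proof -
  have "0 \<in> {m \<in> {0..n}. centered_sumsq n z m \<le> t * centered_sumsq n z n}"
    using assms by (simp add: sum_nonneg)
  then show ?thesis unfolding student_index_def by (intro Max_in) auto
qed

lemma student_index_le: "t \<ge> 0 \<Longrightarrow> student_index n z t \<le> n"
  using student_index_in[of t n z] by simp

lemma student_index_greater:
  assumes "student_index n z t < m" "m \<le> n"
  shows "t * centered_sumsq n z n < centered_sumsq n z m"
proof (rule ccontr)
  assume "\<not> ?thesis"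
  then have "m \<in> {m \<in> {0..n}. centered_sumsq n z m \<le> t * centered_sumsq n z n}"
    using assms by simp
  then have "m \<le> student_index n z t" unfolding student_index_def by (intro Max_ge) auto
  with assms show False by simp
qed

lemma student_index_eqI:
  assumes "m < n" "centered_sumsq n z m \<le> t * centered_sumsq n z n"
    "t * centered_sumsq n z n < centered_sumsq n z (Suc m)"
  shows "student_index n z t = m"
  unfolding student_index_def
proof (rule Max_eqI)
  fix k assume "k \<in> {m \<in> {0..n}. centered_sumsq n z m \<le> t * centered_sumsq n z n}"
  then have "\<not> Suc m \<le> k"
    using centered_sumsq_mono[of "Suc m" k z n] assms(3) by auto
  then show "k \<le> m" by simp
qed (use assms in auto)

lemma student_process_in_cadlag01: "student_process n \<mu> z \<in> cadlag01"
  unfolding student_process_def student_index_def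
  using step_function_in_cadlag01[of "{0..n}" "centered_sumsq n z n"
      "\<lambda>K. (\<Sum>i=1..Max K. z i - \<mu>) / sqrt (real n) / sqrt (centered_sumsq n z n / (real n - 1))"]
  by (simp add: sum_nonneg)

lemma sample_mean_cong: "(\<And>i. i \<in> {1..n} \<Longrightarrow> z i = z' i) \<Longrightarrow> sample_mean n z = sample_mean n z'"
  unfolding sample_mean_def by (metis sum.cong)

lemma student_process_cong:
  assumes eq: "\<And>i. i \<in> {1..n} \<Longrightarrow> z i = z' i"
  shows "student_process n \<mu> z = student_process n \<mu> z'"
proof -
  have mean: "sample_mean n z = sample_mean n z'" by (rule sample_mean_cong[OF eq])
  have A: "centered_sumsq n z m = centered_sumsq n z' m" if "m \<le> n" for m
    using that by (intro sum.cong) (auto simp: mean eq)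
  have idx: "student_index n z t = student_index n z' t" for t
    unfolding student_index_def by (intro arg_cong[of _ _ Max] Collect_cong conj_cong refl) (simp only: A order_refl atLeastAtMost_iff)
  have "(\<Sum>i=1..student_index n z t. z i - \<mu>) = (\<Sum>i=1..student_index n z' t. z' i - \<mu>)"
    if "t \<in> {0..1}" for t
    using student_index_le[of t n z'] that by (intro sum.cong) (auto simp: idx eq)
  then show ?thesis
    unfolding student_process_def A[OF order_refl] by (intro restrict_ext) simp
qed

lemma sample_mean_diff: "n > 0 \<Longrightarrow> sample_mean n (\<lambda>i. z i - \<mu>) = sample_mean n z - \<mu>"
  unfolding sample_mean_def by (simp add: sum_subtractf field_simps)

lemma student_process_center: "student_process n \<mu> z = student_process n 0 (\<lambda>i. z i - \<mu>)"
proof (cases "n = 0")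
  case True
  then show ?thesis by (simp add: student_process_def)
next
  case False
  then have "centered_sumsq n (\<lambda>i. z i - \<mu>) m = centered_sumsq n z m" for m
    by (simp add: sample_mean_diff)
  then show ?thesis
    unfolding student_process_def student_index_def by simp
qed

lemma sample_mean_scale: "sample_mean n (\<lambda>i. c * z i) = c * sample_mean n z"
  unfolding sample_mean_def by (simp add: sum_distrib_left)

text \<open>Self-normalization: numerator and denominator both gain the factor \<open>c\<close>, and
  the index compares two quantities that both gain its square. This is what allows observations to
  be normalized to unit sum of squares.\<close>

lemma student_process_scale:
  assumes "c > 0"
  shows "student_process n 0 (\<lambda>i. c * z i) = student_process n 0 z"
proof -
  have A: "centered_sumsq n (\<lambda>i. c * z i) m = c\<^sup>2 * centered_sumsq n z m" for m
    by (simp add: sample_mean_scale sum_distrib_left power_mult_distrib flip: right_diff_distrib)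
  have idx: "student_index n (\<lambda>i. c * z i) t = student_index n z t" for t
    unfolding student_index_def A
  proof (intro arg_cong[of _ _ Max] Collect_cong conj_cong refl)
    fix m
    have "t * (c\<^sup>2 * centered_sumsq n z n) = c\<^sup>2 * (t * centered_sumsq n z n)" by simp
    then show "c\<^sup>2 * centered_sumsq n z m \<le> t * (c\<^sup>2 * centered_sumsq n z n)
        \<longleftrightarrow> centered_sumsq n z m \<le> t * centered_sumsq n z n"
      using assms by simp
  qed
  have "sqrt (c\<^sup>2 * S / k) = c * sqrt (S / k)" for S k :: real
    using assms by (simp add: real_sqrt_mult real_sqrt_divide)
  then show ?thesis
    unfolding student_process_def A idx using assms
    by (intro restrict_ext) (simp add: flip: sum_distrib_left)
qed

lemma measurable_student_process:
  assumes Z [measurable]: "\<And>i. i \<in> {1..n} \<Longrightarrow> Z i \<in> borel_measurable M"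
  shows "(\<lambda>\<omega>. student_process n \<mu> (\<lambda>i. Z i \<omega>)) \<in> measurable M cadlag_sigma"
proof (rule measurable_cadlag_sigmaI)
  fix t :: real assume t: "t \<in> {0..1}"
  have mean [measurable]: "(\<lambda>\<omega>. sample_mean n (\<lambda>i. Z i \<omega>)) \<in> borel_measurable M"
    unfolding sample_mean_def by measurable
  have A: "(\<lambda>\<omega>. centered_sumsq n (\<lambda>i. Z i \<omega>) m) \<in> borel_measurable M" if "m \<le> n" for m
  proof -
    have "Z i \<in> borel_measurable M" if "i \<in> {1..m}" for i
      using Z that \<open>m \<le> n\<close> by auto
    then show ?thesis by measurable
  qed
  have "Measurable.pred M (\<lambda>\<omega>. m \<in> {0..n} \<and>
      centered_sumsq n (\<lambda>i. Z i \<omega>) m \<le> t * centered_sumsq n (\<lambda>i. Z i \<omega>) n)" for m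
  proof (cases "m \<le> n")
    case True
    note [measurable] = A[OF True] A[OF order_refl]
    show ?thesis by measurable
  qed simp
  then have [measurable]: "(\<lambda>\<omega>. student_index n (\<lambda>i. Z i \<omega>) t) \<in> measurable M (count_space UNIV)"
    unfolding student_index_def by (rule measurable_Max_nat)
  note [measurable] = A[OF order_refl]
  have "(\<lambda>\<omega>. (\<Sum>i=1..n. if i \<le> student_index n (\<lambda>i. Z i \<omega>) t then Z i \<omega> - \<mu> else 0) / sqrt (real n) /
      sqrt (centered_sumsq n (\<lambda>i. Z i \<omega>) n / (real n - 1))) \<in> borel_measurable M"
    by measurable
  moreover have "(\<Sum>i=1..student_index n (\<lambda>i. Z i \<omega>) t. Z i \<omega> - \<mu>) =
      (\<Sum>i=1..n. if i \<le> student_index n (\<lambda>i. Z i \<omega>) t then Z i \<omega> - \<mu> else 0)" for \<omega>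
    using student_index_le[of t n "\<lambda>i. Z i \<omega>"] t
    by (intro sum.mono_neutral_cong_left) auto
  ultimately show "(\<lambda>\<omega>. student_process n \<mu> (\<lambda>i. Z i \<omega>) t) \<in> borel_measurable M"
    using t by (simp add: student_process_def)
qed (rule student_process_in_cadlag01)

text \<open>As a fraction of the total sum of squares, observation \<open>i\<close> occupies an
  interval longer than \<open>\<epsilon>\<close>, during which the index stays at
  \<open>i - 1\<close>. As \<open>\<epsilon>\<close> is at least two cell widths, a whole closed
  grid cell fits in: one width may be lost in reaching the next grid point, the other is the
  cell.\<close>

lemma student_process_constant_on_gap:
  fixes m :: nat
  assumes m: "2 / \<epsilon> \<le> real m" "\<epsilon> > 0" and i: "i \<in> {1..n}"
    and gap: "\<epsilon> * centered_sumsq n z n < (z i - sample_mean n z)\<^sup>2" and pos: "centered_sumsq n z n > 0"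
  shows "\<exists>k<m. student_process n \<mu> z (real (Suc k) / real m) = student_process n \<mu> z (real k / real m)"
proof -
  define S where "S = centered_sumsq n z n"
  define A where "A = centered_sumsq n z"
  have S: "S > 0" using pos by (simp add: S_def)
  have m0: "real m > 0" using m by (smt (verit) divide_pos_pos)
  have Suc: "A i = A (i - 1) + (z i - sample_mean n z)\<^sup>2"
    using i unfolding A_def by (cases i) auto
  define s where "s = A (i - 1) / S"
  have s0: "s \<ge> 0" using S by (auto simp: s_def A_def intro!: divide_nonneg_pos sum_nonneg)
  have s1: "s + \<epsilon> < A i / S"
    using gap[folded S_def] S by (simp add: s_def Suc field_simps)
  have Ai: "A i \<le> S" unfolding A_def S_def by (rule centered_sumsq_mono) (use i in auto)
  then have "A i / S \<le> 1" using S by (simp add: field_simps)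
  \<comment> \<open>The first grid point not before \<open>s\<close>, the time at which observation
    \<open>i\<close> becomes the next one to be included.\<close>
  define k where "k = nat \<lceil>s * real m\<rceil>"
  have k1: "s * real m \<le> real k" unfolding k_def by (rule real_nat_ceiling_ge)
  have k2: "real k < s * real m + 1"
    using s0 m0 unfolding k_def by (simp add: ceiling_less_iff) linarith
  have "2 \<le> \<epsilon> * real m" using m m0 by (simp add: field_simps)
  then have "real (Suc k) < (s + \<epsilon>) * real m" using k2 by (simp add: algebra_simps)
  then have up: "real (Suc k) / real m < s + \<epsilon>" using m0 by (simp add: field_simps)
  then have "real (Suc k) / real m < 1" using s1 \<open>A i / S \<le> 1\<close> by linarith
  then have km: "Suc k < m" using m0 by (simp add: field_simps)
  have lo: "s \<le> real k / real m" using k1 m0 by (simp add: field_simps)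
  have le: "real k / real m \<le> real (Suc k) / real m" by (simp add: divide_right_mono)
  have idx: "student_index n z t = i - 1" if "real k / real m \<le> t" "t \<le> real (Suc k) / real m" for t
  proof (rule student_index_eqI)
    show "i - 1 < n" using i by auto
    have "s \<le> t" using that lo by linarith
    then have "A (i - 1) \<le> t * S" using S by (simp add: s_def field_simps)
    then show "centered_sumsq n z (i - 1) \<le> t * centered_sumsq n z n"
      unfolding A_def S_def .
    have "t < A i / S" using that up s1 by linarith
    then have "t * S < A (Suc (i - 1))" using S i by (simp add: field_simps)
    then show "t * centered_sumsq n z n < centered_sumsq n z (Suc (i - 1))"
      unfolding A_def S_def .
  qed
  have "real k / real m \<in> {0..1}" "real (Suc k) / real m \<in> {0..1}"
    using km by (auto simp: field_simps)
  then show ?thesis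
    using idx[of "real k / real m"] idx[of "real (Suc k) / real m"] le km
    by (intro exI[of _ k]) (simp add: student_process_def)
qed

lemma student_process_degenerate:
  "centered_sumsq n z n = 0 \<Longrightarrow> t \<in> {0..1} \<Longrightarrow> student_process n \<mu> z t = 0"
  by (simp add: student_process_def)

section \<open>Necessity: grid increments of the limit do not vanish\<close>

lemma (in std_wiener_process) measurable_path:
  "(\<lambda>\<omega>. \<lambda>t\<in>{0..1}. W t \<omega>) \<in> measurable N cadlag_sigma"
  using continuous_paths random_variable_W
  by (intro measurable_cadlag_sigmaI continuous_on_in_cadlag01) auto

lemma (in std_wiener_process) AE_increment_neq_0:
  assumes "0 \<le> s" "s < t" "t \<le> 1"
  shows "AE \<omega> in N. W t \<omega> - W s \<omega> \<noteq> 0"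
proof -
  note D = normal_increments[OF assms]
  have "AE x in distr N lborel (\<lambda>\<omega>. W t \<omega> - W s \<omega>). x \<noteq> 0"
    unfolding distributed_distr_eq_density[OF D]
    by (subst AE_density) (auto intro: AE_mp[OF AE_lborel_singleton[of 0]])
  from AE_distrD[OF distributed_measurable[OF D] this] show ?thesis .
qed

text \<open>The product is zero exactly when some grid increment is. It is continuous because
  evaluations at points are, so its discontinuity set is empty and the convergence hypothesis
  applies to it.\<close>

lemma increment_product_continuous:
  fixes m :: nat
  assumes f: "f \<in> cadlag01"
  defines "h \<equiv> \<lambda>f. \<Prod>k<m. \<bar>f (real (Suc k) / real m) - f (real k / real m)\<bar>"
  shows "sup_continuous_at h f"
  unfolding sup_continuous_at_iff[OF f] h_def
  by (intro tendsto_prod tendsto_rabs tendsto_diff tendsto_eval_sup_nhds[OF f]) (auto simp: field_simps)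

text \<open>The increment product is nonnegative and almost surely nonzero on Wiener paths, so 0 is
  a continuity point of its limit law and the probability that it vanishes on the Student process
  tends to 0. Both a zero denominator and a large observation force it to vanish.\<close>

lemma max_ratio_negligible_if_converges:
  assumes M: "prob_space M" and Z: "\<And>i. i \<ge> 1 \<Longrightarrow> Z i \<in> borel_measurable M"
    and W: "std_wiener_process N W"
    and conv: "converges_in_distr_cadlag M (\<lambda>n \<omega>. student_process n \<mu> (\<lambda>i. Z i \<omega>))
           N (\<lambda>\<omega>. \<lambda>t\<in>{0..1}. W t \<omega>)"
  shows "ratio_tendsto_0_in_prob M
           (\<lambda>n \<omega>. MAX i\<in>{1..n}. (Z i \<omega> - sample_mean n (\<lambda>j. Z j \<omega>))\<^sup>2)
           (\<lambda>n \<omega>. \<Sum>i=1..n. (Z i \<omega> - sample_mean n (\<lambda>j. Z j \<omega>))\<^sup>2)"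
proof -
  interpret M: prob_space M by fact
  interpret std_wiener_process N W by fact
  let ?X = "\<lambda>n \<omega>. student_process n \<mu> (\<lambda>i. Z i \<omega>)"
  let ?Y = "\<lambda>\<omega>. \<lambda>t\<in>{0..1}. W t \<omega>"
  let ?S = "\<lambda>n \<omega>. centered_sumsq n (\<lambda>i. Z i \<omega>) n"
  define h where "h m f = (\<Prod>k<m. \<bar>f (real (Suc k) / real m) - f (real k / real m)\<bar>)"
    for m :: nat and f :: "real \<Rightarrow> real"
  have X: "?X n \<in> measurable M cadlag_sigma" for n
    using Z by (intro measurable_student_process) auto
  have small: "(\<lambda>n. measure M {\<omega>\<in>space M. h m (?X n \<omega>) = 0}) \<longlonglongrightarrow> 0" if "m > 0" for m
  proof -
    have h: "h m \<in> borel_measurable cadlag_sigma"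
      unfolding h_def by (intro borel_measurable_prod borel_measurable_abs borel_measurable_diff
          measurable_eval_cadlag_sigma) (auto simp: field_simps)
    have D: "{f \<in> cadlag01. \<not> sup_continuous_at (h m) f} = {}"
      using increment_product_continuous[of _ m] by (auto simp: h_def[abs_def])
    then have w: "weak_conv_m (\<lambda>n. distr M borel (\<lambda>\<omega>. h m (?X n \<omega>))) (distr N borel (\<lambda>\<omega>. h m (?Y \<omega>)))"
      using conv[unfolded converges_in_distr_cadlag_def, rule_format, OF h] unfolding D by simp
    have hX [measurable]: "(\<lambda>\<omega>. h m (?X n \<omega>)) \<in> borel_measurable M" for n
      using measurable_compose[OF X h] .
    have hY [measurable]: "(\<lambda>\<omega>. h m (?Y \<omega>)) \<in> borel_measurable N"
      using measurable_compose[OF measurable_path h] .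
    have nonneg: "h m f \<ge> 0" for f by (simp add: h_def prod_nonneg)
    have "AE \<omega> in N. \<forall>k\<in>{..<m}. W (real (Suc k) / real m) \<omega> - W (real k / real m) \<omega> \<noteq> 0"
      using \<open>m > 0\<close> by (intro AE_finite_allI AE_increment_neq_0) (auto simp: field_simps)
    then have "AE \<omega> in N. h m (?Y \<omega>) \<noteq> 0"
      by eventually_elim (auto simp: h_def field_simps)
    then have null: "measure N {\<omega>\<in>space N. h m (?Y \<omega>) = 0} = 0"
      by (intro measure_eq_0_null_sets) (auto simp: AE_iff_null)
    \<comment> \<open>For a nonnegative functional the atom at 0 and the half-line up to 0 carry the
      same mass: the atom decides continuity of the distribution function at 0, the half-line is its
      value there.\<close>
    have meas: "measure (distr N borel (\<lambda>\<omega>. h m (?Y \<omega>))) A = measure N {\<omega>\<in>space N. h m (?Y \<omega>) = 0}"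
      if "A = {0} \<or> A = {..0}" for A
      using that nonneg by (auto simp: measure_distr intro!: arg_cong[of _ _ "measure N"])
        (use nonneg order_antisym in blast)+
    interpret Y: real_distribution "distr N borel (\<lambda>\<omega>. h m (?Y \<omega>))"
      by (rule real_distribution_distr) simp
    have "isCont (cdf (distr N borel (\<lambda>\<omega>. h m (?Y \<omega>)))) 0"
      using Y.isCont_cdf meas null by simp
    then have "(\<lambda>n. cdf (distr M borel (\<lambda>\<omega>. h m (?X n \<omega>))) 0) \<longlonglongrightarrow> cdf (distr N borel (\<lambda>\<omega>. h m (?Y \<omega>))) 0"
      using w by (simp add: weak_conv_m_def weak_conv_def)
    moreover have "cdf (distr N borel (\<lambda>\<omega>. h m (?Y \<omega>))) 0 = 0"
      using meas null by (simp add: cdf_def2)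
    moreover have "cdf (distr M borel (\<lambda>\<omega>. h m (?X n \<omega>))) 0 = measure M {\<omega>\<in>space M. h m (?X n \<omega>) = 0}" for n
      unfolding cdf_def2 by (subst measure_distr)
        (auto intro!: arg_cong[of _ _ "measure M"] simp: order_antisym[OF _ nonneg])
    ultimately show ?thesis by simp
  qed
  have hX: "{\<omega>\<in>space M. h m (?X n \<omega>) = 0} \<in> sets M" if "m > 0" for m n
  proof -
    have "h m \<in> borel_measurable cadlag_sigma"
      unfolding h_def by (intro borel_measurable_prod borel_measurable_abs borel_measurable_diff
          measurable_eval_cadlag_sigma) (auto simp: field_simps)
    from measurable_compose[OF X this] have [measurable]: "(\<lambda>\<omega>. h m (?X n \<omega>)) \<in> borel_measurable M" .
    show ?thesis by measurable
  qed
  have deg: "h m (?X n \<omega>) = 0" if "?S n \<omega> = 0" "m > 0" for m n \<omega>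
    unfolding h_def
    by (intro prod_zero bexI[of _ 0]) (use that in \<open>auto simp: student_process_degenerate\<close>)
  have S [measurable]: "?S n \<in> borel_measurable M" for n
    using Z unfolding sample_mean_def by (intro borel_measurable_sum borel_measurable_power
      borel_measurable_diff borel_measurable_divide) auto
  \<comment> \<open>One grid cell suffices here: a zero sum of squares makes the whole process
    zero.\<close>
  have "(\<lambda>n. measure M {\<omega>\<in>space M. ?S n \<omega> = 0}) \<longlonglongrightarrow> 0"
    by (rule tendsto_sandwich[OF _ _ tendsto_const small[of 1]])
      (auto intro!: always_eventually M.finite_measure_mono hX deg)
  then have "(\<lambda>n. 1 - measure M {\<omega>\<in>space M. ?S n \<omega> = 0}) \<longlonglongrightarrow> 1 - 0"
    by (intro tendsto_diff tendsto_const)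
  moreover have "measure M {\<omega>\<in>space M. ?S n \<omega> \<noteq> 0} = 1 - measure M {\<omega>\<in>space M. ?S n \<omega> = 0}" for n
    by (rule M.prob_neg) measurable
  ultimately have "(\<lambda>n. measure M {\<omega>\<in>space M. ?S n \<omega> \<noteq> 0}) \<longlonglongrightarrow> 1"
    by simp
  moreover have "(\<lambda>n. measure M {\<omega>\<in>space M.
      \<bar>(MAX i\<in>{1..n}. (Z i \<omega> - sample_mean n (\<lambda>j. Z j \<omega>))\<^sup>2) / ?S n \<omega>\<bar> > \<epsilon>}) \<longlonglongrightarrow> 0" if "\<epsilon> > 0" for \<epsilon>
  proof -
    obtain m :: nat where m: "2 / \<epsilon> \<le> real m" using real_arch_simple by blast
    have "m > 0"
    proof (rule ccontr)
      assume "\<not> ?thesis"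
      moreover have "0 < 2 / \<epsilon>" using \<open>\<epsilon> > 0\<close> by simp
      ultimately show False using m by simp
    qed
    have bad: "h m (?X n \<omega>) = 0"
      if "\<bar>(MAX i\<in>{1..n}. (Z i \<omega> - sample_mean n (\<lambda>j. Z j \<omega>))\<^sup>2) / ?S n \<omega>\<bar> > \<epsilon>" "n \<ge> 1" for n \<omega>
    proof (cases "?S n \<omega> = 0")
      case True
      then show ?thesis by (rule deg) fact
    next
      case False
      then have pos: "?S n \<omega> > 0" by (simp add: order_less_le sum_nonneg)
      let ?D = "(\<lambda>i. (Z i \<omega> - sample_mean n (\<lambda>j. Z j \<omega>))\<^sup>2) ` {1..n}"
      have "Max ?D \<in> ?D" using \<open>n \<ge> 1\<close> by (intro Max_in) auto
      then obtain i where i: "i \<in> {1..n}" "Max ?D = (Z i \<omega> - sample_mean n (\<lambda>j. Z j \<omega>))\<^sup>2"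
        by (auto simp only: image_iff)
      have "\<epsilon> * ?S n \<omega> < (Z i \<omega> - sample_mean n (\<lambda>j. Z j \<omega>))\<^sup>2"
        using that(1) pos unfolding i(2) by (simp add: field_simps)
      from student_process_constant_on_gap[OF m \<open>\<epsilon> > 0\<close> i(1) this pos]
      show ?thesis unfolding h_def by (intro prod_zero) auto
    qed
    show ?thesis
    proof (rule tendsto_sandwich[OF _ _ tendsto_const small[OF \<open>m > 0\<close>]])
      show "\<forall>\<^sub>F n in sequentially. measure M {\<omega>\<in>space M.
          \<bar>(MAX i\<in>{1..n}. (Z i \<omega> - sample_mean n (\<lambda>j. Z j \<omega>))\<^sup>2) / ?S n \<omega>\<bar> > \<epsilon>}
          \<le> measure M {\<omega>\<in>space M. h m (?X n \<omega>) = 0}"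
        \<comment> \<open>For \<open>n = 0\<close> the maximum is taken over the empty set and is
          unspecified.\<close>
        using eventually_ge_at_top[of 1]
        by eventually_elim (intro M.finite_measure_mono hX \<open>m > 0\<close>, use bad in blast)
    qed simp
  qed
  ultimately show ?thesis
    unfolding ratio_tendsto_0_in_prob_def by blast
qed

section \<open>Step functions on blocks of equal self-normalized time\<close>

text \<open>The argument \<open>x\<close> holds increments, and each is added at the right end of
  its cell. Fed with the increments of a path that starts at 0, the function takes on each cell the
  value of the path at the left end.\<close>

definition step_fun :: "nat \<Rightarrow> (nat \<Rightarrow> real) \<Rightarrow> real \<Rightarrow> real" where
  "step_fun m x = (\<lambda>t\<in>{0..1}. \<Sum>k | k \<in> {..<m} \<and> real (Suc k) / real m \<le> t. x k)"

lemma step_fun_in_cadlag01: "step_fun m x \<in> cadlag01"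
  using step_function_in_cadlag01[of "{..<m}" 1 "sum x" "\<lambda>k. real (Suc k) / real m"]
  by (simp add: step_fun_def)

lemma step_fun_eq:
  assumes "t \<in> {0..1}" "real k / real m \<le> t" "t < real (Suc k) / real m"
  shows "step_fun m x t = (\<Sum>j<k. x j)"
proof -
  have m: "m > 0" using assms by (cases m) auto
  have "real j / real m \<le> t \<longleftrightarrow> j \<le> k" for j
  proof
    assume "real j / real m \<le> t"
    then have "real j / real m < real (Suc k) / real m" using assms by linarith
    then show "j \<le> k" using m by (simp add: divide_less_cancel)
  next
    assume "j \<le> k"
    then have "real j / real m \<le> real k / real m" by (simp add: divide_right_mono)
    then show "real j / real m \<le> t" using assms by linarith
  qed
  note iff = this
  have "real k / real m \<le> 1" using assms by simp
  then have "k \<le> m" using m by (simp add: field_simps)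
  then have "{j. j \<in> {..<m} \<and> real (Suc j) / real m \<le> t} = {..<k}"
    unfolding iff by auto
  then show ?thesis using assms(1) by (simp add: step_fun_def)
qed

text \<open>The cell number may reach \<open>m\<close>: this happens at \<open>t = 1\<close>, which
  lies in no half-open cell of the unit interval.\<close>

lemma grid_cell:
  fixes t :: real
  assumes "0 \<le> t" "m > 0"
  obtains k :: nat where "real k / real m \<le> t" "t < real (Suc k) / real m"
proof
  show "real (nat \<lfloor>t * real m\<rfloor>) / real m \<le> t"
    using assms by (simp add: field_simps)
  have "t * real m < real (Suc (nat \<lfloor>t * real m\<rfloor>))" using assms by simp linarith
  then show "t < real (Suc (nat \<lfloor>t * real m\<rfloor>)) / real m"
    using assms by (simp add: field_simps)
qed

text \<open>The last index whose partial sum of squares does not exceed level \<open>k / m\<close>,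
  that is, the block boundaries in self-normalized time. Level 0 is set to 0 separately: leading
  zero entries would otherwise push the maximum above 0, and the blocks would not exhaust the sums
  starting at 1.\<close>

definition time_index :: "nat \<Rightarrow> (nat \<Rightarrow> real) \<Rightarrow> nat \<Rightarrow> nat \<Rightarrow> nat" where
  "time_index n b m k =
     (if k = 0 then 0 else Max {j \<in> {0..n}. (\<Sum>i=1..j. (b i)\<^sup>2) \<le> real k / real m})"

lemma time_index_in:
  "time_index n b m k \<in> {j \<in> {0..n}. (\<Sum>i=1..j. (b i)\<^sup>2) \<le> real k / real m}"
proof (cases "k = 0")
  case False
  have "0 \<in> {j \<in> {0..n}. (\<Sum>i=1..j. (b i)\<^sup>2) \<le> real k / real m}" by simp
  then show ?thesis unfolding time_index_def if_not_P[OF False] by (intro Max_in) (simp, blast)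
qed (simp add: time_index_def)

lemma time_index_le: "time_index n b m k \<le> n"
  and sumsq_time_index_le: "(\<Sum>i=1..time_index n b m k. (b i)\<^sup>2) \<le> real k / real m"
  using time_index_in[of n b m k] by auto

lemma time_index_geI:
  assumes "j \<le> n" "(\<Sum>i=1..j. (b i)\<^sup>2) \<le> real k / real m" "k > 0"
  shows "j \<le> time_index n b m k"
  unfolding time_index_def using assms by (auto intro!: Max_ge)

lemma sumsq_mono: "j \<le> j' \<Longrightarrow> (\<Sum>i=1..j. (b i)\<^sup>2) \<le> (\<Sum>i=1..j'. (b i)\<^sup>2)" for b :: "nat \<Rightarrow> real"
  by (intro sum_mono2) auto

lemma time_index_leI:
  assumes "real k / real m < (\<Sum>i=1..j. (b i)\<^sup>2)"
  shows "time_index n b m k \<le> j"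
proof (rule ccontr)
  assume "\<not> ?thesis"
  then have "(\<Sum>i=1..j. (b i)\<^sup>2) \<le> (\<Sum>i=1..time_index n b m k. (b i)\<^sup>2)"
    by (intro sumsq_mono) simp
  with sumsq_time_index_le[of b n m k] assms show False by linarith
qed

lemma time_index_mono:
  assumes "k \<le> k'"
  shows "time_index n b m k \<le> time_index n b m k'"
proof (cases "k = 0")
  case False
  have "real k / real m \<le> real k' / real m" using assms by (simp add: divide_right_mono)
  then show ?thesis
    using False assms sumsq_time_index_le[of b n m k] time_index_le[of n b m k]
    by (intro time_index_geI) auto
qed (simp add: time_index_def)

lemma time_index_0 [simp]: "time_index n b m 0 = 0"
  by (simp add: time_index_def)

lemma time_index_end:
  assumes "(\<Sum>i=1..n. (b i)\<^sup>2) = 1" "m > 0"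
  shows "time_index n b m m = n"
  using assms time_index_le[of n b m m] time_index_geI[of n n b m m] by simp

text \<open>By maximality the first omitted square would overshoot the level, and that square is at
  most \<open>\<delta>\<^sup>2\<close>.\<close>

lemma sumsq_time_index_ge:
  assumes one: "(\<Sum>i=1..n. (b i)\<^sup>2) = 1" and d: "\<And>i. i \<in> {1..n} \<Longrightarrow> \<bar>b i\<bar> \<le> \<delta>"
    and k: "k \<le> m" "m > 0"
  shows "real k / real m - \<delta>\<^sup>2 \<le> (\<Sum>i=1..time_index n b m k. (b i)\<^sup>2)"
proof (cases "k = 0 \<or> time_index n b m k = n")
  case True
  have "real k / real m \<le> 1" using k by (simp add: field_simps)
  then have "real k / real m - \<delta>\<^sup>2 \<le> 1" using zero_le_power2[of \<delta>] by linarith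
  with True one show ?thesis by auto
next
  case False
  define j where "j = time_index n b m k"
  have j: "Suc j \<le> n" using False time_index_le[of n b m k] by (simp add: j_def)
  have "\<not> (\<Sum>i=1..Suc j. (b i)\<^sup>2) \<le> real k / real m"
    using time_index_geI[OF j, of b k m] False by (auto simp: j_def)
  moreover have "(b (Suc j))\<^sup>2 \<le> \<delta>\<^sup>2"
    using power_mono[OF d[of "Suc j"], of 2] j by simp
  ultimately show ?thesis unfolding j_def[symmetric] by simp
qed

abbreviation (input) block_sum :: "nat \<Rightarrow> (nat \<Rightarrow> real) \<Rightarrow> nat \<Rightarrow> (nat \<Rightarrow> real) \<Rightarrow> nat \<Rightarrow> real" where
  "block_sum n b m c k \<equiv> (\<Sum>i\<in>{time_index n b m k<..time_index n b m (Suc k)}. c i)"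

lemma sum_atLeast1_split:
  fixes f :: "nat \<Rightarrow> real"
  assumes "p \<le> q"
  shows "(\<Sum>i=1..q. f i) = (\<Sum>i=1..p. f i) + (\<Sum>i\<in>{p<..q}. f i)"
proof -
  have "{1..q} = {1..p} \<union> {p<..q}" using assms by auto
  then show ?thesis by (simp only:) (rule sum.union_disjoint, auto)
qed

lemma sum_block_sum:
  "(\<Sum>j<k. block_sum n b m c j) = (\<Sum>i=1..time_index n b m k. c i)"
proof (induction k)
  case (Suc k)
  then show ?case
    using sum_atLeast1_split[OF time_index_mono[of k "Suc k" n b m], of c] by simp
qed simp

text \<open>The index attained by the Student process at time \<open>t\<close> differs from the one attained by the
  uncentered self-normalized process at most by a neighbouring block, because centering changes the
  partial sums of squares by \<open>O(1/n)\<close> only.\<close>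

lemma student_process_close_to_step_fun:
  fixes b :: "nat \<Rightarrow> real" and L \<eta> \<delta> :: real
  defines "B \<equiv> \<lambda>j. \<Sum>i=1..j. b i"
  assumes one: "(\<Sum>i=1..n. (b i)\<^sup>2) = 1" and d: "\<And>i. i \<in> {1..n} \<Longrightarrow> \<bar>b i\<bar> \<le> \<delta>"
    and L: "L \<ge> 1" and m: "m > 0" and fine: "7 * L\<^sup>2 * \<delta>\<^sup>2 < 1 / real m"
    and scale: "2 * L ^ 3 * \<delta>\<^sup>2 \<le> \<eta>"
    and BL: "\<And>j. j \<le> n \<Longrightarrow> \<bar>B j\<bar> \<le> L"
    and osc: "\<And>k j. k < m \<Longrightarrow> j \<in> {time_index n b m k..time_index n b m (Suc k)} \<Longrightarrow>
        \<bar>\<Sum>i\<in>{time_index n b m k<..j}. b i\<bar> \<le> \<eta>"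
  shows "sup_dist (student_process n 0 b) (step_fun m (block_sum n b m b)) \<le> 3 * \<eta>"
proof (rule sup_dist_le)
  fix t :: real assume t: "t \<in> {0..1}"
  define A where "A j = (\<Sum>i=1..j. (b i)\<^sup>2)" for j
  define \<tau> where "\<tau> = time_index n b m"
  have n: "n > 0" using one by (cases n) auto
  \<comment> \<open>A unit sum of squares made of small entries needs many of them. This is why
    effects of centering, which are of order \<open>1 / n\<close>, are controlled by
    \<open>\<delta>\<close>.\<close>
  have "1 \<le> real n * \<delta>\<^sup>2"
  proof -
    have "(\<Sum>i=1..n. (b i)\<^sup>2) \<le> (\<Sum>i=1..n. \<delta>\<^sup>2)"
      using d power_mono[of "\<bar>b _\<bar>" \<delta> 2] by (intro sum_mono) auto
    then show ?thesis using one by simp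
  qed
  then have n1: "1 / real n \<le> \<delta>\<^sup>2" using n by (simp add: field_simps)
  define xb where "xb = sample_mean n b"
  have xb: "xb = B n / real n" by (simp add: xb_def sample_mean_def B_def)
  define C where "C = centered_sumsq n b"
  have C: "C j = A j - 2 * xb * B j + real j * xb\<^sup>2" for j
    by (simp add: C_def A_def B_def xb_def[symmetric] power2_diff sum.distrib sum_subtractf
        sum_distrib_left algebra_simps)
  \<comment> \<open>The common bound for each correction caused by centering:
    \<open>xb * B j\<close> and \<open>real j * xb\<^sup>2\<close>. The former occurs twice in
    \<open>C j\<close>, hence the factor 3 below.\<close>
  define q where "q = L\<^sup>2 / real n"
  have q: "0 \<le> q" "q \<le> L\<^sup>2 * \<delta>\<^sup>2"
    using mult_left_mono[OF n1, of "L\<^sup>2"] by (auto simp: q_def)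
  have xbL: "\<bar>xb\<bar> \<le> L / real n" using BL[of n] n by (simp add: xb divide_right_mono)
  have xbB: "\<bar>xb * B j\<bar> \<le> q" if "j \<le> n" for j
    using mult_mono[OF xbL BL[OF that]] L n by (simp add: q_def abs_mult power2_eq_square)
  have xb2: "0 \<le> real j * xb\<^sup>2" "real j * xb\<^sup>2 \<le> q" if "j \<le> n" for j
  proof -
    have "real j * xb\<^sup>2 \<le> real n * xb\<^sup>2" using that by (intro mult_right_mono) auto
    also have "\<dots> = xb * B n" using n by (simp add: xb power2_eq_square)
    also have "\<dots> \<le> q" using xbB[of n] by simp
    finally show "real j * xb\<^sup>2 \<le> q" .
  qed simp
  have CA: "\<bar>C j - A j\<bar> \<le> 3 * q" if "j \<le> n" for j
    using xbB[OF that] xb2[OF that] unfolding C by linarith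
  have An: "A n = 1" using one by (simp add: A_def)
  have Cn: "C n = 1 - real n * xb\<^sup>2" using n by (simp add: C An xb power2_eq_square field_simps)
  have q7: "7 * q < 1 / real m" "q < 1 / 7"
  proof -
    have "7 * q \<le> 7 * L\<^sup>2 * \<delta>\<^sup>2" using q by simp
    then show "7 * q < 1 / real m" using fine by linarith
    moreover have "1 / real m \<le> 1" using m by simp
    ultimately show "q < 1 / 7" by linarith
  qed
  have Cn_bounds: "C n \<le> 1" "1 - q \<le> C n" using xb2[of n] by (auto simp: Cn)
  define u where "u = student_index n b t"
  have u: "u \<le> n" unfolding u_def by (rule student_index_le) (use t in simp)
  have Cu: "C u \<le> t * C n"
    using student_index_in[of t n b] t unfolding C_def u_def by simp
  have Amono: "A i \<le> A j" if "i \<le> j" for i j unfolding A_def by (rule sumsq_mono[OF that])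
  have "t * C n \<le> t" using mult_left_mono[OF Cn_bounds(1), of t] t by simp
  then have Au_le: "A u \<le> t + 3 * q" using CA[OF u] Cu by linarith
  \<comment> \<open>Three times \<open>q\<close> pays for replacing \<open>C\<close> by
    \<open>A\<close>, once more \<open>q\<close> for \<open>C n\<close> being less than 1, and
    \<open>\<delta>\<^sup>2\<close> for the square of the first index not yet reached.\<close>
  have Au_ge: "t - 4 * q - \<delta>\<^sup>2 \<le> A u"
  proof (cases "u = n")
    case True
    have "t \<le> 1" using t by simp
    then show ?thesis unfolding True An using q(1) zero_le_power2[of \<delta>] by linarith
  next
    case False
    then have u': "Suc u \<le> n" using u by simp
    then have "t * C n < C (Suc u)"
      unfolding C_def u_def by (intro student_index_greater) auto
    moreover have "t - q \<le> t * C n"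
    proof -
      have "t * (1 - q) \<le> t * C n" using Cn_bounds t by (intro mult_left_mono) auto
      moreover have "t * q \<le> q" using mult_right_mono[of t 1 q] t q by simp
      ultimately show ?thesis by (simp add: algebra_simps)
    qed
    moreover have "(b (Suc u))\<^sup>2 \<le> \<delta>\<^sup>2"
      using power_mono[OF d[of "Suc u"], of 2] u' by simp
    ultimately show ?thesis
      using CA[OF u'] by (simp add: A_def)
  qed
  have d2: "\<delta>\<^sup>2 \<le> L\<^sup>2 * \<delta>\<^sup>2" using mult_right_mono[of 1 "L\<^sup>2" "\<delta>\<^sup>2"] L by simp
  \<comment> \<open>The total error is at most \<open>5 * L\<^sup>2 * \<delta>\<^sup>2\<close>,
    which \<open>fine\<close> keeps below one cell width.\<close>
  have Au: "A u < t + 1 / real m" "t - 1 / real m < A u"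
    using Au_le Au_ge q d2 fine by linarith+
  obtain k where k: "real k / real m \<le> t" "t < real (Suc k) / real m"
    using grid_cell[of t m] t m by auto
  have "real k / real m \<le> 1" using k t by simp
  then have km: "k \<le> m" using m by (simp add: field_simps)
  have step: "step_fun m (block_sum n b m b) t = B (\<tau> k)"
    unfolding step_fun_eq[OF t k] sum_block_sum B_def \<tau>_def ..
  have osc': "\<bar>B j - B (\<tau> k)\<bar> \<le> \<eta>" if "k < m" "\<tau> k \<le> j" "j \<le> \<tau> (Suc k)" for k j
    using osc[of k j] that sum_atLeast1_split[of "\<tau> k" j b] by (simp add: \<tau>_def B_def)
  have \<tau>mono: "\<tau> i \<le> \<tau> j" if "i \<le> j" for i j unfolding \<tau>_def by (rule time_index_mono[OF that])
  have osc'': "\<bar>B (\<tau> (Suc k)) - B (\<tau> k)\<bar> \<le> \<eta>" if "k < m" for k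
    using osc'[OF that] \<tau>mono[of k "Suc k"] by simp
  have \<eta>0: "\<eta> \<ge> 0" using osc''[of 0] m by linarith
  \<comment> \<open>Since \<open>A u\<close> is within one cell width of \<open>t\<close>, index
    \<open>u\<close> lies in the block of \<open>t\<close> or in an adjacent one. Passing at most
    two blocks costs \<open>2 * \<eta>\<close>; the case \<open>top\<close> is
    \<open>t = 1\<close>.\<close>
  have Bu: "\<bar>B u - B (\<tau> k)\<bar> \<le> 2 * \<eta>"
  proof -
    consider (low) "u < \<tau> k" | (mid) "\<tau> k \<le> u" "k < m" "u \<le> \<tau> (Suc k)"
      | (high) "\<tau> (Suc k) < u" "Suc k < m" | (top) "\<tau> k \<le> u" "k = m"
      | (top') "\<tau> (Suc k) < u" "Suc k = m"
      using km by linarith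
    then show ?thesis
    proof cases
      case low
      then obtain l where l: "k = Suc l" by (cases k) (auto simp: \<tau>_def)
      have "real l / real m < A u" using Au(2) k(1) m unfolding l by (simp add: field_simps)
      then have "\<tau> l \<le> u" unfolding \<tau>_def A_def by (rule time_index_leI)
      then have "\<bar>B u - B (\<tau> l)\<bar> \<le> \<eta>" using osc'[of l u] low km l by simp
      with osc''[of l] km show ?thesis unfolding l by simp
    next
      case mid
      then show ?thesis using osc'[of k u] \<eta>0 by simp
    next
      case high
      have "A u \<le> real (Suc (Suc k)) / real m"
        using Au(1) k(2) m by (simp add: field_simps)
      then have "u \<le> \<tau> (Suc (Suc k))" using u unfolding \<tau>_def A_def by (intro time_index_geI) auto
      then have "\<bar>B u - B (\<tau> (Suc k))\<bar> \<le> \<eta>" using osc'[of "Suc k" u] high by simp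
      with osc''[of k] high show ?thesis by linarith
    next
      case top
      then have "u = n" using u time_index_end[OF one m] by (simp add: \<tau>_def)
      then show ?thesis using top time_index_end[OF one m] \<eta>0 by (simp add: \<tau>_def)
    next
      case top'
      then have False using u time_index_end[OF one m] by (simp add: \<tau>_def)
      then show ?thesis ..
    qed
  qed
  \<comment> \<open>The factor by which the Student normalization differs from the
    self-normalization by the uncentered sum of squares, which is 1 here.\<close>
  define s where "s = sqrt ((real n - 1) / (real n * C n))"
  have X: "student_process n 0 b t = s * B u"
  proof -
    have "student_process n 0 b t = B u / sqrt (real n) / sqrt (C n / (real n - 1))"
      using t by (simp add: student_process_def u_def C_def B_def)
    then show ?thesis by (simp add: s_def real_sqrt_divide real_sqrt_mult)
  qed
  have s2: "\<bar>s - 1\<bar> \<le> 2 * q"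
  proof -
    have s0: "s \<ge> 0" using n Cn_bounds q7(2) by (simp add: s_def)
    have "s\<^sup>2 = (real n - 1) / (real n * C n)"
      using n Cn_bounds q7(2) by (simp add: s_def)
    then have "s\<^sup>2 - 1 = ((1 - 1 / real n) - C n) / C n"
      using n Cn_bounds q7(2) by (simp add: field_simps)
    moreover have num: "\<bar>(1 - 1 / real n) - C n\<bar> \<le> q"
    proof -
      have "1 / real n \<le> q" using L n by (simp add: q_def divide_right_mono)
      moreover have "0 \<le> 1 / real n" by simp
      ultimately show ?thesis using Cn_bounds by linarith
    qed
    moreover have "q / C n \<le> 2 * q"
      using Cn_bounds q7(2) q(1) mult_right_mono[of 1 "2 * C n" q] by (simp add: field_simps)
    moreover have "\<bar>((1 - 1 / real n) - C n) / C n\<bar> \<le> q / C n"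
      unfolding abs_divide using num Cn_bounds q7(2) by (intro frac_le) auto
    ultimately have "\<bar>s\<^sup>2 - 1\<bar> \<le> 2 * q" by linarith
    \<comment> \<open>The square root is removed by the factorization
      \<open>(s - 1) * (s + 1)\<close>, whose second factor is at least 1.\<close>
    moreover have "\<bar>s - 1\<bar> \<le> \<bar>s\<^sup>2 - 1\<bar>"
    proof -
      have "s\<^sup>2 - 1 = (s - 1) * (s + 1)" by (simp add: power2_eq_square algebra_simps)
      then have "\<bar>s\<^sup>2 - 1\<bar> = \<bar>s - 1\<bar> * (s + 1)" using s0 by (simp add: abs_mult)
      then show ?thesis using s0 mult_left_mono[of 1 "s + 1" "\<bar>s - 1\<bar>"] by simp
    qed
    ultimately show ?thesis by linarith
  qed
  have "\<bar>s * B u - B u\<bar> \<le> \<eta>"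
  proof -
    have "\<bar>s * B u - B u\<bar> = \<bar>s - 1\<bar> * \<bar>B u\<bar>" by (simp add: left_diff_distrib flip: abs_mult)
    also have "\<dots> \<le> (2 * q) * L" using s2 BL[OF u] q by (intro mult_mono) auto
    also have "\<dots> \<le> 2 * (L\<^sup>2 * \<delta>\<^sup>2) * L" using q L by (intro mult_right_mono mult_left_mono) auto
    also have "\<dots> = 2 * L ^ 3 * \<delta>\<^sup>2" by (simp add: power2_eq_square power3_eq_cube)
    finally show ?thesis using scale by linarith
  qed
  then show "\<bar>student_process n 0 b t - step_fun m (block_sum n b m b) t\<bar> \<le> 3 * \<eta>"
    using Bu unfolding X step by linarith
qed

section \<open>Rademacher signs\<close>

definition rademacher :: "nat \<Rightarrow> (nat \<Rightarrow> real) pmf" where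
  "rademacher n = Pi_pmf {1..n} 0 (\<lambda>_. pmf_of_set {-1, 1})"

lemma set_rademacher: "set_pmf (rademacher n) = PiE_dflt {1..n} 0 (\<lambda>_. {-1, 1})"
  unfolding rademacher_def by (subst set_Pi_pmf) (auto simp: o_def set_pmf_of_set)

lemma finite_set_rademacher [simp]: "finite (set_pmf (rademacher n))"
  unfolding set_rademacher by (rule finite_PiE_dflt) auto

text \<open>Finite support makes every function of the signs integrable, in particular the Lipschitz
  minorants evaluated along Student processes, with no measurability to check.\<close>

lemma integrable_rademacher [simp]:
  "integrable (measure_pmf (rademacher n)) (F :: _ \<Rightarrow> 'b :: {banach, second_countable_topology})"
  by (rule integrable_measure_pmf_finite) simp

text \<open>Conditioning on the sign with index \<open>i\<close>. Overwriting that coordinate under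
  the same law, instead of passing to the law of the remaining signs, keeps inductions within
  \<open>rademacher n\<close>.\<close>

lemma expectation_rademacher_flip:
  fixes F :: "(nat \<Rightarrow> real) \<Rightarrow> 'b :: {banach, second_countable_topology}"
  assumes i: "i \<in> {1..n}"
  shows "measure_pmf.expectation (rademacher n) F =
    (measure_pmf.expectation (rademacher n) (\<lambda>e. F (e(i := 1))) +
     measure_pmf.expectation (rademacher n) (\<lambda>e. F (e(i := -1)))) /\<^sub>R 2"
proof -
  let ?P = "Pi_pmf ({1..n} - {i}) 0 (\<lambda>_. pmf_of_set {-1, 1 :: real})"
  have P: "?P = map_pmf (\<lambda>e. e(i := 0)) (rademacher n)"
    unfolding rademacher_def by (rule Pi_pmf_remove) simp
  have fin: "finite (set_pmf ?P)" unfolding P by simp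
  have "rademacher n = pmf_of_set {-1, 1} \<bind> (\<lambda>y. ?P \<bind> (\<lambda>f. return_pmf (f(i := y))))"
    unfolding rademacher_def using i
    by (subst Pi_pmf_insert'[symmetric]) (auto simp: insert_absorb)
  also have "\<dots> = pmf_of_set {-1, 1} \<bind> (\<lambda>y. map_pmf (\<lambda>f. f(i := y)) ?P)"
    by (simp add: map_pmf_def)
  finally have "measure_pmf.expectation (rademacher n) F =
      (\<Sum>y\<in>{-1,1}. measure_pmf.expectation (map_pmf (\<lambda>f. f(i := y)) ?P) F /\<^sub>R real (card {-1, 1::real}))"
    using fin by (simp only:) (rule pmf_expectation_bind_pmf_of_set, auto)
  also have "\<dots> = (\<Sum>y\<in>{-1,1}. measure_pmf.expectation (rademacher n) (\<lambda>e. F (e(i := y))) /\<^sub>R 2)"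
    unfolding P by simp
  finally show ?thesis by (simp add: scaleR_add_right add.commute)
qed

lemma prob_rademacher_flip:
  assumes "i \<in> {1..n}"
  shows "measure_pmf.prob (rademacher n) {e. Q e} =
    (measure_pmf.prob (rademacher n) {e. Q (e(i := 1))} +
     measure_pmf.prob (rademacher n) {e. Q (e(i := -1))}) / 2"
proof -
  have "measure_pmf.prob (rademacher n) {e. Q' e} =
      measure_pmf.expectation (rademacher n) (\<lambda>e. indicator {e. Q' e} e)" for Q'
    by simp
  then show ?thesis
    using expectation_rademacher_flip[OF assms, of "indicator {e. Q e} :: _ \<Rightarrow> real"]
    by (simp add: indicator_def[abs_def])
qed

text \<open>Doob's inequality for fourth powers, by conditioning on the first sign: the right-hand side
  dominates the fourth moment of \<open>x + \<Sum> e i * a i\<close> and is superharmonic in \<open>x\<close>.\<close>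

lemma rademacher_maximal:
  fixes a :: "nat \<Rightarrow> real"
  assumes "lo \<le> hi" "hi \<le> n" "\<eta> > 0"
  shows "measure_pmf.prob (rademacher n) {e. \<exists>j\<in>{lo..hi}. \<eta> \<le> \<bar>x + (\<Sum>i\<in>{lo<..j}. e i * a i)\<bar>} * \<eta> ^ 4
    \<le> x ^ 4 + 6 * x\<^sup>2 * (\<Sum>i\<in>{lo<..hi}. (a i)\<^sup>2) + 3 * (\<Sum>i\<in>{lo<..hi}. (a i)\<^sup>2)\<^sup>2"
  using assms(1)
proof (induction lo arbitrary: x rule: inc_induct)
  case base
  show ?case
  proof (cases "\<eta> \<le> \<bar>x\<bar>")
    case True
    then have "\<eta> ^ 4 \<le> x ^ 4" using power_mono[of \<eta> "\<bar>x\<bar>" 4] \<open>\<eta> > 0\<close> by simp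
    then show ?thesis using True by simp
  qed simp
next
  case (step lo)
  define v where "v = (\<Sum>i\<in>{Suc lo<..hi}. (a i)\<^sup>2)"
  define \<alpha> where "\<alpha> = a (Suc lo)"
  have v: "v \<ge> 0" by (simp add: v_def sum_nonneg)
  have "{lo<..hi} = insert (Suc lo) {Suc lo<..hi}" using step by auto
  then have sum_v: "(\<Sum>i\<in>{lo<..hi}. (a i)\<^sup>2) = \<alpha>\<^sup>2 + v" by (simp add: \<alpha>_def v_def)
  show ?case
  proof (cases "\<eta> \<le> \<bar>x\<bar>")
    case True
    then have "\<eta> ^ 4 \<le> x ^ 4" using power_mono[of \<eta> "\<bar>x\<bar>" 4] \<open>\<eta> > 0\<close> by simp
    moreover have "measure_pmf.prob (rademacher n)
        {e. \<exists>j\<in>{lo..hi}. \<eta> \<le> \<bar>x + (\<Sum>i\<in>{lo<..j}. e i * a i)\<bar>} * \<eta> ^ 4 \<le> 1 * \<eta> ^ 4"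
      by (intro mult_right_mono) auto
    moreover have "0 \<le> 6 * x\<^sup>2 * (\<alpha>\<^sup>2 + v) + 3 * (\<alpha>\<^sup>2 + v)\<^sup>2" using v by simp
    ultimately show ?thesis unfolding sum_v by linarith
  next
    case False
    define Q where "Q y e \<longleftrightarrow> (\<exists>j\<in>{Suc lo..hi}. \<eta> \<le> \<bar>y + (\<Sum>i\<in>{Suc lo<..j}. e i * a i)\<bar>)" for y e
    have split: "{lo<..j} = insert (Suc lo) {Suc lo<..j}" if "j \<in> {Suc lo..hi}" for j
      using that by auto
    have "(\<exists>j\<in>{lo..hi}. \<eta> \<le> \<bar>x + (\<Sum>i\<in>{lo<..j}. e i * a i)\<bar>) \<longleftrightarrow>
        (\<exists>j\<in>{Suc lo..hi}. \<eta> \<le> \<bar>x + (\<Sum>i\<in>{lo<..j}. e i * a i)\<bar>)" for e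
    proof -
      have "{lo..hi} = insert lo {Suc lo..hi}" using step by auto
      then show ?thesis using False by simp
    qed
    also have "\<And>e. \<dots> e \<longleftrightarrow> Q (x + e (Suc lo) * \<alpha>) e"
      unfolding Q_def by (intro bex_cong refl) (simp add: split \<alpha>_def add.assoc)
    finally have eq: "(\<exists>j\<in>{lo..hi}. \<eta> \<le> \<bar>x + (\<Sum>i\<in>{lo<..j}. e i * a i)\<bar>) \<longleftrightarrow>
        Q (x + e (Suc lo) * \<alpha>) e" for e .
    \<comment> \<open>\<open>Q\<close> reads only signs beyond \<open>Suc lo\<close>, so after
      conditioning the same event remains, with a shifted starting point.\<close>
    have upd: "Q y (e(Suc lo := c)) \<longleftrightarrow> Q y e" for y e c
      unfolding Q_def by (intro bex_cong refl arg_cong[of _ _ "\<lambda>s. \<eta> \<le> \<bar>y + s\<bar>"] sum.cong) auto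
    have IH: "measure_pmf.prob (rademacher n) {e. Q y e} * \<eta> ^ 4 \<le> y ^ 4 + 6 * y\<^sup>2 * v + 3 * v\<^sup>2" for y
      using step.IH[of y] unfolding Q_def v_def .
    have "measure_pmf.prob (rademacher n) {e. Q (x + e (Suc lo) * \<alpha>) e} * \<eta> ^ 4 =
        (measure_pmf.prob (rademacher n) {e. Q (x + \<alpha>) e} * \<eta> ^ 4 +
         measure_pmf.prob (rademacher n) {e. Q (x - \<alpha>) e} * \<eta> ^ 4) / 2"
      by (subst prob_rademacher_flip[of "Suc lo"]) (use step assms in \<open>auto simp: upd field_simps\<close>)
    also have "\<dots> \<le> (((x + \<alpha>) ^ 4 + 6 * (x + \<alpha>)\<^sup>2 * v + 3 * v\<^sup>2) +
        ((x - \<alpha>) ^ 4 + 6 * (x - \<alpha>)\<^sup>2 * v + 3 * v\<^sup>2)) / 2"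
      using IH[of "x + \<alpha>"] IH[of "x - \<alpha>"] by simp
    \<comment> \<open>Averaging over the sign gives \<open>\<alpha> ^ 4\<close> with coefficient 1,
      while the bound has the Gaussian coefficient 3; the difference is the slack that makes the
      bound superharmonic.\<close>
    also have "\<dots> = x ^ 4 + 6 * x\<^sup>2 * (\<alpha>\<^sup>2 + v) + 3 * (\<alpha>\<^sup>2 + v)\<^sup>2 - 2 * \<alpha> ^ 4"
      by (simp add: power2_eq_square power4_eq_xxxx algebra_simps)
    also have "\<dots> \<le> x ^ 4 + 6 * x\<^sup>2 * (\<alpha>\<^sup>2 + v) + 3 * (\<alpha>\<^sup>2 + v)\<^sup>2" by simp
    finally show ?thesis unfolding eq sum_v .
  qed
qed

section \<open>Characteristic functions of signed sums\<close>

lemma indep_vars_rademacher: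
  "prob_space.indep_vars (measure_pmf (rademacher n)) (\<lambda>_. borel) (\<lambda>i e. e i * a i) {1..n}"
proof -
  have "prob_space.indep_vars (measure_pmf (rademacher n)) (\<lambda>_. count_space UNIV) (\<lambda>i e. e i) {1..n}"
    unfolding rademacher_def by (rule indep_vars_Pi_pmf) simp
  then show ?thesis
    by (rule prob_space.indep_vars_compose2[OF prob_space_measure_pmf]) auto
qed

lemma char_rademacher_sum:
  assumes "J \<subseteq> {1..n}"
  shows "char (distr (measure_pmf (rademacher n)) borel (\<lambda>e. \<Sum>i\<in>J. e i * a i)) t = (\<Prod>i\<in>J. complex_of_real (cos (t * a i)))"
proof -
  have "char (distr (measure_pmf (rademacher n)) borel (\<lambda>e. \<Sum>i\<in>J. e i * a i)) t =
      (\<Prod>i\<in>J. char (distr (measure_pmf (rademacher n)) borel (\<lambda>e. e i * a i)) t)"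
    by (rule prob_space.char_distr_sum[OF prob_space_measure_pmf])
      (rule prob_space.indep_vars_subset[OF prob_space_measure_pmf indep_vars_rademacher assms])
  also have "\<dots> = (\<Prod>i\<in>J. complex_of_real (cos (t * a i)))"
  proof (rule prod.cong[OF refl])
    fix i assume "i \<in> J"
    then have i: "i \<in> {1..n}" using assms by auto
    have "char (distr (measure_pmf (rademacher n)) borel (\<lambda>e. e i * a i)) t =
        measure_pmf.expectation (rademacher n) (\<lambda>e. iexp (t * (e i * a i)))"
      unfolding char_def by (subst integral_distr) auto
    also have "\<dots> = (iexp (t * a i) + iexp (- (t * a i))) /\<^sub>R 2"
      by (subst expectation_rademacher_flip[OF i]) simp
    also have "\<dots> = complex_of_real (cos (t * a i))"
      by (simp add: complex_eq_iff cis_conv_exp[symmetric] Re_exp Im_exp)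
    finally show "char (distr (measure_pmf (rademacher n)) borel (\<lambda>e. e i * a i)) t =
      complex_of_real (cos (t * a i))" .
  qed
  finally show ?thesis .
qed

text \<open>Both functions agree with \<open>1 - x\<^sup>2 / 2\<close> up to fourth order, with
  constants 1/24 and 1/4. For the cosine, the cubic Taylor term of \<open>iexp x\<close> is purely
  imaginary and drops out of the real part.\<close>

lemma cos_minus_exp_bound: "\<bar>cos x - exp (- x\<^sup>2 / 2)\<bar> \<le> x ^ 4" for x :: real
proof -
  have "cmod (iexp x - (\<Sum>k\<le>3. (\<i> * x) ^ k / fact k)) \<le> \<bar>x\<bar> ^ 4 / fact 4"
    using iexp_approx1[of x 3] by (simp add: numeral_eq_Suc)
  moreover have "Re (iexp x - (\<Sum>k\<le>3. (\<i> * x) ^ k / fact k)) = cos x - (1 - x\<^sup>2 / 2)"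
    by (simp add: numeral_3_eq_3 Re_exp power2_eq_square)
  ultimately have c: "\<bar>cos x - (1 - x\<^sup>2 / 2)\<bar> \<le> x ^ 4 / 24"
    using abs_Re_le_cmod[of "iexp x - (\<Sum>k\<le>3. (\<i> * x) ^ k / fact k)"] by (simp add: fact_numeral)
  define y where "y = x\<^sup>2 / 2"
  have y: "y \<ge> 0" by (simp add: y_def)
  have "exp (- y) \<le> 1 / (1 + y)"
    using exp_ge_add_one_self[of y] y by (simp add: exp_minus field_simps)
  \<comment> \<open>The product of \<open>1 + y\<close> and \<open>1 - y + y\<^sup>2\<close> is one
    plus the cube of \<open>y\<close>.\<close>
  also have "\<dots> \<le> 1 - y + y\<^sup>2"
    using y by (simp add: field_simps power2_eq_square)
  finally have "exp (- y) \<le> 1 - y + y\<^sup>2" .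
  moreover have "1 - y \<le> exp (- y)" using exp_ge_add_one_self[of "- y"] by simp
  moreover have "y\<^sup>2 = x ^ 4 / 4" by (simp add: y_def power2_eq_square power4_eq_xxxx)
  ultimately have "\<bar>exp (- x\<^sup>2 / 2) - (1 - x\<^sup>2 / 2)\<bar> \<le> x ^ 4 / 4" by (simp add: y_def)
  moreover have "0 \<le> x ^ 4" by simp
  ultimately show ?thesis using c by linarith
qed

text \<open>Factors of modulus at most 1 let the difference of products be bounded by the sum of
  differences, each at most \<open>(t * a i) ^ 4\<close>. Giving two of the four factors
  \<open>a i\<close> to \<open>\<delta>\<close> makes the sum of squares and the largest entry the
  only data that matter, which yields uniformity over arrays.\<close>

lemma char_rademacher_sum_bound:
  fixes a :: "nat \<Rightarrow> real"
  assumes J: "J \<subseteq> {1..n}" and d: "\<And>i. i \<in> J \<Longrightarrow> \<bar>a i\<bar> \<le> \<delta>"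
  shows "cmod (char (distr (measure_pmf (rademacher n)) borel (\<lambda>e. \<Sum>i\<in>J. e i * a i)) t
      - exp (- t\<^sup>2 * (\<Sum>i\<in>J. (a i)\<^sup>2) / 2)) \<le> t ^ 4 * \<delta>\<^sup>2 * (\<Sum>i\<in>J. (a i)\<^sup>2)"
proof -
  have "finite J" using J finite_subset by blast
  then have "complex_of_real (exp (- t\<^sup>2 * (\<Sum>i\<in>J. (a i)\<^sup>2) / 2)) = (\<Prod>i\<in>J. complex_of_real (exp (- (t * a i)\<^sup>2 / 2)))"
    by (simp add: exp_sum[symmetric] sum_distrib_left sum_divide_distrib power_mult_distrib sum_negf flip: of_real_prod)
  then have "cmod (char (distr (measure_pmf (rademacher n)) borel (\<lambda>e. \<Sum>i\<in>J. e i * a i)) t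
      - exp (- t\<^sup>2 * (\<Sum>i\<in>J. (a i)\<^sup>2) / 2)) =
      cmod ((\<Prod>i\<in>J. complex_of_real (cos (t * a i))) - (\<Prod>i\<in>J. complex_of_real (exp (- (t * a i)\<^sup>2 / 2))))"
    by (simp add: char_rademacher_sum[OF J] del: of_real_exp of_real_prod)
  also have "\<dots> \<le> (\<Sum>i\<in>J. cmod (complex_of_real (cos (t * a i)) - complex_of_real (exp (- (t * a i)\<^sup>2 / 2))))"
    by (rule norm_prod_diff) (auto simp del: of_real_exp)
  also have "\<dots> \<le> (\<Sum>i\<in>J. t ^ 4 * \<delta>\<^sup>2 * (a i)\<^sup>2)"
  proof (rule sum_mono)
    fix i assume "i \<in> J"
    have "cmod (complex_of_real (cos (t * a i)) - complex_of_real (exp (- (t * a i)\<^sup>2 / 2))) \<le> (t * a i) ^ 4"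
      using cos_minus_exp_bound[of "t * a i"] unfolding of_real_diff[symmetric] norm_of_real .
    also have "\<dots> = t ^ 4 * ((a i)\<^sup>2 * (a i)\<^sup>2)"
      by (simp add: power_mult_distrib power2_eq_square power4_eq_xxxx)
    also have "\<dots> \<le> t ^ 4 * (\<delta>\<^sup>2 * (a i)\<^sup>2)"
      using power_mono[OF d[OF \<open>i \<in> J\<close>], of 2] by (intro mult_left_mono mult_right_mono) auto
    finally show "cmod (complex_of_real (cos (t * a i)) - complex_of_real (exp (- (t * a i)\<^sup>2 / 2))) \<le> t ^ 4 * \<delta>\<^sup>2 * (a i)\<^sup>2"
      by simp
  qed
  finally show ?thesis by (simp add: sum_distrib_left)
qed

section \<open>Convergence of the block increments\<close>

lemma tendsto_lipschitz_coordinates: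
  fixes \<phi> :: "(nat \<Rightarrow> real) \<Rightarrow> real"
  assumes lip: "\<And>x y. \<bar>\<phi> x - \<phi> y\<bar> \<le> K * (\<Sum>k<m. \<bar>x k - y k\<bar>)"
    and lim: "\<And>k. k < m \<Longrightarrow> ((\<lambda>n. x n k) \<longlongrightarrow> y k) F"
  shows "((\<lambda>n. \<phi> (x n)) \<longlongrightarrow> \<phi> y) F"
proof -
  have "((\<lambda>n. K * (\<Sum>k<m. \<bar>x n k - y k\<bar>)) \<longlongrightarrow> K * (\<Sum>k<m. \<bar>y k - y k\<bar>)) F"
    using lim by (intro tendsto_mult tendsto_const tendsto_sum tendsto_rabs tendsto_diff) simp
  then have null: "((\<lambda>n. K * (\<Sum>k<m. \<bar>x n k - y k\<bar>)) \<longlongrightarrow> 0) F" by simp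
  have "((\<lambda>n. \<phi> (x n) - \<phi> y) \<longlongrightarrow> 0) F"
    by (rule Lim_null_comparison[OF _ null]) (intro always_eventually allI, unfold real_norm_def, rule lip)
  then show ?thesis by (simp add: LIM_zero_iff)
qed

text \<open>The Lipschitz bound makes \<open>\<phi>\<close> depend on the first \<open>m\<close>
  coordinates only and continuous for the product topology, hence Borel. Replacing later coordinates
  by 0 means that nothing is asked of \<open>X k\<close> for larger \<open>k\<close>.\<close>

lemma measurable_lipschitz_coordinates:
  fixes \<phi> :: "(nat \<Rightarrow> real) \<Rightarrow> real"
  assumes lip: "\<And>x y. \<bar>\<phi> x - \<phi> y\<bar> \<le> K * (\<Sum>k<m. \<bar>x k - y k\<bar>)"
    and X: "\<And>k. k < m \<Longrightarrow> X k \<in> borel_measurable M"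
  shows "(\<lambda>\<omega>. \<phi> (\<lambda>k. X k \<omega>)) \<in> borel_measurable M"
proof -
  have "continuous_on UNIV \<phi>"
    unfolding continuous_on_def
  proof
    fix x :: "nat \<Rightarrow> real"
    have "((\<lambda>y. y k) \<longlongrightarrow> x k) (at x within UNIV)" for k
      using continuous_on_product_coordinates[of k] unfolding continuous_on_def by blast
    then show "(\<phi> \<longlongrightarrow> \<phi> x) (at x within UNIV)"
      by (rule tendsto_lipschitz_coordinates[OF lip])
  qed
  then have "\<phi> \<in> borel_measurable borel" by (rule borel_measurable_continuous_onI)
  moreover have "(\<lambda>\<omega> k. if k < m then X k \<omega> else 0) \<in> borel_measurable M"
  proof (rule measurable_coordinatewise_then_product)
    show "(\<lambda>\<omega>. if k < m then X k \<omega> else 0) \<in> borel_measurable M" for k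
      by (cases "k < m") (simp_all add: X)
  qed
  ultimately have "(\<lambda>\<omega>. \<phi> (\<lambda>k. if k < m then X k \<omega> else 0)) \<in> borel_measurable M"
    by (rule measurable_compose[rotated])
  moreover have "\<phi> (\<lambda>k. if k < m then X k \<omega> else 0) = \<phi> (\<lambda>k. X k \<omega>)" for \<omega>
    using lip[of "\<lambda>k. if k < m then X k \<omega> else 0" "\<lambda>k. X k \<omega>"] by simp
  ultimately show ?thesis by simp
qed

text \<open>Verified on boxes. It carries couplings constructed one coordinate at a time over to the
  product space.\<close>

lemma distr_PiM_components:
  assumes fin: "finite I" and A: "\<And>i. prob_space (A i)"
    and f [measurable]: "\<And>i. f i \<in> measurable (A i) (B i)"
  shows "distr (PiM I A) (PiM I B) (\<lambda>\<omega>. \<lambda>i\<in>I. f i (\<omega> i)) = PiM I (\<lambda>i. distr (A i) (B i) (f i))"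
proof -
  interpret A: product_prob_space A by (intro product_prob_spaceI A)
  interpret N: product_prob_space "\<lambda>i. distr (A i) (B i) (f i)"
    by (intro product_prob_spaceI prob_space.prob_space_distr A f)
  have F: "(\<lambda>\<omega>. \<lambda>i\<in>I. f i (\<omega> i)) \<in> measurable (PiM I A) (PiM I B)"
    by measurable
  show ?thesis
  proof (rule N.PiM_eqI[OF fin])
    show "sets (distr (PiM I A) (PiM I B) (\<lambda>\<omega>. \<lambda>i\<in>I. f i (\<omega> i))) = sets (PiM I (\<lambda>i. distr (A i) (B i) (f i)))"
      by (simp cong: sets_PiM_cong)
    fix C assume C: "\<And>i. i \<in> I \<Longrightarrow> C i \<in> sets (distr (A i) (B i) (f i))"
    have "emeasure (distr (PiM I A) (PiM I B) (\<lambda>\<omega>. \<lambda>i\<in>I. f i (\<omega> i))) (Pi\<^sub>E I C) =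
        emeasure (PiM I A) ((\<lambda>\<omega>. \<lambda>i\<in>I. f i (\<omega> i)) -` Pi\<^sub>E I C \<inter> space (PiM I A))"
      using C by (intro emeasure_distr F sets_PiM_I_finite fin) auto
    also have "(\<lambda>\<omega>. \<lambda>i\<in>I. f i (\<omega> i)) -` Pi\<^sub>E I C \<inter> space (PiM I A) = Pi\<^sub>E I (\<lambda>i. f i -` C i \<inter> space (A i))"
      by (auto simp: space_PiM PiE_def Pi_def extensional_def)
    also have "emeasure (PiM I A) \<dots> = (\<Prod>i\<in>I. emeasure (A i) (f i -` C i \<inter> space (A i)))"
      using C by (intro A.emeasure_PiM fin) auto
    also have "\<dots> = (\<Prod>i\<in>I. emeasure (distr (A i) (B i) (f i)) (C i))"
      using C by (intro prod.cong refl emeasure_distr[symmetric]) auto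
    finally show "emeasure (distr (PiM I A) (PiM I B) (\<lambda>\<omega>. \<lambda>i\<in>I. f i (\<omega> i))) (Pi\<^sub>E I C) =
        (\<Prod>i\<in>I. emeasure (distr (A i) (B i) (f i)) (C i))" .
  qed
qed

text \<open>Skorohod's theorem, available on the line, is applied in each coordinate. On the product
  of the representing spaces all coordinates converge pointwise, and dominated convergence finishes
  the argument.\<close>

lemma weak_conv_m_PiM:
  fixes \<mu> :: "nat \<Rightarrow> 'i \<Rightarrow> real measure"
  assumes fin: "finite I"
    and \<mu>: "\<And>n i. real_distribution (\<mu> n i)" and \<nu>: "\<And>i. real_distribution (\<nu> i)"
    and conv: "\<And>i. weak_conv_m (\<lambda>n. \<mu> n i) (\<nu> i)"
    and \<phi>: "\<phi> \<in> borel_measurable (PiM I (\<lambda>_. borel))" and bounded: "\<And>x. \<bar>\<phi> x\<bar> \<le> B"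
    and cont: "\<And>x y. (\<And>i. i \<in> I \<Longrightarrow> (\<lambda>n. x n i) \<longlonglongrightarrow> y i) \<Longrightarrow> (\<lambda>n. \<phi> (x n)) \<longlonglongrightarrow> (\<phi> y :: real)"
  shows "(\<lambda>n. \<integral>x. \<phi> x \<partial>PiM I (\<mu> n)) \<longlonglongrightarrow> (\<integral>x. \<phi> x \<partial>PiM I \<nu>)"
proof -
  \<comment> \<open>Space, approximating variables and limit variable are packed into one tuple, so
    that a single application of choice selects them for all coordinates.\<close>
  have "\<forall>i. \<exists>S :: real measure \<times> (nat \<Rightarrow> real \<Rightarrow> real) \<times> (real \<Rightarrow> real). prob_space (fst S) \<and> (\<forall>n. fst (snd S) n \<in> borel_measurable (fst S)) \<and>
      (\<forall>n. distr (fst S) borel (fst (snd S) n) = \<mu> n i) \<and>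
      snd (snd S) \<in> borel_measurable (fst S) \<and> distr (fst S) borel (snd (snd S)) = \<nu> i \<and>
      (\<forall>x\<in>space (fst S). (\<lambda>n. fst (snd S) n x) \<longlonglongrightarrow> snd (snd S) x)"
  proof
    fix i
    obtain \<Omega> :: "real measure" and Ys Y where "prob_space \<Omega>"
      "\<forall>n. Ys n \<in> measurable \<Omega> borel" "\<forall>n. distr \<Omega> borel (Ys n) = \<mu> n i"
      "Y \<in> measurable \<Omega> lborel" "distr \<Omega> borel Y = \<nu> i" "\<forall>x\<in>space \<Omega>. (\<lambda>n. Ys n x) \<longlonglongrightarrow> Y x"
      using Skorohod[OF \<mu> \<nu> conv] by blast
    then show "\<exists>S :: real measure \<times> (nat \<Rightarrow> real \<Rightarrow> real) \<times> (real \<Rightarrow> real). prob_space (fst S) \<and> (\<forall>n. fst (snd S) n \<in> borel_measurable (fst S)) \<and>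
      (\<forall>n. distr (fst S) borel (fst (snd S) n) = \<mu> n i) \<and>
      snd (snd S) \<in> borel_measurable (fst S) \<and> distr (fst S) borel (snd (snd S)) = \<nu> i \<and>
      (\<forall>x\<in>space (fst S). (\<lambda>n. fst (snd S) n x) \<longlonglongrightarrow> snd (snd S) x)"
      by (intro exI[of _ "(\<Omega>, Ys, Y)"]) simp
  qed
  from choice[OF this] obtain S :: "'i \<Rightarrow> real measure \<times> (nat \<Rightarrow> real \<Rightarrow> real) \<times> (real \<Rightarrow> real)"
    where S: "\<And>i. prob_space (fst (S i))"
      "\<And>i n. fst (snd (S i)) n \<in> borel_measurable (fst (S i))"
      "\<And>i n. distr (fst (S i)) borel (fst (snd (S i)) n) = \<mu> n i"
      "\<And>i. snd (snd (S i)) \<in> borel_measurable (fst (S i))"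
      "\<And>i. distr (fst (S i)) borel (snd (snd (S i))) = \<nu> i"
      "\<And>i x. x \<in> space (fst (S i)) \<Longrightarrow> (\<lambda>n. fst (snd (S i)) n x) \<longlonglongrightarrow> snd (snd (S i)) x"
    by blast
  define \<Omega> where "\<Omega> i = fst (S i)" for i
  define Ys where "Ys i = fst (snd (S i))" for i
  define Y where "Y i = snd (snd (S i))" for i
  note S = S[folded \<Omega>_def Ys_def Y_def]
  note [measurable] = S(2) S(4)
  interpret P: prob_space "PiM I \<Omega>" by (intro prob_space_PiM S(1))
  have Fs [measurable]: "(\<lambda>\<omega>. \<lambda>i\<in>I. Ys i n (\<omega> i)) \<in> measurable (PiM I \<Omega>) (PiM I (\<lambda>_. borel))" for n
    by measurable
  have F [measurable]: "(\<lambda>\<omega>. \<lambda>i\<in>I. Y i (\<omega> i)) \<in> measurable (PiM I \<Omega>) (PiM I (\<lambda>_. borel))"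
    by measurable
  have "(\<integral>x. \<phi> x \<partial>PiM I (\<mu> n)) = (\<integral>\<omega>. \<phi> (\<lambda>i\<in>I. Ys i n (\<omega> i)) \<partial>PiM I \<Omega>)" for n
    unfolding S(3)[symmetric] by (subst distr_PiM_components[symmetric]) (use fin S \<phi> in \<open>auto simp: integral_distr\<close>)
  moreover have "(\<integral>x. \<phi> x \<partial>PiM I \<nu>) = (\<integral>\<omega>. \<phi> (\<lambda>i\<in>I. Y i (\<omega> i)) \<partial>PiM I \<Omega>)"
    unfolding S(5)[symmetric] by (subst distr_PiM_components[symmetric]) (use fin S \<phi> in \<open>auto simp: integral_distr\<close>)
  moreover have "(\<lambda>n. \<integral>\<omega>. \<phi> (\<lambda>i\<in>I. Ys i n (\<omega> i)) \<partial>PiM I \<Omega>) \<longlonglongrightarrow> (\<integral>\<omega>. \<phi> (\<lambda>i\<in>I. Y i (\<omega> i)) \<partial>PiM I \<Omega>)"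
  proof (rule integral_dominated_convergence[where w = "\<lambda>_. B"])
    show "AE \<omega> in PiM I \<Omega>. (\<lambda>n. \<phi> (\<lambda>i\<in>I. Ys i n (\<omega> i))) \<longlonglongrightarrow> \<phi> (\<lambda>i\<in>I. Y i (\<omega> i))"
    proof (rule AE_I2, rule cont)
      fix \<omega> i assume "\<omega> \<in> space (PiM I \<Omega>)" "i \<in> I"
      then show "(\<lambda>n. (\<lambda>i\<in>I. Ys i n (\<omega> i)) i) \<longlonglongrightarrow> (\<lambda>i\<in>I. Y i (\<omega> i)) i"
        using S(6)[of "\<omega> i" i] by (auto simp: space_PiM PiE_def Pi_def)
    qed
    show "(\<lambda>\<omega>. \<phi> (\<lambda>i\<in>I. Y i (\<omega> i))) \<in> borel_measurable (PiM I \<Omega>)"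
      by (rule measurable_compose[OF F \<phi>])
    show "(\<lambda>\<omega>. \<phi> (\<lambda>i\<in>I. Ys i n (\<omega> i))) \<in> borel_measurable (PiM I \<Omega>)" for n
      by (rule measurable_compose[OF Fs \<phi>])
  qed (use bounded in simp_all)
  ultimately show ?thesis by simp
qed

section \<open>Joint limit of the block sums\<close>

lemma distr_indep_vars_PiM:
  assumes "prob_space M" and ne: "I \<noteq> {}"
    and ind: "prob_space.indep_vars M (\<lambda>_. borel) X I"
  shows "distr M (PiM I (\<lambda>_. borel)) (\<lambda>\<omega>. \<lambda>k\<in>I. X k \<omega>) = PiM I (\<lambda>k. distr M borel (X k))"
proof -
  interpret prob_space M by fact
  have rv: "X k \<in> borel_measurable M" if "k \<in> I" for k
    using ind that unfolding indep_vars_def by auto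
  from iffD1[OF indep_vars_iff_distr_eq_PiM'[OF ne rv] ind] show ?thesis .
qed

lemma indep_vars_block_sums:
  "prob_space.indep_vars (measure_pmf (rademacher n)) (\<lambda>_. borel)
     (\<lambda>k e. c * block_sum n b m (\<lambda>i. e i * a i) k) {..<m}"
proof -
  let ?R = "measure_pmf (rademacher n)"
  define K where "K k = {time_index n b m k<..time_index n b m (Suc k)}" for k
  have K: "K k \<subseteq> {1..n}" for k
  proof
    fix i assume "i \<in> K k"
    then have "0 < i" "i \<le> time_index n b m (Suc k)" by (simp_all add: K_def)
    with time_index_le[of n b m "Suc k"] show "i \<in> {1..n}"
      unfolding atLeastAtMost_iff by linarith
  qed
  have "K i \<inter> K j = {}" if "i < j" for i j
    using time_index_mono[of "Suc i" j n b m] that by (auto simp: K_def)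
  then have disj: "disjoint_family_on K {..<m}"
    unfolding disjoint_family_on_def by (metis Int_commute nat_neq_iff)
  have "prob_space.indep_vars ?R (\<lambda>k. PiM (K k) (\<lambda>_. borel)) (\<lambda>k e. restrict (\<lambda>i. e i * a i) (K k)) {..<m}"
    by (rule prob_space.indep_vars_restrict[OF prob_space_measure_pmf indep_vars_rademacher K disj])
  then have "prob_space.indep_vars ?R (\<lambda>_. borel) (\<lambda>k e. c * (\<Sum>i\<in>K k. restrict (\<lambda>i. e i * a i) (K k) i)) {..<m}"
    by (rule prob_space.indep_vars_compose2[OF prob_space_measure_pmf]) measurable
  then show ?thesis
    by (simp add: K_def)
qed

text \<open>The sums of squares at both ends of the block fall short of their levels by between 0
  and \<open>\<delta>\<^sup>2\<close>, so the difference errs by at most that amount in either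
  direction.\<close>

lemma block_sum_sumsq_bounds:
  assumes one: "(\<Sum>i=1..n. (a i)\<^sup>2) = 1" and d: "\<And>i. i \<in> {1..n} \<Longrightarrow> \<bar>a i\<bar> \<le> \<delta>" and k: "k < m"
  shows "\<bar>block_sum n a m (\<lambda>i. (a i)\<^sup>2) k - 1 / real m\<bar> \<le> \<delta>\<^sup>2"
proof -
  let ?\<tau> = "time_index n a m"
  have "(\<Sum>i=1..?\<tau> (Suc k). (a i)\<^sup>2) = (\<Sum>i=1..?\<tau> k. (a i)\<^sup>2) + block_sum n a m (\<lambda>i. (a i)\<^sup>2) k"
    by (rule sum_atLeast1_split[OF time_index_mono]) simp
  moreover have "real (Suc k) / real m = real k / real m + 1 / real m" by (simp add: add_divide_distrib)
  moreover have "real k / real m - \<delta>\<^sup>2 \<le> (\<Sum>i=1..?\<tau> k. (a i)\<^sup>2)"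
    using k by (intro sumsq_time_index_ge[OF one d]) simp_all
  moreover have "real (Suc k) / real m - \<delta>\<^sup>2 \<le> (\<Sum>i=1..?\<tau> (Suc k). (a i)\<^sup>2)"
    using k by (intro sumsq_time_index_ge[OF one d]) simp_all
  ultimately show ?thesis
    using sumsq_time_index_le[of a n m k] sumsq_time_index_le[of a n m "Suc k"] by linarith
qed

text \<open>Levy's continuity theorem: the block has variance tending to \<open>1 / m\<close>, which
  \<open>sqrt (real m)\<close> scales to 1, and the characteristic function is within a vanishing
  error of the Gaussian one with the actual block variance \<open>v q\<close>.\<close>

lemma block_sum_weak_conv:
  fixes nn :: "nat \<Rightarrow> nat" and a :: "nat \<Rightarrow> nat \<Rightarrow> real"
  assumes one: "\<And>q. (\<Sum>i=1..nn q. (a q i)\<^sup>2) = 1"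
    and d: "\<And>q i. i \<in> {1..nn q} \<Longrightarrow> \<bar>a q i\<bar> \<le> \<delta> q" and \<delta>: "\<delta> \<longlonglongrightarrow> 0" and k: "k < m"
  shows "weak_conv_m (\<lambda>q. distr (measure_pmf (rademacher (nn q))) borel
      (\<lambda>e. sqrt (real m) * block_sum (nn q) (a q) m (\<lambda>i. e i * a q i) k)) std_normal_distribution"
proof (rule levy_continuity[OF _ real_dist_normal_dist])
  show "real_distribution (distr (measure_pmf (rademacher (nn q))) borel
      (\<lambda>e. sqrt (real m) * block_sum (nn q) (a q) m (\<lambda>i. e i * a q i) k))" for q
    by (rule prob_space.real_distribution_distr[OF prob_space_measure_pmf]) simp
  fix t
  let ?J = "\<lambda>q. {time_index (nn q) (a q) m k<..time_index (nn q) (a q) m (Suc k)}"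
  define v where "v q = block_sum (nn q) (a q) m (\<lambda>i. (a q i)\<^sup>2) k" for q
  define ch where "ch q = char (distr (measure_pmf (rademacher (nn q))) borel
      (\<lambda>e. sqrt (real m) * block_sum (nn q) (a q) m (\<lambda>i. e i * a q i) k)) t" for q
  have m: "real m > 0" using k by simp
  have v: "\<bar>v q - 1 / real m\<bar> \<le> (\<delta> q)\<^sup>2" for q
    unfolding v_def by (rule block_sum_sumsq_bounds[OF one d k])
  have \<delta>2: "(\<lambda>q. (\<delta> q)\<^sup>2) \<longlonglongrightarrow> 0" using tendsto_power[OF \<delta>, of 2] by simp
  have "(\<lambda>q. v q - 1 / real m) \<longlonglongrightarrow> 0"
    by (rule Lim_null_comparison[OF _ \<delta>2]) (use v in simp)
  then have v_lim: "v \<longlonglongrightarrow> 1 / real m" by (simp add: LIM_zero_iff)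
  have bound: "cmod (ch q - exp (- t\<^sup>2 * (real m * v q) / 2)) \<le> t ^ 4 * (real m * (\<delta> q)\<^sup>2) * (real m * v q)" for q
  proof -
    have J: "?J q \<subseteq> {1..nn q}"
    proof
      fix i assume "i \<in> ?J q"
      then have "0 < i" "i \<le> time_index (nn q) (a q) m (Suc k)" by simp_all
      with time_index_le[of "nn q" "a q" m "Suc k"] show "i \<in> {1..nn q}"
        unfolding atLeastAtMost_iff by linarith
    qed
    have "\<bar>sqrt (real m) * a q i\<bar> \<le> sqrt (real m) * \<delta> q" if "i \<in> ?J q" for i
    proof -
      have "i \<in> {1..nn q}" using J that by blast
      from mult_left_mono[OF d[OF this], of "sqrt (real m)"] show ?thesis by (simp add: abs_mult)
    qed
    from char_rademacher_sum_bound[OF J this, where t = t] show ?thesis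
      using m by (simp add: ch_def v_def power_mult_distrib sum_distrib_left ac_simps)
  qed
  have "(\<lambda>q. t ^ 4 * (real m * (\<delta> q)\<^sup>2) * (real m * v q)) \<longlonglongrightarrow> t ^ 4 * (real m * 0) * (real m * (1 / real m))"
    by (intro tendsto_intros \<delta>2 v_lim)
  then have null: "(\<lambda>q. t ^ 4 * (real m * (\<delta> q)\<^sup>2) * (real m * v q)) \<longlonglongrightarrow> 0" by simp
  have "(\<lambda>q. ch q - exp (- t\<^sup>2 * (real m * v q) / 2)) \<longlonglongrightarrow> 0"
    by (rule Lim_null_comparison[OF _ null]) (intro always_eventually allI bound)
  moreover have "(\<lambda>q. exp (- t\<^sup>2 * (real m * v q) / 2)) \<longlonglongrightarrow> exp (- t\<^sup>2 * (real m * (1 / real m)) / 2)"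
    by (intro tendsto_intros v_lim) auto
  then have "(\<lambda>q. complex_of_real (exp (- t\<^sup>2 * (real m * v q) / 2))) \<longlonglongrightarrow> complex_of_real (exp (- (t\<^sup>2) / 2))"
    using m by (intro tendsto_of_real) simp
  ultimately have "(\<lambda>q. (ch q - exp (- t\<^sup>2 * (real m * v q) / 2)) + exp (- t\<^sup>2 * (real m * v q) / 2)) \<longlonglongrightarrow> 0 + complex_of_real (exp (- (t\<^sup>2) / 2))"
    by (rule tendsto_add)
  then show "(\<lambda>q. char (distr (measure_pmf (rademacher (nn q))) borel
      (\<lambda>e. sqrt (real m) * block_sum (nn q) (a q) m (\<lambda>i. e i * a q i) k)) t) \<longlonglongrightarrow> char std_normal_distribution t"
    by (simp add: ch_def char_std_normal_distribution)
qed

lemma (in std_wiener_process) increments_standardized: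
  assumes m: "m > 0"
  shows "indep_vars (\<lambda>_. borel) (\<lambda>k \<omega>. sqrt (real m) * (W (real (Suc k) / real m) \<omega> - W (real k / real m) \<omega>)) {..<m}"
    and "k < m \<Longrightarrow> distr N borel (\<lambda>\<omega>. sqrt (real m) * (W (real (Suc k) / real m) \<omega> - W (real k / real m) \<omega>)) = std_normal_distribution"
proof -
  have "indep_vars (\<lambda>_. borel) (\<lambda>k \<omega>. W (real (Suc k) / real m) \<omega> - W (real k / real m) \<omega>) {..<m}"
    using m by (intro indep_increments[of m "\<lambda>i. real i / real m"]) (simp_all add: divide_strict_right_mono)
  then show "indep_vars (\<lambda>_. borel) (\<lambda>k \<omega>. sqrt (real m) * (W (real (Suc k) / real m) \<omega> - W (real k / real m) \<omega>)) {..<m}"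
    by (rule indep_vars_compose2) simp
  assume k: "k < m"
  have diff: "real (Suc k) / real m - real k / real m = 1 / real m" by (simp add: add_divide_distrib)
  have "distributed N lborel (\<lambda>\<omega>. W (real (Suc k) / real m) \<omega> - W (real k / real m) \<omega>) (normal_density 0 (sqrt (1 / real m)))"
    using normal_increments[of "real k / real m" "real (Suc k) / real m"] k
    unfolding diff by (simp add: field_simps)
  then have "distributed N lborel (\<lambda>\<omega>. (W (real (Suc k) / real m) \<omega> - W (real k / real m) \<omega> - 0) / sqrt (1 / real m)) std_normal_density"
    using m by (subst normal_standard_normal_convert[symmetric]) auto
  then have "distributed N lborel (\<lambda>\<omega>. sqrt (real m) * (W (real (Suc k) / real m) \<omega> - W (real k / real m) \<omega>)) std_normal_density"
    by (simp add: real_sqrt_divide mult.commute)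
  from distributed_distr_eq_density[OF this]
  show "distr N borel (\<lambda>\<omega>. sqrt (real m) * (W (real (Suc k) / real m) \<omega> - W (real k / real m) \<omega>)) = std_normal_distribution"
    by (simp cong: distr_cong)
qed

text \<open>Scaled by \<open>sqrt (real m)\<close>, the block sums as well as the Wiener increments
  are independent, so their joint laws are product measures, and coordinatewise convergence to the
  standard normal law suffices.\<close>

lemma (in std_wiener_process) rademacher_fidi_sequence:
  fixes nn :: "nat \<Rightarrow> nat" and a :: "nat \<Rightarrow> nat \<Rightarrow> real" and \<phi> :: "(nat \<Rightarrow> real) \<Rightarrow> real"
  assumes one: "\<And>q. (\<Sum>i=1..nn q. (a q i)\<^sup>2) = 1"
    and d: "\<And>q i. i \<in> {1..nn q} \<Longrightarrow> \<bar>a q i\<bar> \<le> \<delta> q" and \<delta>: "\<delta> \<longlonglongrightarrow> 0" and m: "m > 0"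
    and lip: "\<And>x y. \<bar>\<phi> x - \<phi> y\<bar> \<le> K * (\<Sum>k<m. \<bar>x k - y k\<bar>)" and bounded: "\<And>x. \<bar>\<phi> x\<bar> \<le> B"
  shows "(\<lambda>q. measure_pmf.expectation (rademacher (nn q)) (\<lambda>e. \<phi> (block_sum (nn q) (a q) m (\<lambda>i. e i * a q i))))
    \<longlonglongrightarrow> expectation (\<lambda>\<omega>. \<phi> (\<lambda>k. W (real (Suc k) / real m) \<omega> - W (real k / real m) \<omega>))"
proof -
  have "0 \<in> {..<m}" using m by simp
  then have ne: "{..<m} \<noteq> {}" by (metis empty_iff)
  define \<psi> where "\<psi> x = \<phi> (\<lambda>k. x k / sqrt (real m))" for x
  define X where "X q k e = sqrt (real m) * block_sum (nn q) (a q) m (\<lambda>i. e i * a q i) k" for q k e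
  define Y where "Y k \<omega> = sqrt (real m) * (W (real (Suc k) / real m) \<omega> - W (real k / real m) \<omega>)" for k \<omega>
  have \<psi>_lip: "\<bar>\<psi> x - \<psi> y\<bar> \<le> (K / sqrt (real m)) * (\<Sum>k<m. \<bar>x k - y k\<bar>)" for x y
    using lip[of "\<lambda>k. x k / sqrt (real m)" "\<lambda>k. y k / sqrt (real m)"]
    by (simp add: \<psi>_def sum_divide_distrib[symmetric] flip: diff_divide_distrib)
  have \<psi>_meas: "\<psi> \<in> borel_measurable (PiM {..<m} (\<lambda>_. borel))"
    using measurable_lipschitz_coordinates[OF \<psi>_lip, of "\<lambda>k x. x k"] by simp
  have \<psi>_restrict: "\<psi> (\<lambda>k\<in>{..<m}. x k) = \<psi> x" for x
    using \<psi>_lip[of "\<lambda>k\<in>{..<m}. x k" x] by simp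
  have \<psi>_cont: "(\<lambda>n. \<psi> (x n)) \<longlonglongrightarrow> \<psi> y" if "\<And>i. i \<in> {..<m} \<Longrightarrow> (\<lambda>n. x n i) \<longlonglongrightarrow> y i" for x y
    by (rule tendsto_lipschitz_coordinates[OF \<psi>_lip]) (use that in simp)
  \<comment> \<open>Coordinates from \<open>m\<close> onwards get the limit law itself, because the
    product lemma asks for convergence at every index.\<close>
  define \<mu> where "\<mu> q k = (if k < m then distr (measure_pmf (rademacher (nn q))) borel (X q k) else std_normal_distribution)" for q k
  have real: "real_distribution (\<mu> q k)" for q k
    using real_dist_normal_dist prob_space.real_distribution_distr[OF prob_space_measure_pmf, of "X q k" "rademacher (nn q)"]
    by (simp add: \<mu>_def)
  have conv: "weak_conv_m (\<lambda>q. \<mu> q k) std_normal_distribution" for k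
  proof (cases "k < m")
    case True
    then show ?thesis
      using block_sum_weak_conv[OF one d \<delta> True] by (simp add: \<mu>_def X_def[abs_def])
  next
    case False
    then show ?thesis by (simp add: \<mu>_def weak_conv_m_def weak_conv_def)
  qed
  have "(\<lambda>q. \<integral>x. \<psi> x \<partial>PiM {..<m} (\<mu> q)) \<longlonglongrightarrow> (\<integral>x. \<psi> x \<partial>PiM {..<m} (\<lambda>_. std_normal_distribution))"
    by (rule weak_conv_m_PiM[OF _ real real_dist_normal_dist conv \<psi>_meas _ \<psi>_cont])
      (simp, unfold \<psi>_def, rule bounded)
  moreover have "(\<integral>x. \<psi> x \<partial>PiM {..<m} (\<mu> q)) =
      measure_pmf.expectation (rademacher (nn q)) (\<lambda>e. \<phi> (block_sum (nn q) (a q) m (\<lambda>i. e i * a q i)))" for q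
  proof -
    have "PiM {..<m} (\<mu> q) = PiM {..<m} (\<lambda>k. distr (measure_pmf (rademacher (nn q))) borel (X q k))"
      by (intro PiM_cong) (auto simp: \<mu>_def)
    also have "\<dots> = distr (measure_pmf (rademacher (nn q))) (PiM {..<m} (\<lambda>_. borel)) (\<lambda>e. \<lambda>k\<in>{..<m}. X q k e)"
      by (rule distr_indep_vars_PiM[symmetric, OF prob_space_measure_pmf ne])
        (unfold X_def, rule indep_vars_block_sums)
    finally have "(\<integral>x. \<psi> x \<partial>PiM {..<m} (\<mu> q)) = measure_pmf.expectation (rademacher (nn q)) (\<lambda>e. \<psi> (\<lambda>k\<in>{..<m}. X q k e))"
      by (simp only:) (rule integral_distr, auto simp: \<psi>_meas space_PiM)
    then show ?thesis unfolding \<psi>_restrict using m by (simp add: \<psi>_def X_def)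
  qed
  moreover have "(\<integral>x. \<psi> x \<partial>PiM {..<m} (\<lambda>_. std_normal_distribution)) =
      expectation (\<lambda>\<omega>. \<phi> (\<lambda>k. W (real (Suc k) / real m) \<omega> - W (real k / real m) \<omega>))"
  proof -
    have indep: "indep_vars (\<lambda>_. borel) Y {..<m}"
      using increments_standardized(1)[OF m] unfolding Y_def .
    have "distr N borel (Y k) = std_normal_distribution" if "k < m" for k
      unfolding Y_def[abs_def] by (rule increments_standardized(2)[OF m that])
    then have "PiM {..<m} (\<lambda>_. std_normal_distribution) = PiM {..<m} (\<lambda>k. distr N borel (Y k))"
      by (intro PiM_cong) simp_all
    also have "\<dots> = distr N (PiM {..<m} (\<lambda>_. borel)) (\<lambda>\<omega>. \<lambda>k\<in>{..<m}. Y k \<omega>)"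
      by (rule distr_indep_vars_PiM[symmetric, OF prob_space_axioms ne indep])
    finally have eq: "PiM {..<m} (\<lambda>_. std_normal_distribution) = distr N (PiM {..<m} (\<lambda>_. borel)) (\<lambda>\<omega>. \<lambda>k\<in>{..<m}. Y k \<omega>)" .
    have "(\<lambda>\<omega>. \<lambda>k\<in>{..<m}. Y k \<omega>) \<in> measurable N (PiM {..<m} (\<lambda>_. borel))"
      using indep unfolding indep_vars_def by (intro measurable_restrict) auto
    then have "(\<integral>x. \<psi> x \<partial>PiM {..<m} (\<lambda>_. std_normal_distribution)) = expectation (\<lambda>\<omega>. \<psi> (\<lambda>k\<in>{..<m}. Y k \<omega>))"
      unfolding eq by (rule integral_distr[OF _ \<psi>_meas])
    then show ?thesis unfolding \<psi>_restrict using m by (simp add: \<psi>_def Y_def)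
  qed
  ultimately show ?thesis by (simp only:)
qed

text \<open>Uniformity by contradiction: if no \<open>\<delta>\<close> works, picking a
  counterexample for each bound \<open>1 / real (Suc q)\<close> gives a sequence of arrays that
  violates the sequential limit.\<close>

lemma (in std_wiener_process) rademacher_fidi:
  fixes \<phi> :: "(nat \<Rightarrow> real) \<Rightarrow> real"
  assumes m: "m > 0" and lip: "\<And>x y. \<bar>\<phi> x - \<phi> y\<bar> \<le> K * (\<Sum>k<m. \<bar>x k - y k\<bar>)"
    and bounded: "\<And>x. \<bar>\<phi> x\<bar> \<le> B" and \<epsilon>: "\<epsilon> > 0"
  obtains \<delta> where "\<delta> > 0"
    "\<And>n a. (\<Sum>i=1..n. (a i)\<^sup>2) = 1 \<Longrightarrow> (\<And>i. i \<in> {1..n} \<Longrightarrow> \<bar>a i\<bar> \<le> \<delta>) \<Longrightarrow>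
      \<bar>measure_pmf.expectation (rademacher n) (\<lambda>e. \<phi> (block_sum n a m (\<lambda>i. e i * a i))) -
       expectation (\<lambda>\<omega>. \<phi> (\<lambda>k. W (real (Suc k) / real m) \<omega> - W (real k / real m) \<omega>))\<bar> < \<epsilon>"
proof (rule ccontr)
  let ?E = "\<lambda>n a. \<bar>measure_pmf.expectation (rademacher n) (\<lambda>e. \<phi> (block_sum n a m (\<lambda>i. e i * a i))) -
       expectation (\<lambda>\<omega>. \<phi> (\<lambda>k. W (real (Suc k) / real m) \<omega> - W (real k / real m) \<omega>))\<bar>"
  assume contra: "\<not> thesis"
  have "\<exists>p. (\<Sum>i=1..fst p. (snd p i)\<^sup>2) = 1 \<and> (\<forall>i\<in>{1..fst p}. \<bar>snd p i\<bar> \<le> 1 / real (Suc q)) \<and>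
      \<epsilon> \<le> ?E (fst p) (snd p)" for q :: nat
  proof (rule ccontr)
    assume none: "\<not> ?thesis"
    have small: "?E n a < \<epsilon>"
      if "(\<Sum>i=1..n. (a i)\<^sup>2) = 1" "\<And>i. i \<in> {1..n} \<Longrightarrow> \<bar>a i\<bar> \<le> 1 / real (Suc q)" for n a
    proof (rule ccontr)
      assume "\<not> ?E n a < \<epsilon>"
      then have large: "\<epsilon> \<le> ?E n a" by (rule leI)
      have "\<exists>p. (\<Sum>i=1..fst p. (snd p i)\<^sup>2) = 1 \<and> (\<forall>i\<in>{1..fst p}. \<bar>snd p i\<bar> \<le> 1 / real (Suc q)) \<and>
          \<epsilon> \<le> ?E (fst p) (snd p)"
        by (rule exI[of _ "(n, a)"], unfold fst_conv snd_conv) (intro conjI ballI that large)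
      with none show False by (rule notE)
    qed
    show False
    proof (rule notE[OF contra], rule that)
      show "0 < 1 / real (Suc q)" by simp
    qed (rule small)
  qed
  then have "\<forall>q::nat. \<exists>p. (\<Sum>i=1..fst p. (snd p i)\<^sup>2) = 1 \<and> (\<forall>i\<in>{1..fst p}. \<bar>snd p i\<bar> \<le> 1 / real (Suc q)) \<and>
      \<epsilon> \<le> ?E (fst p) (snd p)" ..
  from choice[OF this] obtain p where p: "\<And>q. (\<Sum>i=1..fst (p q). (snd (p q) i)\<^sup>2) = 1"
      "\<And>q i. i\<in>{1..fst (p q)} \<Longrightarrow> \<bar>snd (p q) i\<bar> \<le> 1 / real (Suc q)"
      "\<And>q. \<epsilon> \<le> ?E (fst (p q)) (snd (p q))"
    by blast
  have "(\<lambda>q. 1 / real (Suc q)) \<longlonglongrightarrow> 0" using LIMSEQ_inverse_real_of_nat by (simp add: inverse_eq_divide)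
  from rademacher_fidi_sequence[OF p(1,2) this m lip bounded]
  have "(\<lambda>q. ?E (fst (p q)) (snd (p q))) \<longlonglongrightarrow> 0"
    by (intro tendsto_rabs_zero) (simp add: LIM_zero_iff)
  then have "\<epsilon> \<le> 0"
    by (rule LIMSEQ_le_const) (use p(3) in auto)
  with \<epsilon> show False by simp
qed

section \<open>Lipschitz minorants of a functional\<close>

text \<open>The infimal convolution of \<open>h\<close> with \<open>k\<close> times the metric
  (Pasch-Hausdorff envelope), which for bounded \<open>h\<close> is the largest minorant with
  Lipschitz constant \<open>k\<close>.\<close>

definition lower_env :: "((real \<Rightarrow> real) \<Rightarrow> real) \<Rightarrow> nat \<Rightarrow> (real \<Rightarrow> real) \<Rightarrow> real" where
  "lower_env h k f = (INF g\<in>cadlag01. h g + real k * sup_dist g f)"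

context
  fixes h :: "(real \<Rightarrow> real) \<Rightarrow> real" and B :: real
  assumes bounded: "\<And>g. \<bar>h g\<bar> \<le> B"
begin

lemma lower_env_term_ge:
  assumes "f \<in> cadlag01" "g \<in> cadlag01"
  shows "- B \<le> h g + real k * sup_dist g f"
proof -
  have "0 \<le> real k * sup_dist g f" using sup_dist_nonneg assms by simp
  moreover have "- B \<le> h g" using bounded[of g] by linarith
  ultimately show ?thesis by linarith
qed

lemma lower_env_lower:
  assumes "f \<in> cadlag01" "g \<in> cadlag01"
  shows "lower_env h k f \<le> h g + real k * sup_dist g f"
  unfolding lower_env_def
  using lower_env_term_ge[OF assms(1)] assms(2) by (intro cINF_lower bdd_belowI2[where m = "- B"])

lemma lower_env_greatest:
  assumes "\<And>g. g \<in> cadlag01 \<Longrightarrow> c \<le> h g + real k * sup_dist g f"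
  shows "c \<le> lower_env h k f"
proof -
  have "cadlag01 \<noteq> {}" using step_fun_in_cadlag01 by (metis empty_iff)
  then show ?thesis unfolding lower_env_def by (rule cINF_greatest) (rule assms)
qed

lemma lower_env_le: "f \<in> cadlag01 \<Longrightarrow> lower_env h k f \<le> h f"
  using lower_env_lower[of f f k] by simp

lemma abs_lower_env_le:
  assumes "f \<in> cadlag01"
  shows "\<bar>lower_env h k f\<bar> \<le> B"
  using lower_env_greatest[of "- B" k f, OF lower_env_term_ge[OF assms]] lower_env_le[OF assms, of k]
    bounded[of f] by linarith

lemma lower_env_lipschitz:
  assumes "f \<in> cadlag01" "f' \<in> cadlag01"
  shows "\<bar>lower_env h k f - lower_env h k f'\<bar> \<le> real k * sup_dist f f'"
proof -
  have *: "lower_env h k f1 - real k * sup_dist f1 f2 \<le> lower_env h k f2"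
    if f: "f1 \<in> cadlag01" "f2 \<in> cadlag01" for f1 f2
  proof (rule lower_env_greatest)
    fix g assume g: "g \<in> cadlag01"
    have "sup_dist g f1 \<le> sup_dist g f2 + sup_dist f1 f2"
      using sup_dist_triangle[OF g f(2,1)] by (simp add: sup_dist_commute)
    then have "real k * sup_dist g f1 \<le> real k * (sup_dist g f2 + sup_dist f1 f2)"
      by (rule mult_left_mono) simp
    then show "lower_env h k f1 - real k * sup_dist f1 f2 \<le> h g + real k * sup_dist g f2"
      using lower_env_lower[OF f(1) g, of k] by (simp add: distrib_left)
  qed
  show ?thesis
    using *[OF assms] *[OF assms(2,1)] by (simp add: sup_dist_commute abs_le_iff)
qed

text \<open>Within distance \<open>d\<close> of \<open>f\<close>, continuity keeps
  \<open>h g\<close> near \<open>h f\<close>; farther away the penalty \<open>k * d\<close> reaches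
  \<open>2 * B\<close>, more than \<open>h\<close> can gain.\<close>

lemma lower_env_tendsto:
  assumes f: "f \<in> cadlag01" and cont: "sup_continuous_at h f"
  shows "(\<lambda>k. lower_env h k f) \<longlonglongrightarrow> h f"
proof (rule LIMSEQ_I)
  fix r :: real assume r: "r > 0"
  obtain d where d: "d > 0" "\<And>g. g \<in> cadlag01 \<Longrightarrow> sup_dist g f < d \<Longrightarrow> \<bar>h g - h f\<bar> < r / 2"
    using cont r unfolding sup_continuous_at_def by (meson half_gt_zero)
  obtain k0 :: nat where k0: "2 * B / d \<le> real k0" using real_arch_simple by blast
  have "norm (lower_env h k f - h f) < r" if k: "k \<ge> k0" for k
  proof -
    have "h f - r / 2 \<le> lower_env h k f"
    proof (rule lower_env_greatest)
      fix g assume g: "g \<in> cadlag01"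
      show "h f - r / 2 \<le> h g + real k * sup_dist g f"
      proof (cases "sup_dist g f < d")
        case True
        have "0 \<le> real k * sup_dist g f" using sup_dist_nonneg[OF g f] by simp
        then show ?thesis using d(2)[OF g True] by linarith
      next
        case False
        have "2 * B \<le> real k0 * d" using k0 d(1) by (simp add: field_simps)
        also have "\<dots> \<le> real k * sup_dist g f" using k d(1) False by (intro mult_mono) auto
        finally show ?thesis using bounded[of f] bounded[of g] r by linarith
      qed
    qed
    then show ?thesis using lower_env_le[OF f, of k] r by (simp add: abs_less_iff)
  qed
  then show "\<exists>no. \<forall>n\<ge>no. norm (lower_env h n f - h f) < r" by blast
qed

text \<open>As a function of the increments, the minorant on step functions is Lipschitz in finitely
  many coordinates, which is the form required by \<open>rademacher_fidi\<close>.\<close>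

lemma lower_env_step_fun_lipschitz:
  "\<bar>lower_env h k (step_fun m x) - lower_env h k (step_fun m y)\<bar> \<le> real k * (\<Sum>j<m. \<bar>x j - y j\<bar>)"
proof -
  have "sup_dist (step_fun m x) (step_fun m y) \<le> (\<Sum>j<m. \<bar>x j - y j\<bar>)"
  proof (rule sup_dist_le)
    fix t :: real assume t: "t \<in> {0..1}"
    let ?J = "{j. j \<in> {..<m} \<and> real (Suc j) / real m \<le> t}"
    have "step_fun m x t - step_fun m y t = (\<Sum>j\<in>?J. x j - y j)"
      using t by (simp add: step_fun_def sum_subtractf)
    also have "\<bar>\<dots>\<bar> \<le> (\<Sum>j\<in>?J. \<bar>x j - y j\<bar>)" by (rule sum_abs)
    also have "\<dots> \<le> (\<Sum>j<m. \<bar>x j - y j\<bar>)" by (rule sum_mono2) auto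
    finally show "\<bar>step_fun m x t - step_fun m y t\<bar> \<le> (\<Sum>j<m. \<bar>x j - y j\<bar>)" .
  qed
  then have "real k * sup_dist (step_fun m x) (step_fun m y) \<le> real k * (\<Sum>j<m. \<bar>x j - y j\<bar>)"
    by (rule mult_left_mono) simp
  with lower_env_lipschitz[OF step_fun_in_cadlag01[of m x] step_fun_in_cadlag01[of m y], of k]
  show ?thesis by linarith
qed

end

section \<open>Minorants along Wiener paths\<close>

context std_wiener_process
begin

abbreviation (input) path :: "'b \<Rightarrow> real \<Rightarrow> real" where
  "path \<omega> \<equiv> (\<lambda>t\<in>{0..1}. W t \<omega>)"

abbreviation (input) increments :: "nat \<Rightarrow> 'b \<Rightarrow> nat \<Rightarrow> real" where
  "increments m \<omega> \<equiv> (\<lambda>k. W (real (Suc k) / real m) \<omega> - W (real k / real m) \<omega>)"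

lemma path_in_cadlag01: "\<omega> \<in> space N \<Longrightarrow> path \<omega> \<in> cadlag01"
  by (rule continuous_on_in_cadlag01[OF continuous_paths])

text \<open>Increments telescope to the path value at the left end of the cell, since the path
  starts at 0; uniform continuity does the rest.\<close>

lemma step_fun_increments_tendsto:
  assumes \<omega>: "\<omega> \<in> space N"
  shows "(\<lambda>m. sup_dist (step_fun m (increments m \<omega>)) (path \<omega>)) \<longlonglongrightarrow> 0"
proof (rule LIMSEQ_I)
  fix r :: real assume r: "r > 0"
  have "uniformly_continuous_on {0..1} (\<lambda>t. W t \<omega>)"
    by (rule compact_uniformly_continuous[OF continuous_paths[OF \<omega>]]) simp
  then obtain d where d: "d > 0"
    "\<And>s t. s \<in> {0..1} \<Longrightarrow> t \<in> {0..1} \<Longrightarrow> dist s t < d \<Longrightarrow> dist (W s \<omega>) (W t \<omega>) < r / 2"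
    using r unfolding uniformly_continuous_on_def by (meson half_gt_zero)
  obtain M :: nat where M: "1 / d < real M" using reals_Archimedean2 by blast
  have "norm (sup_dist (step_fun m (increments m \<omega>)) (path \<omega>) - 0) < r" if "m \<ge> M" for m
  proof -
    have "0 < 1 / d" using d(1) by simp
    moreover have M': "1 / d < real m" using M that by linarith
    ultimately have m: "m > 0" by (cases m) auto
    have inv: "1 / real m < d" using M' d(1) m by (simp add: field_simps)
    have "sup_dist (step_fun m (increments m \<omega>)) (path \<omega>) \<le> r / 2"
    proof (rule sup_dist_le)
      fix t :: real assume t: "t \<in> {0..1}"
      obtain k where k: "real k / real m \<le> t" "t < real (Suc k) / real m"
        using grid_cell[of t m] t m by auto
      have "step_fun m (increments m \<omega>) t = (\<Sum>j<k. increments m \<omega> j)"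
        by (rule step_fun_eq[OF t k])
      also have "\<dots> = W (real k / real m) \<omega> - W (real 0 / real m) \<omega>"
        by (rule sum_lessThan_telescope[of "\<lambda>j. W (real j / real m) \<omega>"])
      finally have step: "step_fun m (increments m \<omega>) t = W (real k / real m) \<omega>"
        using W_0[OF \<omega>] by simp
      have "t < real k / real m + 1 / real m" using k(2) by (simp add: add_divide_distrib)
      then have "dist (real k / real m) t < d" using k(1) inv by (simp add: dist_real_def)
      moreover have "real k / real m \<in> {0..1}" using k(1) t by simp
      ultimately have "dist (W (real k / real m) \<omega>) (W t \<omega>) < r / 2" using d(2) t by blast
      then show "\<bar>step_fun m (increments m \<omega>) t - path \<omega> t\<bar> \<le> r / 2"
        using t unfolding step by (simp add: dist_real_def)
    qed
    then show ?thesis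
      using sup_dist_nonneg[OF step_fun_in_cadlag01[of m "increments m \<omega>"] path_in_cadlag01[OF \<omega>]] r by simp
  qed
  then show "\<exists>no. \<forall>m\<ge>no. norm (sup_dist (step_fun m (increments m \<omega>)) (path \<omega>) - 0) < r" by blast
qed

context
  fixes h :: "(real \<Rightarrow> real) \<Rightarrow> real" and B :: real
  assumes bounded: "\<And>g. \<bar>h g\<bar> \<le> B"
begin

lemma lower_env_step_tendsto:
  assumes \<omega>: "\<omega> \<in> space N"
  shows "(\<lambda>m. lower_env h k (step_fun m (increments m \<omega>))) \<longlonglongrightarrow> lower_env h k (path \<omega>)"
proof -
  have "(\<lambda>m. real k * sup_dist (step_fun m (increments m \<omega>)) (path \<omega>)) \<longlonglongrightarrow> real k * 0"
    by (intro tendsto_mult tendsto_const step_fun_increments_tendsto[OF \<omega>])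
  then have null: "(\<lambda>m. real k * sup_dist (step_fun m (increments m \<omega>)) (path \<omega>)) \<longlonglongrightarrow> 0" by simp
  have "(\<lambda>m. lower_env h k (step_fun m (increments m \<omega>)) - lower_env h k (path \<omega>)) \<longlonglongrightarrow> 0"
    by (rule Lim_null_comparison[OF _ null], intro always_eventually allI, unfold real_norm_def)
      (rule lower_env_lipschitz[OF bounded step_fun_in_cadlag01 path_in_cadlag01[OF \<omega>]])
  then show ?thesis by (simp add: LIM_zero_iff)
qed

lemma measurable_lower_env_step:
  "(\<lambda>\<omega>. lower_env h k (step_fun m (increments m \<omega>))) \<in> borel_measurable N"
proof (rule measurable_lipschitz_coordinates[where \<phi> = "\<lambda>x. lower_env h k (step_fun m x)" and K = "real k" and m = m])
  show "\<bar>lower_env h k (step_fun m x) - lower_env h k (step_fun m y)\<bar> \<le> real k * (\<Sum>j<m. \<bar>x j - y j\<bar>)" for x y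
    by (rule lower_env_step_fun_lipschitz[OF bounded])
  show "(\<lambda>\<omega>. increments m \<omega> j) \<in> borel_measurable N" if "j < m" for j
    using that by (intro borel_measurable_diff random_variable_W) (auto simp: field_simps)
qed

text \<open>An infimum over uncountably many functions gives no measurability by itself; it is
  obtained as a pointwise limit of functions of finitely many increments.\<close>

lemma measurable_lower_env_path: "(\<lambda>\<omega>. lower_env h k (path \<omega>)) \<in> borel_measurable N"
  by (rule borel_measurable_LIMSEQ_real[OF lower_env_step_tendsto measurable_lower_env_step])

lemma expectation_lower_env_step_tendsto:
  "(\<lambda>m. expectation (\<lambda>\<omega>. lower_env h k (step_fun m (increments m \<omega>))))
    \<longlonglongrightarrow> expectation (\<lambda>\<omega>. lower_env h k (path \<omega>))"
proof (rule integral_dominated_convergence[where w = "\<lambda>_. B"])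
  show "AE \<omega> in N. (\<lambda>m. lower_env h k (step_fun m (increments m \<omega>))) \<longlonglongrightarrow> lower_env h k (path \<omega>)"
    by (rule AE_I2) (rule lower_env_step_tendsto)
  show "AE \<omega> in N. norm (lower_env h k (step_fun m (increments m \<omega>))) \<le> B" for m
    by (rule AE_I2, unfold real_norm_def) (rule abs_lower_env_le[OF bounded step_fun_in_cadlag01])
  show "(\<lambda>\<omega>. lower_env h k (step_fun m (increments m \<omega>))) \<in> borel_measurable N" for m
    by (rule measurable_lower_env_step)
qed (rule measurable_lower_env_path, rule integrable_const)

lemma expectation_lower_env_tendsto:
  assumes h: "h \<in> borel_measurable cadlag_sigma" and cont: "AE \<omega> in N. sup_continuous_at h (path \<omega>)"
  shows "(\<lambda>k. expectation (\<lambda>\<omega>. lower_env h k (path \<omega>))) \<longlonglongrightarrow> expectation (\<lambda>\<omega>. h (path \<omega>))"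
proof (rule integral_dominated_convergence[where w = "\<lambda>_. B"])
  show "AE \<omega> in N. (\<lambda>k. lower_env h k (path \<omega>)) \<longlonglongrightarrow> h (path \<omega>)"
    using cont AE_space
  proof eventually_elim
    case (elim \<omega>)
    then show ?case by (intro lower_env_tendsto[OF bounded] path_in_cadlag01)
  qed
  show "AE \<omega> in N. norm (lower_env h k (path \<omega>)) \<le> B" for k
    by (rule AE_I2, unfold real_norm_def) (rule abs_lower_env_le[OF bounded path_in_cadlag01])
  show "(\<lambda>\<omega>. h (path \<omega>)) \<in> borel_measurable N"
    by (rule measurable_compose[OF measurable_path h])
qed (rule measurable_lower_env_path, rule integrable_const)

end

end

text \<open>The complement is where the two path conditions of
  \<open>student_process_close_to_step_fun\<close> hold for the signed array. The blocks are
  computed from \<open>a\<close>, since signs do not affect squares.\<close>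

definition irregular_signs :: "nat \<Rightarrow> (nat \<Rightarrow> real) \<Rightarrow> nat \<Rightarrow> real \<Rightarrow> real \<Rightarrow> (nat \<Rightarrow> real) set" where
  "irregular_signs n a m L \<eta> =
     {e. \<exists>j\<in>{0..n}. L \<le> \<bar>\<Sum>i\<in>{0<..j}. e i * a i\<bar>} \<union>
     (\<Union>k<m. {e. \<exists>j\<in>{time_index n a m k..time_index n a m (Suc k)}.
        \<eta> \<le> \<bar>\<Sum>i\<in>{time_index n a m k<..j}. e i * a i\<bar>})"

text \<open>A block of variance \<open>v k\<close> contributes
  \<open>3 * (v k)\<^sup>2 / \<eta> ^ 4\<close>. As the variances add up to 1 and each is at most
  \<open>1 / real m + \<delta>\<^sup>2\<close>, so is the sum of their squares; first powers would
  leave a bound that does not shrink with \<open>m\<close>.\<close>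

lemma prob_irregular_signs:
  fixes a :: "nat \<Rightarrow> real"
  assumes one: "(\<Sum>i=1..n. (a i)\<^sup>2) = 1" and d: "\<And>i. i \<in> {1..n} \<Longrightarrow> \<bar>a i\<bar> \<le> \<delta>"
    and m: "m > 0" and L: "L > 0" and \<eta>: "\<eta> > 0"
  shows "measure_pmf.prob (rademacher n) (irregular_signs n a m L \<eta>)
    \<le> 3 / L ^ 4 + 3 * (1 / real m + \<delta>\<^sup>2) / \<eta> ^ 4"
proof -
  let ?\<tau> = "time_index n a m"
  let ?G = "{e. \<exists>j\<in>{0..n}. L \<le> \<bar>\<Sum>i\<in>{0<..j}. e i * a i\<bar>}"
  let ?H = "\<lambda>k. {e. \<exists>j\<in>{?\<tau> k..?\<tau> (Suc k)}. \<eta> \<le> \<bar>\<Sum>i\<in>{?\<tau> k<..j}. e i * a i\<bar>}"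
  define v where "v k = block_sum n a m (\<lambda>i. (a i)\<^sup>2) k" for k
  have "{0<..n} = {1..n}" by auto
  then have "measure_pmf.prob (rademacher n) ?G * L ^ 4 \<le> 3"
    using rademacher_maximal[of 0 n n L 0 a] L one by simp
  then have G: "measure_pmf.prob (rademacher n) ?G \<le> 3 / L ^ 4" using L by (simp add: field_simps)
  have "measure_pmf.prob (rademacher n) (?H k) * \<eta> ^ 4 \<le> 3 * (v k)\<^sup>2" for k
    using rademacher_maximal[OF time_index_mono[of k "Suc k" n a m] time_index_le \<eta>, of 0 a]
    by (simp add: v_def)
  then have H: "measure_pmf.prob (rademacher n) (?H k) \<le> 3 * (v k)\<^sup>2 / \<eta> ^ 4" for k
    using \<eta> by (simp add: field_simps)
  have v0: "v k \<ge> 0" for k by (simp add: v_def sum_nonneg)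
  have "(\<Sum>k<m. v k) = 1"
    unfolding v_def sum_block_sum time_index_end[OF one m] by (rule one)
  moreover have "(v k)\<^sup>2 \<le> (1 / real m + \<delta>\<^sup>2) * v k" if "k < m" for k
  proof -
    have "v k \<le> 1 / real m + \<delta>\<^sup>2"
      using block_sum_sumsq_bounds[OF one d that] unfolding v_def by linarith
    then show ?thesis using mult_right_mono[OF _ v0[of k]] by (simp add: power2_eq_square)
  qed
  then have "(\<Sum>k<m. (v k)\<^sup>2) \<le> (\<Sum>k<m. (1 / real m + \<delta>\<^sup>2) * v k)" by (intro sum_mono) simp
  ultimately have sq: "(\<Sum>k<m. (v k)\<^sup>2) \<le> 1 / real m + \<delta>\<^sup>2"
    by (simp add: sum_distrib_left[symmetric])
  have "measure_pmf.prob (rademacher n) (\<Union>k<m. ?H k) \<le> (\<Sum>k<m. measure_pmf.prob (rademacher n) (?H k))"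
    by (rule measure_pmf.finite_measure_subadditive_finite) auto
  also have "\<dots> \<le> (\<Sum>k<m. 3 * (v k)\<^sup>2 / \<eta> ^ 4)" by (intro sum_mono H)
  also have "\<dots> = 3 * (\<Sum>k<m. (v k)\<^sup>2) / \<eta> ^ 4" by (simp add: sum_divide_distrib sum_distrib_left)
  also have "\<dots> \<le> 3 * (1 / real m + \<delta>\<^sup>2) / \<eta> ^ 4" using sq \<eta> by (intro divide_right_mono mult_left_mono) auto
  finally have "measure_pmf.prob (rademacher n) (\<Union>k<m. ?H k) \<le> 3 * (1 / real m + \<delta>\<^sup>2) / \<eta> ^ 4" .
  moreover have "measure_pmf.prob (rademacher n) (?G \<union> (\<Union>k<m. ?H k)) \<le>
      measure_pmf.prob (rademacher n) ?G + measure_pmf.prob (rademacher n) (\<Union>k<m. ?H k)"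
    by (rule measure_Un_le) simp_all
  ultimately show ?thesis using G unfolding irregular_signs_def by linarith
qed

lemma rademacher_sign_sq:
  assumes "e \<in> set_pmf (rademacher n)" "i \<in> {1..n}"
  shows "(e i)\<^sup>2 = 1" "\<bar>e i\<bar> = 1"
proof -
  have "e i \<in> {-1, 1}" using assms unfolding set_rademacher PiE_dflt_def by blast
  then show "(e i)\<^sup>2 = 1" "\<bar>e i\<bar> = 1" by auto
qed

lemma time_index_cong:
  assumes "\<And>i. i \<in> {1..n} \<Longrightarrow> (b i)\<^sup>2 = (a i)\<^sup>2"
  shows "time_index n b m k = time_index n a m k"
proof -
  have "(\<Sum>i=1..j. (b i)\<^sup>2) = (\<Sum>i=1..j. (a i)\<^sup>2)" if "j \<in> {0..n}" for j
    by (rule sum.cong) (use assms that in auto)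
  then have "{j \<in> {0..n}. (\<Sum>i=1..j. (b i)\<^sup>2) \<le> real k / real m} = {j \<in> {0..n}. (\<Sum>i=1..j. (a i)\<^sup>2) \<le> real k / real m}"
    by (intro Collect_cong conj_cong refl) (simp only:)
  then show ?thesis unfolding time_index_def by (simp only:)
qed

lemma student_process_close_to_step_fun_signs:
  fixes a :: "nat \<Rightarrow> real"
  assumes one: "(\<Sum>i=1..n. (a i)\<^sup>2) = 1" and d: "\<And>i. i \<in> {1..n} \<Longrightarrow> \<bar>a i\<bar> \<le> \<delta>"
    and L: "L \<ge> 1" and m: "m > 0" and fine: "7 * L\<^sup>2 * \<delta>\<^sup>2 < 1 / real m"
    and scale: "2 * L ^ 3 * \<delta>\<^sup>2 \<le> \<eta>"
    and e: "e \<in> set_pmf (rademacher n)" "e \<notin> irregular_signs n a m L \<eta>"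
  shows "sup_dist (student_process n 0 (\<lambda>i. e i * a i)) (step_fun m (block_sum n a m (\<lambda>i. e i * a i))) \<le> 3 * \<eta>"
proof -
  let ?b = "\<lambda>i. e i * a i"
  have sq: "(?b i)\<^sup>2 = (a i)\<^sup>2" if "i \<in> {1..n}" for i
    using rademacher_sign_sq(1)[OF e(1) that] by (simp add: power_mult_distrib)
  have \<tau>: "time_index n ?b m = time_index n a m" by (rule ext) (rule time_index_cong[OF sq])
  have set: "{1..j} = {0<..j}" for j :: nat by auto
  show ?thesis unfolding \<tau>[symmetric]
  proof (rule student_process_close_to_step_fun[OF _ _ L m fine scale])
    show "(\<Sum>i=1..n. (?b i)\<^sup>2) = 1" using one by (subst sum.cong[OF refl sq])
    show "\<bar>?b i\<bar> \<le> \<delta>" if "i \<in> {1..n}" for i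
      using d[OF that] rademacher_sign_sq(2)[OF e(1) that] by (simp add: abs_mult)
    show "\<bar>\<Sum>i=1..j. ?b i\<bar> \<le> L" if "j \<le> n" for j
    proof (rule ccontr)
      assume "\<not> ?thesis"
      then have "e \<in> irregular_signs n a m L \<eta>"
        unfolding irregular_signs_def set using that by (intro UnI1 CollectI bexI[of _ j]) simp_all
      with e(2) show False ..
    qed
    show "\<bar>\<Sum>i\<in>{time_index n ?b m k<..j}. ?b i\<bar> \<le> \<eta>"
      if "k < m" "j \<in> {time_index n ?b m k..time_index n ?b m (Suc k)}" for k j
    proof (rule ccontr)
      assume "\<not> ?thesis"
      then have "e \<in> irregular_signs n a m L \<eta>"
        unfolding irregular_signs_def \<tau> using that[unfolded \<tau>]
        by (intro UnI2 UN_I[of k] CollectI bexI[of _ j]) simp_all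
      with e(2) show False ..
    qed
  qed
qed

section \<open>Randomly signed arrays and symmetrization\<close>

lemma (in std_wiener_process) rademacher_lower_bound:
  fixes h :: "(real \<Rightarrow> real) \<Rightarrow> real"
  assumes h: "h \<in> borel_measurable cadlag_sigma" and bounded: "\<And>g. \<bar>h g\<bar> \<le> B"
    and cont: "AE \<omega> in N. sup_continuous_at h (path \<omega>)" and \<epsilon>: "\<epsilon> > 0"
  obtains \<delta> where "\<delta> > 0"
    "\<And>n a. (\<Sum>i=1..n. (a i)\<^sup>2) = 1 \<Longrightarrow> (\<And>i. i \<in> {1..n} \<Longrightarrow> \<bar>a i\<bar> \<le> \<delta>) \<Longrightarrow>
      expectation (\<lambda>\<omega>. h (path \<omega>)) - \<epsilon>
      \<le> measure_pmf.expectation (rademacher n) (\<lambda>e. h (student_process n 0 (\<lambda>i. e i * a i)))"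
proof -
  have B: "B \<ge> 0" using bounded[of "\<lambda>_. 0"] by linarith
  let ?E = "\<lambda>k. expectation (\<lambda>\<omega>. lower_env h k (path \<omega>))"
  have "\<forall>\<^sub>F k in sequentially. expectation (\<lambda>\<omega>. h (path \<omega>)) - \<epsilon> / 6 < ?E k"
    by (rule order_tendstoD(1)[OF expectation_lower_env_tendsto[OF bounded h cont]]) (use \<epsilon> in simp)
  from eventually_happens'[OF sequentially_bot this] obtain k
    where k: "expectation (\<lambda>\<omega>. h (path \<omega>)) - \<epsilon> / 6 < ?E k" ..
  \<comment> \<open>Chosen so that the Lipschitz constant \<open>k\<close> times the distance
    \<open>3 * \<eta>\<close> stays within \<open>\<epsilon> / 6\<close>; adding 1 to
    \<open>k\<close> avoids division by zero.\<close>
  define \<eta> where "\<eta> = \<epsilon> / (18 * (real k + 1))"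
  have \<eta>: "\<eta> > 0" using \<epsilon> by (simp add: \<eta>_def)
  have k\<eta>: "3 * real k * \<eta> \<le> \<epsilon> / 6"
  proof -
    have "3 * (real k + 1) * \<eta> = \<epsilon> / 6" by (simp add: \<eta>_def field_simps)
    moreover have "3 * real k * \<eta> \<le> 3 * (real k + 1) * \<eta>" using \<eta> by (intro mult_right_mono) auto
    ultimately show ?thesis by linarith
  qed
  \<comment> \<open>Irregular signs cost \<open>2 * B\<close> times their probability; the part with
    \<open>3 / L ^ 4\<close> shall stay below \<open>\<epsilon> / 12\<close>, and
    \<open>L \<le> L ^ 4\<close> lets a linear choice suffice.\<close>
  define L where "L = 1 + 72 * B / \<epsilon>"
  have L: "L \<ge> 1" using B \<epsilon> by (simp add: L_def)
  have LB: "2 * B * (3 / L ^ 4) \<le> \<epsilon> / 12"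
  proof -
    have "72 * B / \<epsilon> \<le> L" by (simp add: L_def)
    then have "72 * B \<le> \<epsilon> * L" using \<epsilon> by (simp add: field_simps)
    also have "\<dots> \<le> \<epsilon> * L ^ 4" using L \<epsilon> self_le_power[of L 4] by (intro mult_left_mono) auto
    finally show ?thesis using L by (simp add: field_simps)
  qed
  \<comment> \<open>The other half of that allowance, with \<open>\<delta>\<^sup>2\<close> replaced
    by its later bound \<open>1 / real m\<close>: the product of 2, 3, 2 and 12 is 144.\<close>
  obtain m0 :: nat where m0: "144 * B / (\<epsilon> * \<eta> ^ 4) \<le> real m0" using real_arch_simple by blast
  have "\<forall>\<^sub>F m in sequentially. ?E k - \<epsilon> / 6 < expectation (\<lambda>\<omega>. lower_env h k (step_fun m (increments m \<omega>)))"
    by (rule order_tendstoD(1)[OF expectation_lower_env_step_tendsto[OF bounded]]) (use \<epsilon> in simp)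
  then have "\<forall>\<^sub>F m in sequentially. Suc m0 \<le> m \<and>
      ?E k - \<epsilon> / 6 < expectation (\<lambda>\<omega>. lower_env h k (step_fun m (increments m \<omega>)))"
    using eventually_ge_at_top[of "Suc m0"] by eventually_elim simp
  from eventually_happens'[OF sequentially_bot this] obtain m
    where m: "Suc m0 \<le> m" "?E k - \<epsilon> / 6 < expectation (\<lambda>\<omega>. lower_env h k (step_fun m (increments m \<omega>)))"
    by blast
  have mpos: "m > 0" using m(1) by simp
  have mB: "2 * B * (3 * (1 / real m + 1 / real m) / \<eta> ^ 4) \<le> \<epsilon> / 12"
  proof -
    have "144 * B / (\<epsilon> * \<eta> ^ 4) \<le> real m" using m0 m(1) by simp
    then have "144 * B \<le> \<epsilon> * \<eta> ^ 4 * real m" using \<epsilon> \<eta> by (simp add: field_simps)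
    then show ?thesis using mpos \<eta> by (simp add: field_simps)
  qed
  have lip: "\<bar>lower_env h k (step_fun m x) - lower_env h k (step_fun m y)\<bar> \<le> real k * (\<Sum>j<m. \<bar>x j - y j\<bar>)" for x y
    by (rule lower_env_step_fun_lipschitz[OF bounded])
  have bnd: "\<bar>lower_env h k (step_fun m x)\<bar> \<le> B" for x
    by (rule abs_lower_env_le[OF bounded step_fun_in_cadlag01])
  have "\<epsilon> / 6 > 0" using \<epsilon> by simp
  from rademacher_fidi[where \<phi> = "\<lambda>x. lower_env h k (step_fun m x)", OF mpos lip bnd this]
  obtain \<delta>1 where \<delta>1: "\<delta>1 > 0" and fidi: "\<And>n a. (\<Sum>i=1..n. (a i)\<^sup>2) = 1 \<Longrightarrow> (\<And>i. i \<in> {1..n} \<Longrightarrow> \<bar>a i\<bar> \<le> \<delta>1) \<Longrightarrow>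
      \<bar>measure_pmf.expectation (rademacher n) (\<lambda>e. lower_env h k (step_fun m (block_sum n a m (\<lambda>i. e i * a i)))) -
       expectation (\<lambda>\<omega>. lower_env h k (step_fun m (increments m \<omega>)))\<bar> < \<epsilon> / 6"
    by blast
  \<comment> \<open>A bound for the square of \<open>\<delta>\<close>: the first term serves
    \<open>fine\<close>, where 8 in place of 7 gives strictness, the second serves
    \<open>scale\<close>.\<close>
  define \<delta>2 where "\<delta>2 = min (1 / (8 * L\<^sup>2 * real m)) (\<eta> / (2 * L ^ 3))"
  have \<delta>2: "\<delta>2 > 0" using L mpos \<eta> by (simp add: \<delta>2_def)
  define \<delta> where "\<delta> = min \<delta>1 (sqrt \<delta>2)"
  have \<delta>: "\<delta> > 0" "\<delta> \<le> \<delta>1" using \<delta>1 \<delta>2 by (auto simp: \<delta>_def)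
  have "\<delta>\<^sup>2 \<le> (sqrt \<delta>2)\<^sup>2" using \<delta>(1) by (intro power_mono) (auto simp: \<delta>_def)
  then have d2: "\<delta>\<^sup>2 \<le> \<delta>2" using \<delta>2 by simp
  have fine: "7 * L\<^sup>2 * \<delta>\<^sup>2 < 1 / real m"
  proof -
    have "7 * L\<^sup>2 * \<delta>\<^sup>2 \<le> 7 * L\<^sup>2 * (1 / (8 * L\<^sup>2 * real m))"
      using d2 by (intro mult_left_mono) (auto simp: \<delta>2_def)
    also have "\<dots> < 1 / real m" using L mpos by (simp add: field_simps)
    finally show ?thesis .
  qed
  have scale: "2 * L ^ 3 * \<delta>\<^sup>2 \<le> \<eta>"
  proof -
    have "2 * L ^ 3 * \<delta>\<^sup>2 \<le> 2 * L ^ 3 * (\<eta> / (2 * L ^ 3))"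
      using d2 L by (intro mult_left_mono) (auto simp: \<delta>2_def)
    also have "\<dots> = \<eta>" using L by simp
    finally show ?thesis .
  qed
  have \<delta>m: "\<delta>\<^sup>2 \<le> 1 / real m"
  proof -
    have "1 * \<delta>\<^sup>2 \<le> 7 * L\<^sup>2 * \<delta>\<^sup>2" using L by (intro mult_right_mono) (auto intro: order_trans[OF _ mult_mono[of 1 7 1 "L\<^sup>2"]])
    then show ?thesis using fine by simp
  qed
  show thesis
  proof (rule that[OF \<delta>(1)])
    fix n and a :: "nat \<Rightarrow> real"
    assume one: "(\<Sum>i=1..n. (a i)\<^sup>2) = 1" and d: "\<And>i. i \<in> {1..n} \<Longrightarrow> \<bar>a i\<bar> \<le> \<delta>"
    let ?R = "rademacher n"
    let ?Y = "\<lambda>e. student_process n 0 (\<lambda>i. e i * a i)"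
    let ?S = "\<lambda>e. step_fun m (block_sum n a m (\<lambda>i. e i * a i))"
    let ?I = "irregular_signs n a m L \<eta>"
    have pointwise: "lower_env h k (?S e) - 3 * real k * \<eta> - 2 * B * indicator ?I e \<le> h (?Y e)"
      if e: "e \<in> set_pmf ?R" for e
    proof (cases "e \<in> ?I")
      case True
      have "0 \<le> 3 * real k * \<eta>" using \<eta> by simp
      moreover have "indicator ?I e = (1 :: real)" using True by simp
      ultimately show ?thesis
        using bnd[of "block_sum n a m (\<lambda>i. e i * a i)"] bounded[of "?Y e"] by (simp only: mult_1_right)
    next
      case False
      have "sup_dist (?Y e) (?S e) \<le> 3 * \<eta>"
        by (rule student_process_close_to_step_fun_signs[OF one d L mpos fine scale e False])
      then have "real k * sup_dist (?Y e) (?S e) \<le> real k * (3 * \<eta>)" by (rule mult_left_mono) simp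
      moreover have "\<bar>lower_env h k (?Y e) - lower_env h k (?S e)\<bar> \<le> real k * sup_dist (?Y e) (?S e)"
        by (rule lower_env_lipschitz[OF bounded student_process_in_cadlag01 step_fun_in_cadlag01])
      moreover have "lower_env h k (?Y e) \<le> h (?Y e)"
        by (rule lower_env_le[OF bounded student_process_in_cadlag01])
      moreover have "indicator ?I e = (0 :: real)" using False by simp
      ultimately show ?thesis by (simp add: abs_le_iff algebra_simps)
    qed
    have "measure_pmf.expectation ?R (\<lambda>e. lower_env h k (?S e) - 3 * real k * \<eta> - 2 * B * indicator ?I e)
        \<le> measure_pmf.expectation ?R (\<lambda>e. h (?Y e))"
      by (rule integral_mono_AE) (simp_all add: AE_measure_pmf_iff pointwise)
    moreover have "measure_pmf.expectation ?R (\<lambda>e. lower_env h k (?S e) - 3 * real k * \<eta> - 2 * B * indicator ?I e) =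
        measure_pmf.expectation ?R (\<lambda>e. lower_env h k (?S e)) - 3 * real k * \<eta> - 2 * B * measure_pmf.prob ?R ?I"
      by simp
    moreover have "\<bar>measure_pmf.expectation ?R (\<lambda>e. lower_env h k (?S e)) -
       expectation (\<lambda>\<omega>. lower_env h k (step_fun m (increments m \<omega>)))\<bar> < \<epsilon> / 6"
      by (rule fidi[OF one]) (rule order_trans[OF d \<delta>(2)])
    moreover have "2 * B * measure_pmf.prob ?R ?I \<le> \<epsilon> / 6"
    proof -
      have "0 < L" using L by simp
      from prob_irregular_signs[OF one d mpos this \<eta>]
      have "measure_pmf.prob ?R ?I \<le> 3 / L ^ 4 + 3 * (1 / real m + \<delta>\<^sup>2) / \<eta> ^ 4" .
      also have "\<dots> \<le> 3 / L ^ 4 + 3 * (1 / real m + 1 / real m) / \<eta> ^ 4"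
        using \<delta>m \<eta> by (intro add_mono divide_right_mono mult_left_mono) simp_all
      finally have "2 * B * measure_pmf.prob ?R ?I \<le> 2 * B * (3 / L ^ 4 + 3 * (1 / real m + 1 / real m) / \<eta> ^ 4)"
        using B by (intro mult_left_mono) simp_all
      then show ?thesis using LB mB by (simp only: distrib_left)
    qed
    ultimately show "expectation (\<lambda>\<omega>. h (path \<omega>)) - \<epsilon> \<le> measure_pmf.expectation ?R (\<lambda>e. h (?Y e))"
      using k m(2) k\<eta> \<epsilon> by linarith
  qed
qed

text \<open>The lower bound applied to \<open>h\<close> and to \<open>- h\<close>, which has the
  same continuity points.\<close>

lemma (in std_wiener_process) rademacher_functional_limit:
  fixes h :: "(real \<Rightarrow> real) \<Rightarrow> real"
  assumes h: "h \<in> borel_measurable cadlag_sigma" and bounded: "\<And>g. \<bar>h g\<bar> \<le> B"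
    and cont: "AE \<omega> in N. sup_continuous_at h (path \<omega>)" and \<epsilon>: "\<epsilon> > 0"
  obtains \<delta> where "\<delta> > 0"
    "\<And>n a. (\<Sum>i=1..n. (a i)\<^sup>2) = 1 \<Longrightarrow> (\<And>i. i \<in> {1..n} \<Longrightarrow> \<bar>a i\<bar> \<le> \<delta>) \<Longrightarrow>
      \<bar>measure_pmf.expectation (rademacher n) (\<lambda>e. h (student_process n 0 (\<lambda>i. e i * a i))) -
       expectation (\<lambda>\<omega>. h (path \<omega>))\<bar> \<le> \<epsilon>"
proof -
  obtain \<delta> where \<delta>: "\<delta> > 0"
    "\<And>n a. (\<Sum>i=1..n. (a i)\<^sup>2) = 1 \<Longrightarrow> (\<And>i. i \<in> {1..n} \<Longrightarrow> \<bar>a i\<bar> \<le> \<delta>) \<Longrightarrow>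
      expectation (\<lambda>\<omega>. h (path \<omega>)) - \<epsilon>
      \<le> measure_pmf.expectation (rademacher n) (\<lambda>e. h (student_process n 0 (\<lambda>i. e i * a i)))"
    using rademacher_lower_bound[OF h bounded cont \<epsilon>] by blast
  have h': "(\<lambda>f. - h f) \<in> borel_measurable cadlag_sigma" using h by simp
  have bounded': "\<bar>- h g\<bar> \<le> B" for g using bounded[of g] by simp
  have cont': "AE \<omega> in N. sup_continuous_at (\<lambda>f. - h f) (path \<omega>)"
    using cont by eventually_elim (simp add: sup_continuous_at_def abs_minus_commute)
  obtain \<delta>' where \<delta>': "\<delta>' > 0"
    "\<And>n a. (\<Sum>i=1..n. (a i)\<^sup>2) = 1 \<Longrightarrow> (\<And>i. i \<in> {1..n} \<Longrightarrow> \<bar>a i\<bar> \<le> \<delta>') \<Longrightarrow>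
      expectation (\<lambda>\<omega>. - h (path \<omega>)) - \<epsilon>
      \<le> measure_pmf.expectation (rademacher n) (\<lambda>e. - h (student_process n 0 (\<lambda>i. e i * a i)))"
    using rademacher_lower_bound[OF h' bounded' cont' \<epsilon>] by blast
  show thesis
  proof (rule that)
    show "min \<delta> \<delta>' > 0" using \<delta>(1) \<delta>'(1) by simp
    fix n and a :: "nat \<Rightarrow> real"
    assume one: "(\<Sum>i=1..n. (a i)\<^sup>2) = 1" and d: "\<And>i. i \<in> {1..n} \<Longrightarrow> \<bar>a i\<bar> \<le> min \<delta> \<delta>'"
    have "\<bar>a i\<bar> \<le> \<delta>" "\<bar>a i\<bar> \<le> \<delta>'" if "i \<in> {1..n}" for i using d[OF that] by simp_all
    from \<delta>(2)[OF one this(1)] \<delta>'(2)[OF one this(2)]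
    show "\<bar>measure_pmf.expectation (rademacher n) (\<lambda>e. h (student_process n 0 (\<lambda>i. e i * a i))) -
       expectation (\<lambda>\<omega>. h (path \<omega>))\<bar> \<le> \<epsilon>"
      by (simp add: abs_le_iff)
  qed
qed

text \<open>For each fixed sign pattern, independence and symmetry give the signed vector the same
  product law as the original one. The average runs over finitely many patterns, so the expectations
  are exchanged as a finite sum. \<open>F_restrict\<close> reconciles functions on all indices with
  the product space over \<open>{1..n}\<close>.\<close>

lemma expectation_rademacher_symmetrization:
  fixes X :: "nat \<Rightarrow> 'a \<Rightarrow> real" and F :: "(nat \<Rightarrow> real) \<Rightarrow> real"
  assumes M: "prob_space M" and ind: "prob_space.indep_vars M (\<lambda>_. borel) X {1..n}"
    and sym: "\<And>i. i \<in> {1..n} \<Longrightarrow> distr M borel (X i) = distr M borel (\<lambda>\<omega>. - X i \<omega>)"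
    and n: "n > 0" and F: "F \<in> borel_measurable (PiM {1..n} (\<lambda>_. borel))" and bounded: "\<And>x. \<bar>F x\<bar> \<le> B"
    and F_restrict: "\<And>x. F (restrict x {1..n}) = F x"
  shows "(\<integral>\<omega>. F (\<lambda>i. X i \<omega>) \<partial>M) =
    (\<integral>\<omega>. measure_pmf.expectation (rademacher n) (\<lambda>e. F (\<lambda>i. e i * X i \<omega>)) \<partial>M)"
proof -
  interpret prob_space M by fact
  have ne: "{1..n} \<noteq> {}" using n by simp
  have rv: "X i \<in> borel_measurable M" if "i \<in> {1..n}" for i
    using ind that unfolding indep_vars_def by auto
  have rvs: "(\<lambda>\<omega>. \<lambda>i\<in>{1..n}. e i * X i \<omega>) \<in> measurable M (PiM {1..n} (\<lambda>_. borel))" for e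
    by (intro measurable_restrict borel_measurable_times borel_measurable_const rv)
  have F_int: "(\<integral>x. F x \<partial>distr M (PiM {1..n} (\<lambda>_. borel)) (\<lambda>\<omega>. \<lambda>i\<in>{1..n}. e i * X i \<omega>)) = (\<integral>\<omega>. F (\<lambda>i. e i * X i \<omega>) \<partial>M)" for e
    by (subst integral_distr[OF rvs F]) (simp only: F_restrict)
  have meas: "(\<lambda>\<omega>. F (\<lambda>i. e i * X i \<omega>)) \<in> borel_measurable M" for e
    using measurable_compose[OF rvs F] by (simp only: F_restrict)
  have law: "distr M (PiM {1..n} (\<lambda>_. borel)) (\<lambda>\<omega>. \<lambda>i\<in>{1..n}. e i * X i \<omega>) = PiM {1..n} (\<lambda>i. distr M borel (X i))"
    if e: "\<And>i. i \<in> {1..n} \<Longrightarrow> e i \<in> {-1, 1}" for e :: "nat \<Rightarrow> real"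
  proof -
    have "indep_vars (\<lambda>_. borel) (\<lambda>i \<omega>. e i * X i \<omega>) {1..n}"
      by (rule indep_vars_compose2[OF ind]) simp
    from distr_indep_vars_PiM[OF M ne this]
    have "distr M (PiM {1..n} (\<lambda>_. borel)) (\<lambda>\<omega>. \<lambda>i\<in>{1..n}. e i * X i \<omega>) = PiM {1..n} (\<lambda>i. distr M borel (\<lambda>\<omega>. e i * X i \<omega>))" .
    also have "\<dots> = PiM {1..n} (\<lambda>i. distr M borel (X i))"
    proof (rule PiM_cong[OF refl])
      fix i assume i: "i \<in> {1..n}"
      show "distr M borel (\<lambda>\<omega>. e i * X i \<omega>) = distr M borel (X i)"
        using e[OF i] sym[OF i] by auto
    qed
    finally show ?thesis .
  qed
  have flip: "(\<integral>\<omega>. F (\<lambda>i. e i * X i \<omega>) \<partial>M) = (\<integral>\<omega>. F (\<lambda>i. X i \<omega>) \<partial>M)" if e: "e \<in> set_pmf (rademacher n)" for e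
  proof -
    have "e i \<in> {-1, 1}" if "i \<in> {1..n}" for i
      using e that unfolding set_rademacher PiE_dflt_def by blast
    from law[OF this] law[of "\<lambda>_. 1"] have
      "distr M (PiM {1..n} (\<lambda>_. borel)) (\<lambda>\<omega>. \<lambda>i\<in>{1..n}. e i * X i \<omega>) =
       distr M (PiM {1..n} (\<lambda>_. borel)) (\<lambda>\<omega>. \<lambda>i\<in>{1..n}. 1 * X i \<omega>)" by simp
    then have "(\<integral>\<omega>. F (\<lambda>i. e i * X i \<omega>) \<partial>M) = (\<integral>\<omega>. F (\<lambda>i. 1 * X i \<omega>) \<partial>M)"
      using F_int[of e] F_int[of "\<lambda>_. 1"] by simp
    then show ?thesis by simp
  qed
  let ?R = "rademacher n"
  have sum: "measure_pmf.expectation ?R g = (\<Sum>e\<in>set_pmf ?R. pmf ?R e * g e)" for g :: "_ \<Rightarrow> real"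
    by (subst integral_measure_pmf[OF finite_set_rademacher]) simp_all
  have "(\<integral>\<omega>. measure_pmf.expectation ?R (\<lambda>e. F (\<lambda>i. e i * X i \<omega>)) \<partial>M) =
      (\<Sum>e\<in>set_pmf ?R. pmf ?R e * (\<integral>\<omega>. F (\<lambda>i. e i * X i \<omega>) \<partial>M))"
    unfolding sum
  proof (subst Bochner_Integration.integral_sum)
    show "integrable M (\<lambda>\<omega>. pmf ?R e * F (\<lambda>i. e i * X i \<omega>))" for e
      by (intro integrable_mult_right integrable_const_bound[where B = B] meas AE_I2) (simp add: bounded)
  qed simp
  also have "\<dots> = (\<Sum>e\<in>set_pmf ?R. pmf ?R e * (\<integral>\<omega>. F (\<lambda>i. X i \<omega>) \<partial>M))"
    by (intro sum.cong refl) (simp add: flip)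
  also have "\<dots> = measure_pmf.expectation ?R (\<lambda>_. \<integral>\<omega>. F (\<lambda>i. X i \<omega>) \<partial>M)"
    by (rule sum[symmetric])
  finally show ?thesis by simp
qed

section \<open>Convergence of the Student process\<close>

text \<open>Passage from centered to uncentered sizes. The centered sum of squares is the uncentered
  one minus \<open>real n * m\<^sup>2\<close>, so the mean deviation \<open>m\<close> is at most
  \<open>V / sqrt n\<close>; the condition on \<open>n\<close> makes this at most half of
  \<open>\<delta> * V\<close>, and the deviation from the sample mean is the other half.\<close>

lemma observation_small_relative_to_norm:
  fixes z :: "nat \<Rightarrow> real" and \<mu> \<delta> :: real and n :: nat
  defines "V \<equiv> sqrt (\<Sum>i=1..n. (z i - \<mu>)\<^sup>2)"
  assumes n: "4 / \<delta>\<^sup>2 \<le> real n" and \<delta>: "\<delta> > 0" and nondeg: "centered_sumsq n z n \<noteq> 0"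
    and dev: "\<And>i. i \<in> {1..n} \<Longrightarrow> (z i - sample_mean n z)\<^sup>2 \<le> (\<delta> / 2)\<^sup>2 * centered_sumsq n z n"
  shows "V > 0" and "i \<in> {1..n} \<Longrightarrow> \<bar>z i - \<mu>\<bar> \<le> \<delta> * V"
proof -
  have "0 < 4 / \<delta>\<^sup>2" using \<delta> by simp
  then have n0: "real n > 0" using n by linarith
  define S where "S = (\<Sum>i=1..n. (z i - \<mu>)\<^sup>2)"
  define D where "D = centered_sumsq n z n"
  define m where "m = sample_mean n z - \<mu>"
  have sum: "(\<Sum>i=1..n. z i - \<mu>) = real n * m"
    using n0 by (simp add: m_def sample_mean_def sum_subtractf field_simps)
  define x where "x i = z i - \<mu>" for i
  have "(z i - sample_mean n z)\<^sup>2 = (x i)\<^sup>2 - 2 * m * x i + m\<^sup>2" for i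
    by (simp add: m_def x_def power2_eq_square algebra_simps)
  then have "D = (\<Sum>i=1..n. (x i)\<^sup>2) - 2 * m * (\<Sum>i=1..n. x i) + real n * m\<^sup>2"
    by (simp add: D_def sum.distrib sum_subtractf sum_distrib_left)
  then have DS: "D = S - real n * m\<^sup>2"
    unfolding S_def x_def sum by (simp add: power2_eq_square)
  have D: "D > 0" using nondeg unfolding D_def by (simp add: order_less_le sum_nonneg)
  have nm: "0 \<le> real n * m\<^sup>2" by simp
  have le: "D \<le> S" "real n * m\<^sup>2 \<le> S" using DS D nm by linarith+
  have S: "S > 0" using D le by linarith
  then show V: "V > 0" by (simp add: V_def S_def)
  have V2: "V\<^sup>2 = S" using S by (simp add: V_def S_def)
  assume i: "i \<in> {1..n}"
  have "(z i - sample_mean n z)\<^sup>2 \<le> (\<delta> / 2)\<^sup>2 * D" using dev[OF i] unfolding D_def .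
  also have "\<dots> \<le> (\<delta> / 2)\<^sup>2 * S" using le(1) by (intro mult_left_mono) simp_all
  also have "\<dots> = (\<delta> / 2 * V)\<^sup>2"
    unfolding V2[symmetric] by (rule power_mult_distrib[symmetric])
  finally have 1: "\<bar>z i - sample_mean n z\<bar> \<le> \<delta> / 2 * V"
    using V \<delta> by (subst (asm) power2_le_iff_abs_le) simp_all
  have "4 \<le> \<delta>\<^sup>2 * real n" using n \<delta> by (simp add: field_simps)
  then have "4 * m\<^sup>2 \<le> \<delta>\<^sup>2 * real n * m\<^sup>2" by (rule mult_right_mono) simp
  also have "\<dots> \<le> \<delta>\<^sup>2 * S" using mult_left_mono[OF le(2), of "\<delta>\<^sup>2"] by (simp add: mult.assoc)
  also have "\<dots> = 4 * (\<delta> / 2 * V)\<^sup>2" by (simp add: V2[symmetric] power_mult_distrib power_divide)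
  finally have "m\<^sup>2 \<le> (\<delta> / 2 * V)\<^sup>2" by simp
  then have 2: "\<bar>m\<bar> \<le> \<delta> / 2 * V"
    using V \<delta> by (subst (asm) power2_le_iff_abs_le) simp_all
  have "z i - \<mu> = (z i - sample_mean n z) + m" by (simp add: m_def)
  then show "\<bar>z i - \<mu>\<bar> \<le> \<delta> * V" using 1 2 by linarith
qed

text \<open>Composing \<open>h\<close> with a bounded continuous \<open>\<psi>\<close> yields a
  bounded functional with no new discontinuities, and integrals of such \<open>\<psi>\<close>
  characterize weak convergence on the line. Hence expectations of functionals bounded by 1
  suffice.\<close>

lemma converges_in_distr_cadlagI:
  assumes W: "std_wiener_process N W" and M: "prob_space M"
    and X: "\<And>n. X n \<in> measurable M cadlag_sigma"
    and lim: "\<And>h. h \<in> borel_measurable cadlag_sigma \<Longrightarrow> (\<And>f. \<bar>h f\<bar> \<le> 1) \<Longrightarrow>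
      AE \<omega> in N. sup_continuous_at h (\<lambda>t\<in>{0..1}. W t \<omega>) \<Longrightarrow>
      (\<lambda>n. \<integral>\<omega>. h (X n \<omega>) \<partial>M) \<longlonglongrightarrow> (\<integral>\<omega>. h (\<lambda>t\<in>{0..1}. W t \<omega>) \<partial>N)"
  shows "converges_in_distr_cadlag M X N (\<lambda>\<omega>. \<lambda>t\<in>{0..1}. W t \<omega>)"
  unfolding converges_in_distr_cadlag_def
proof (intro ballI impI)
  interpret std_wiener_process N W by fact
  interpret M: prob_space M by fact
  fix h assume h: "h \<in> borel_measurable cadlag_sigma"
    and null: "{f \<in> cadlag01. \<not> sup_continuous_at h f} \<in> null_sets (distr N cadlag_sigma (\<lambda>\<omega>. path \<omega>))"
  have "AE f in distr N cadlag_sigma (\<lambda>\<omega>. path \<omega>). f \<notin> {f \<in> cadlag01. \<not> sup_continuous_at h f}"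
    by (rule AE_not_in[OF null])
  from AE_distrD[OF measurable_path this] AE_space
  have cont: "AE \<omega> in N. sup_continuous_at h (path \<omega>)"
  proof eventually_elim
    case (elim \<omega>)
    then show ?case using path_in_cadlag01[OF elim(2)] by blast
  qed
  have hX: "(\<lambda>\<omega>. h (X n \<omega>)) \<in> borel_measurable M" for n
    by (rule measurable_compose[OF X h])
  have hW: "(\<lambda>\<omega>. h (path \<omega>)) \<in> borel_measurable N"
    by (rule measurable_compose[OF measurable_path h])
  show "weak_conv_m (\<lambda>n. distr M borel (\<lambda>\<omega>. h (X n \<omega>))) (distr N borel (\<lambda>\<omega>. h (path \<omega>)))"
  proof (rule integral_bdd_continuous_conv_imp_weak_conv)
    show "real_distribution (distr M borel (\<lambda>\<omega>. h (X n \<omega>)))" for n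
      by (rule M.real_distribution_distr[OF hX])
    show "real_distribution (distr N borel (\<lambda>\<omega>. h (path \<omega>)))"
      by (rule real_distribution_distr[OF hW])
    fix \<psi> :: "real \<Rightarrow> real" assume \<psi>: "\<And>x. isCont \<psi> x" "\<And>x. \<bar>\<psi> x\<bar> \<le> 1"
    have \<psi>_meas: "\<psi> \<in> borel_measurable borel"
      by (intro borel_measurable_continuous_onI continuous_at_imp_continuous_on ballI \<psi>(1))
    have "AE \<omega> in N. sup_continuous_at (\<lambda>f. \<psi> (h f)) (path \<omega>)"
      using cont AE_space
    proof eventually_elim
      case (elim \<omega>)
      note f = path_in_cadlag01[OF elim(2)]
      show ?case
        using elim(1) unfolding sup_continuous_at_iff[OF f] by (rule isCont_tendsto_compose[OF \<psi>(1)])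
    qed
    from lim[OF measurable_compose[OF h \<psi>_meas] \<psi>(2) this]
    have "(\<lambda>n. \<integral>\<omega>. \<psi> (h (X n \<omega>)) \<partial>M) \<longlonglongrightarrow> (\<integral>\<omega>. \<psi> (h (path \<omega>)) \<partial>N)" .
    then show "(\<lambda>n. integral\<^sup>L (distr M borel (\<lambda>\<omega>. h (X n \<omega>))) \<psi>) \<longlonglongrightarrow> integral\<^sup>L (distr N borel (\<lambda>\<omega>. h (path \<omega>))) \<psi>"
      by (simp only: integral_distr[OF hX \<psi>_meas] integral_distr[OF hW \<psi>_meas])
  qed
qed

text \<open>With the observations held fixed, the expectation over the signs is close to the Wiener
  expectation unless the sum of squares is zero or some deviation is large. On that exceptional
  event, whose probability vanishes, the error is at most 2.\<close>

lemma converges_if_max_ratio_negligible: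
  fixes Z :: "nat \<Rightarrow> 'a \<Rightarrow> real"
  assumes M: "prob_space M" and ind: "prob_space.indep_vars M (\<lambda>_. borel) Z {1..}"
    and sym: "\<And>i. i \<ge> 1 \<Longrightarrow> symmetric_around M (Z i) \<mu>"
    and W: "std_wiener_process N W"
    and ratio: "ratio_tendsto_0_in_prob M
           (\<lambda>n \<omega>. MAX i\<in>{1..n}. (Z i \<omega> - sample_mean n (\<lambda>j. Z j \<omega>))\<^sup>2)
           (\<lambda>n \<omega>. \<Sum>i=1..n. (Z i \<omega> - sample_mean n (\<lambda>j. Z j \<omega>))\<^sup>2)"
  shows "converges_in_distr_cadlag M (\<lambda>n \<omega>. student_process n \<mu> (\<lambda>i. Z i \<omega>)) N (\<lambda>\<omega>. \<lambda>t\<in>{0..1}. W t \<omega>)"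
proof (rule converges_in_distr_cadlagI[OF W M])
  interpret M: prob_space M by fact
  interpret std_wiener_process N W by fact
  have Z: "Z i \<in> borel_measurable M" if "i \<ge> 1" for i
    using ind that unfolding M.indep_vars_def by auto
  show X: "(\<lambda>\<omega>. student_process n \<mu> (\<lambda>i. Z i \<omega>)) \<in> measurable M cadlag_sigma" for n
    by (rule measurable_student_process) (rule Z, simp)
  let ?S = "\<lambda>n \<omega>. centered_sumsq n (\<lambda>i. Z i \<omega>) n"
  let ?d = "\<lambda>n i \<omega>. (Z i \<omega> - sample_mean n (\<lambda>j. Z j \<omega>))\<^sup>2"
  have mean: "(\<lambda>\<omega>. sample_mean n (\<lambda>j. Z j \<omega>)) \<in> borel_measurable M" for n
    unfolding sample_mean_def by (intro borel_measurable_sum borel_measurable_divide borel_measurable_const Z) simp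
  have d: "?d n i \<in> borel_measurable M" if "i \<in> {1..n}" for n i
    by (intro borel_measurable_power borel_measurable_diff mean Z) (use that in simp)
  have S [measurable]: "?S n \<in> borel_measurable M" for n
    by (rule borel_measurable_sum) (rule d)
  fix h :: "(real \<Rightarrow> real) \<Rightarrow> real"
  assume h: "h \<in> borel_measurable cadlag_sigma" and bounded: "\<And>f. \<bar>h f\<bar> \<le> 1"
    and cont: "AE \<omega> in N. sup_continuous_at h (path \<omega>)"
  define c where "c = expectation (\<lambda>\<omega>. h (path \<omega>))"
  have c: "\<bar>c\<bar> \<le> 1"
  proof -
    have "\<bar>c\<bar> \<le> expectation (\<lambda>\<omega>. \<bar>h (path \<omega>)\<bar>)" unfolding c_def by (rule integral_abs_bound)
    also have "\<dots> \<le> expectation (\<lambda>_. 1)"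
      by (intro integral_mono' integrable_const) (simp_all add: bounded)
    finally show ?thesis by (simp add: prob_space)
  qed
  have bad_limit: "(\<lambda>n. measure M {\<omega> \<in> space M. ?S n \<omega> = 0 \<or> (\<exists>i\<in>{1..n}. \<epsilon> * ?S n \<omega> < ?d n i \<omega>)}) \<longlonglongrightarrow> 0"
    if "\<epsilon> > 0" for \<epsilon>
  proof -
    let ?A = "\<lambda>n. {\<omega> \<in> space M. ?S n \<omega> = 0 \<or> (\<exists>i\<in>{1..n}. \<epsilon> * ?S n \<omega> < ?d n i \<omega>)}"
    let ?R = "\<lambda>n. {\<omega> \<in> space M. \<bar>(MAX i\<in>{1..n}. ?d n i \<omega>) / ?S n \<omega>\<bar> > \<epsilon>}"
    have zero: "measure M {\<omega> \<in> space M. ?S n \<omega> = 0} = 1 - measure M {\<omega> \<in> space M. ?S n \<omega> \<noteq> 0}" for n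
    proof -
      have "{\<omega> \<in> space M. ?S n \<omega> \<noteq> 0} \<in> sets M" by measurable
      from M.prob_neg[OF this] show ?thesis by (simp only: not_not)
    qed
    have sub: "?A n \<subseteq> {\<omega> \<in> space M. ?S n \<omega> = 0} \<union> ?R n" for n
    proof
      fix \<omega> assume \<omega>: "\<omega> \<in> ?A n"
      show "\<omega> \<in> {\<omega> \<in> space M. ?S n \<omega> = 0} \<union> ?R n"
      proof (cases "?S n \<omega> = 0")
        case False
        then have pos: "?S n \<omega> > 0" by (simp add: order_less_le sum_nonneg)
        obtain i where i: "i \<in> {1..n}" "\<epsilon> * ?S n \<omega> < ?d n i \<omega>" using \<omega> False by blast
        have "?d n i \<omega> \<le> (MAX i\<in>{1..n}. ?d n i \<omega>)" using i(1) by (intro Max_ge) auto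
        with i(2) have "\<epsilon> * ?S n \<omega> < (MAX i\<in>{1..n}. ?d n i \<omega>)" by linarith
        then have "\<epsilon> < (MAX i\<in>{1..n}. ?d n i \<omega>) / ?S n \<omega>" using pos by (simp only: pos_less_divide_eq)
        then have "\<epsilon> < \<bar>(MAX i\<in>{1..n}. ?d n i \<omega>) / ?S n \<omega>\<bar>" by linarith
        then show ?thesis using \<omega> by blast
      qed (use \<omega> in blast)
    qed
    have R: "?R n \<in> sets M" for n
      by (intro borel_measurable_less borel_measurable_const borel_measurable_abs borel_measurable_divide
          borel_measurable_Max S d) simp_all
    have S0: "{\<omega> \<in> space M. ?S n \<omega> = 0} \<in> sets M" for n by measurable
    have le: "measure M (?A n) \<le> (1 - measure M {\<omega> \<in> space M. ?S n \<omega> \<noteq> 0}) + measure M (?R n)" for n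
    proof -
      have "measure M (?A n) \<le> measure M ({\<omega> \<in> space M. ?S n \<omega> = 0} \<union> ?R n)"
        by (rule M.finite_measure_mono[OF sub]) (intro sets.Un R S0)
      also have "\<dots> \<le> measure M {\<omega> \<in> space M. ?S n \<omega> = 0} + measure M (?R n)"
        by (rule measure_Un_le[OF S0 R])
      finally show ?thesis unfolding zero .
    qed
    have "(\<lambda>n. (1 - measure M {\<omega> \<in> space M. ?S n \<omega> \<noteq> 0}) + measure M (?R n)) \<longlonglongrightarrow> (1 - 1) + 0"
      using ratio \<open>\<epsilon> > 0\<close> unfolding ratio_tendsto_0_in_prob_def by (intro tendsto_intros) blast+
    then have lim0: "(\<lambda>n. (1 - measure M {\<omega> \<in> space M. ?S n \<omega> \<noteq> 0}) + measure M (?R n)) \<longlonglongrightarrow> 0"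
      by (simp only: diff_self add_0_right)
    show ?thesis
    proof (rule tendsto_sandwich[OF _ _ tendsto_const lim0])
      show "\<forall>\<^sub>F n in sequentially. 0 \<le> measure M (?A n)"
        by (rule always_eventually) (rule allI, rule measure_nonneg)
      show "\<forall>\<^sub>F n in sequentially. measure M (?A n)
          \<le> (1 - measure M {\<omega> \<in> space M. ?S n \<omega> \<noteq> 0}) + measure M (?R n)"
        by (rule always_eventually) (rule allI, rule le)
    qed
  qed
  show "(\<lambda>n. \<integral>\<omega>. h (student_process n \<mu> (\<lambda>i. Z i \<omega>)) \<partial>M) \<longlonglongrightarrow> (\<integral>\<omega>. h (path \<omega>) \<partial>N)"
    unfolding c_def[symmetric]
  proof (rule LIMSEQ_I)
    fix \<epsilon> :: real assume \<epsilon>: "\<epsilon> > 0"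
    then have "\<epsilon> / 2 > 0" by simp
    from rademacher_functional_limit[OF h bounded cont this] obtain \<delta> where \<delta>: "\<delta> > 0"
      and approx: "\<And>n a. (\<Sum>i=1..n. (a i)\<^sup>2) = 1 \<Longrightarrow> (\<And>i. i \<in> {1..n} \<Longrightarrow> \<bar>a i\<bar> \<le> \<delta>) \<Longrightarrow>
      \<bar>measure_pmf.expectation (rademacher n) (\<lambda>e. h (student_process n 0 (\<lambda>i. e i * a i))) - c\<bar> \<le> \<epsilon> / 2"
      unfolding c_def by blast
    \<comment> \<open>The threshold \<open>(\<delta> / 2)\<^sup>2\<close> is the one under which
      \<open>observation_small_relative_to_norm\<close> gives entries of size at most
      \<open>\<delta>\<close>.\<close>
    let ?A = "\<lambda>n. {\<omega> \<in> space M. ?S n \<omega> = 0 \<or> (\<exists>i\<in>{1..n}. (\<delta> / 2)\<^sup>2 * ?S n \<omega> < ?d n i \<omega>)}"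
    have A: "?A n \<in> sets M" for n
    proof -
      have "{\<omega> \<in> space M. (\<delta> / 2)\<^sup>2 * ?S n \<omega> < ?d n i \<omega>} \<in> sets M" if "i \<in> {1..n}" for i
        using d[OF that] by (intro borel_measurable_less borel_measurable_times borel_measurable_const S)
      then have "(\<Union>i\<in>{1..n}. {\<omega> \<in> space M. (\<delta> / 2)\<^sup>2 * ?S n \<omega> < ?d n i \<omega>}) \<in> sets M"
        by (intro sets.finite_UN) simp_all
      moreover have "{\<omega> \<in> space M. ?S n \<omega> = 0} \<in> sets M" by measurable
      moreover have "?A n = {\<omega> \<in> space M. ?S n \<omega> = 0} \<union> (\<Union>i\<in>{1..n}. {\<omega> \<in> space M. (\<delta> / 2)\<^sup>2 * ?S n \<omega> < ?d n i \<omega>})"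
        by blast
      ultimately show ?thesis by (simp only: sets.Un)
    qed
    \<comment> \<open>The conditional expectation given the observations, once independent signs
      have been attached to them.\<close>
    define G where "G n \<omega> = measure_pmf.expectation (rademacher n)
      (\<lambda>e. h (student_process n 0 (\<lambda>i. e i * (Z i \<omega> - \<mu>))))" for n \<omega>
    have G_bound: "\<bar>G n \<omega>\<bar> \<le> 1" for n \<omega>
    proof -
      have "\<bar>G n \<omega>\<bar> \<le> measure_pmf.expectation (rademacher n)
          (\<lambda>e. \<bar>h (student_process n 0 (\<lambda>i. e i * (Z i \<omega> - \<mu>)))\<bar>)"
        unfolding G_def by (rule integral_abs_bound)
      also have "\<dots> \<le> measure_pmf.expectation (rademacher n) (\<lambda>_. 1)"
        by (rule integral_mono) (simp_all add: bounded)
      finally show ?thesis by simp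
    qed
    have G_meas: "G n \<in> borel_measurable M" for n
    proof -
      have "G n = (\<lambda>\<omega>. \<Sum>e\<in>set_pmf (rademacher n). pmf (rademacher n) e * h (student_process n 0 (\<lambda>i. e i * (Z i \<omega> - \<mu>))))"
        unfolding G_def by (rule ext) (subst integral_measure_pmf[OF finite_set_rademacher], simp_all)
      moreover have "(\<lambda>\<omega>. h (student_process n 0 (\<lambda>i. e i * (Z i \<omega> - \<mu>)))) \<in> borel_measurable M" for e
        by (rule measurable_compose[OF measurable_student_process h])
          (intro borel_measurable_times borel_measurable_diff borel_measurable_const Z, simp)
      ultimately show ?thesis by simp
    qed
    have close: "\<bar>G n \<omega> - c\<bar> \<le> \<epsilon> / 2 + 2 * indicator (?A n) \<omega>"
      if n: "4 / \<delta>\<^sup>2 \<le> real n" and \<omega>: "\<omega> \<in> space M" for n \<omega>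
    proof (cases "\<omega> \<in> ?A n")
      case True
      then have "indicator (?A n) \<omega> = (1 :: real)" by (rule indicator_simps)
      then show ?thesis using G_bound[of n \<omega>] c \<epsilon> by (simp only:)
    next
      case False
      define V where "V = sqrt (\<Sum>i=1..n. (Z i \<omega> - \<mu>)\<^sup>2)"
      have nondeg: "?S n \<omega> \<noteq> 0" using False \<omega> by blast
      have dev: "?d n i \<omega> \<le> (\<delta> / 2)\<^sup>2 * ?S n \<omega>" if "i \<in> {1..n}" for i
        using False \<omega> that by (intro leI) blast
      note small = observation_small_relative_to_norm[where n = n and z = "\<lambda>i. Z i \<omega>" and \<mu> = \<mu>, OF n \<delta> nondeg, folded V_def]
      have V: "V > 0" by (rule small(1)[OF dev])
      have V2: "V\<^sup>2 = (\<Sum>i=1..n. (Z i \<omega> - \<mu>)\<^sup>2)" unfolding V_def by (simp add: sum_nonneg)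
      have one: "(\<Sum>i=1..n. ((Z i \<omega> - \<mu>) / V)\<^sup>2) = 1"
      proof -
        have "(\<Sum>i=1..n. ((Z i \<omega> - \<mu>) / V)\<^sup>2) = (\<Sum>i=1..n. (Z i \<omega> - \<mu>)\<^sup>2) / V\<^sup>2"
          by (simp only: power_divide sum_divide_distrib)
        then show ?thesis using V unfolding V2[symmetric] by simp
      qed
      have le: "\<bar>(Z i \<omega> - \<mu>) / V\<bar> \<le> \<delta>" if "i \<in> {1..n}" for i
        using small(2)[OF dev that] V by (simp add: field_simps)
      \<comment> \<open>Scale invariance undoes the division by \<open>V\<close>, so the estimate
        for normalized arrays applies to the raw observations.\<close>
      have "student_process n 0 (\<lambda>i. e i * ((Z i \<omega> - \<mu>) / V)) = student_process n 0 (\<lambda>i. e i * (Z i \<omega> - \<mu>))" for e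
        using student_process_scale[of "1 / V" n "\<lambda>i. e i * (Z i \<omega> - \<mu>)"] V by simp
      then have "\<bar>G n \<omega> - c\<bar> \<le> \<epsilon> / 2"
        using approx[OF one le] by (simp add: G_def)
      moreover have "indicator (?A n) \<omega> = (0 :: real)" using False by (rule indicator_simps)
      ultimately show ?thesis by simp
    qed
    have sym_eq: "(\<integral>\<omega>. h (student_process n \<mu> (\<lambda>i. Z i \<omega>)) \<partial>M) = (\<integral>\<omega>. G n \<omega> \<partial>M)" if n: "n > 0" for n
    proof -
      have "(\<integral>\<omega>. h (student_process n 0 (\<lambda>i. Z i \<omega> - \<mu>)) \<partial>M) = (\<integral>\<omega>. G n \<omega> \<partial>M)"
        unfolding G_def
      proof (rule expectation_rademacher_symmetrization[OF M _ _ n, where F = "\<lambda>x. h (student_process n 0 x)" and X = "\<lambda>i \<omega>. Z i \<omega> - \<mu>" and B = 1])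
        have "M.indep_vars (\<lambda>_. borel) Z {1..n}" by (rule M.indep_vars_subset[OF ind]) auto
        then show "M.indep_vars (\<lambda>_. borel) (\<lambda>i \<omega>. Z i \<omega> - \<mu>) {1..n}"
          by (rule M.indep_vars_compose2) simp
        show "distr M borel (\<lambda>\<omega>. Z i \<omega> - \<mu>) = distr M borel (\<lambda>\<omega>. - (Z i \<omega> - \<mu>))" if "i \<in> {1..n}" for i
          using sym[of i] that by (simp add: symmetric_around_def)
        show "(\<lambda>x. h (student_process n 0 x)) \<in> borel_measurable (PiM {1..n} (\<lambda>_. borel))"
          by (rule measurable_compose[OF _ h], rule measurable_student_process) (rule measurable_component_singleton)
        show "h (student_process n 0 (restrict x {1..n})) = h (student_process n 0 x)" for x
          by (rule arg_cong[of _ _ h], rule student_process_cong) simp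
      qed (rule bounded)
      then show ?thesis by (simp only: student_process_center[of n \<mu>])
    qed
    have "(\<delta> / 2)\<^sup>2 > 0" using \<delta> by simp
    \<comment> \<open>The exceptional event is weighted by 2, which leaves
      \<open>\<epsilon> / 2\<close> for the approximation at regular observations.\<close>
    from order_tendstoD(2)[OF bad_limit[OF this], of "\<epsilon> / 4"] \<epsilon>
    have ev: "\<forall>\<^sub>F n in sequentially. measure M (?A n) < \<epsilon> / 4" by simp
    obtain n0 :: nat where n0: "4 / \<delta>\<^sup>2 \<le> real n0" using real_arch_simple by blast
    have "\<forall>\<^sub>F n in sequentially. norm ((\<integral>\<omega>. h (student_process n \<mu> (\<lambda>i. Z i \<omega>)) \<partial>M) - c) < \<epsilon>"
      using ev eventually_ge_at_top[of "Suc n0"]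
    proof eventually_elim
      case (elim n)
      have n: "4 / \<delta>\<^sup>2 \<le> real n" "n > 0" using n0 elim(2) by (linarith, simp)
      have G_int: "integrable M (G n)"
        by (rule M.integrable_const_bound[where B = 1]) (simp_all add: G_bound G_meas)
      have "\<bar>(\<integral>\<omega>. G n \<omega> \<partial>M) - c\<bar> = \<bar>\<integral>\<omega>. G n \<omega> - c \<partial>M\<bar>"
        using G_int by (simp add: M.prob_space)
      also have "\<dots> \<le> (\<integral>\<omega>. \<bar>G n \<omega> - c\<bar> \<partial>M)" by (rule integral_abs_bound)
      also have "\<dots> \<le> (\<integral>\<omega>. \<epsilon> / 2 + 2 * indicator (?A n) \<omega> \<partial>M)"
      proof (rule integral_mono)
        show "integrable M (\<lambda>\<omega>. \<epsilon> / 2 + 2 * indicator (?A n) \<omega> :: real)"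
          using A[of n] by (intro Bochner_Integration.integrable_add integrable_mult_right M.integrable_const
            integrable_real_indicator) (simp_all add: M.emeasure_eq_measure)
        show "\<bar>G n \<omega> - c\<bar> \<le> \<epsilon> / 2 + 2 * indicator (?A n) \<omega>" if "\<omega> \<in> space M" for \<omega>
          by (rule close[OF n(1) that])
      qed (use G_int in simp)
      also have "\<dots> = \<epsilon> / 2 + 2 * measure M (?A n)"
      proof -
        have "integrable M (indicator (?A n) :: _ \<Rightarrow> real)"
          using A[of n] by (intro integrable_real_indicator) (simp_all add: M.emeasure_eq_measure)
        then show ?thesis using A[of n] by (simp add: M.prob_space)
      qed
      finally have "\<bar>(\<integral>\<omega>. G n \<omega> \<partial>M) - c\<bar> < \<epsilon>" using elim(1) by linarith
      then show ?case unfolding sym_eq[OF n(2)] by simp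
    qed
    then show "\<exists>no. \<forall>n\<ge>no. norm ((\<integral>\<omega>. h (student_process n \<mu> (\<lambda>i. Z i \<omega>)) \<partial>M) - c) < \<epsilon>"
      unfolding eventually_sequentially .
  qed
qed

theorem corollary1:
  fixes M :: "'a measure" and Z :: "nat \<Rightarrow> 'a \<Rightarrow> real" and \<mu> :: real
    and N :: "'b measure" and W :: "real \<Rightarrow> 'b \<Rightarrow> real"
  assumes "prob_space M"
    and "prob_space.indep_vars M (\<lambda>_. borel) Z {1..}"
    and "\<And>i. i \<ge> 1 \<Longrightarrow> integrable M (Z i)"
    and "\<And>i. i \<ge> 1 \<Longrightarrow> (\<integral>\<omega>. Z i \<omega> \<partial>M) = \<mu>"
    and "\<And>i. i \<ge> 1 \<Longrightarrow> symmetric_around M (Z i) \<mu>"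
    and "std_wiener_process N W"
  shows "converges_in_distr_cadlag
           M (\<lambda>n \<omega>. student_process n \<mu> (\<lambda>i. Z i \<omega>))
           N (\<lambda>\<omega>. \<lambda>t\<in>{0..1}. W t \<omega>)
         \<longleftrightarrow>
         ratio_tendsto_0_in_prob M
           (\<lambda>n \<omega>. MAX i\<in>{1..n}. (Z i \<omega> - sample_mean n (\<lambda>j. Z j \<omega>))\<^sup>2)
           (\<lambda>n \<omega>. \<Sum>i=1..n. (Z i \<omega> - sample_mean n (\<lambda>j. Z j \<omega>))\<^sup>2)"
proof
  assume "converges_in_distr_cadlag
           M (\<lambda>n \<omega>. student_process n \<mu> (\<lambda>i. Z i \<omega>))
           N (\<lambda>\<omega>. \<lambda>t\<in>{0..1}. W t \<omega>)"
  then show "ratio_tendsto_0_in_prob M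
           (\<lambda>n \<omega>. MAX i\<in>{1..n}. (Z i \<omega> - sample_mean n (\<lambda>j. Z j \<omega>))\<^sup>2)
           (\<lambda>n \<omega>. \<Sum>i=1..n. (Z i \<omega> - sample_mean n (\<lambda>j. Z j \<omega>))\<^sup>2)"
    by (intro max_ratio_negligible_if_converges[OF assms(1) _ assms(6)] borel_measurable_integrable assms(3))
next
  assume "ratio_tendsto_0_in_prob M
           (\<lambda>n \<omega>. MAX i\<in>{1..n}. (Z i \<omega> - sample_mean n (\<lambda>j. Z j \<omega>))\<^sup>2)
           (\<lambda>n \<omega>. \<Sum>i=1..n. (Z i \<omega> - sample_mean n (\<lambda>j. Z j \<omega>))\<^sup>2)"
  then show "converges_in_distr_cadlag
           M (\<lambda>n \<omega>. student_process n \<mu> (\<lambda>i. Z i \<omega>))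
           N (\<lambda>\<omega>. \<lambda>t\<in>{0..1}. W t \<omega>)"
    by (intro converges_if_max_ratio_negligible[OF assms(1,2) _ assms(6)] assms(5))
qed

end
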